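(* For $r \in \mathbb{R}$ and $T>0$ let $$\mathscr{E}_T(r):=\left\{\Lambda\in\mathscr{L}_2:\ \max_{0\leq t\leq T} \log\alpha_1(u_t\Lambda)\leq r+\tfrac12\log T\right\}.$$ Then the limit $$F(r):=\lim_{T\to\infty}\mu(\mathscr{E}_T(r))$$ exists for all $r\in\mathbb{R}$ and defines a continuous function of $r\in\mathbb{R}$. Furthermore: (1) For all $r>0$, $$F(r)=1-\frac{3}{\pi^2}e^{-2r}.$$ (2) For all $-\frac12\log 2<r\leq 0$, $$F(r)=1-\frac{3}{\pi^2}\left(-e^{-2r}+4r^2-4r+2\right).$$ (3) There exist positive constants $C_0, C_1$ such that for all $r\le-\frac12\log 2$, $$C_0e^{2r}\le F(r)\le C_1e^{2r}.$$
   Context: $\mathscr{L}_2$ denotes the space of unimodular lattices (covolume $1$) in $\mathbb{R}^2$, identified with $\mathrm{SL}_2(\mathbb{R})/\mathrm{SL}_2(\mathbb{Z})$ via $g\,\mathrm{SL}_2(\mathbb{Z})\mapsto g\mathbb{Z}^2$; $\mathrm{SL}_2(\mathbb{R})$ acts on $\mathscr{L}_2$ by its linear action on $\mathbb{R}^2$. $\mu$ is the $\mathrm{SL}_2(\mathbb{R})$-invariant probability measure on $\mathscr{L}_2$ induced by the Haar measure on $\mathrm{SL}_2(\mathbb{R})$. For $\Lambda\in\mathscr{L}_2$, $\alpha_1(\Lambda):=\sup_{0\neq v\in\Lambda}\frac{1}{\|v\|}$, where $\|\cdot\|$ is the Euclidean norm. The unipotent flow is given by $u_t=\begin{pmatrix}1&t\\0&1\end{pmatrix}$,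 $t\in\mathbb{R}$. *)

theory Defs
  imports "HOL-Analysis.Analysis"
begin

definition SL2 :: "(real^2^2) set" where
  "SL2 = {g. det g = 1}"

definition lattice_of :: "real^2^2 \<Rightarrow> (real^2) set" where
  "lattice_of g = (*v) g ` {n. \<forall>i. n $ i \<in> \<int>}"

text \<open>The columns of \<open>g\<close> are a basis of \<open>lattice_of g\<close>, so its covolume is \<open>\<bar>det g\<bar>\<close>.\<close>

definition unimodular_lattices :: "(real^2) set set" where
  "unimodular_lattices = {lattice_of g | g. \<bar>det g\<bar> = 1}"

definition act :: "real^2^2 \<Rightarrow> (real^2) set \<Rightarrow> (real^2) set" where
  "act g \<Lambda> = (*v) g ` \<Lambda>"

lemma lattice_of_mult: "lattice_of (g ** h) = act g (lattice_of h)"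
  unfolding lattice_of_def act_def image_image matrix_vector_mul_assoc ..

lemma unimodular_lattices_eq: "unimodular_lattices = lattice_of ` SL2"
proof
  show "lattice_of ` SL2 \<subseteq> unimodular_lattices"
    by (auto simp: unimodular_lattices_def SL2_def)
  show "unimodular_lattices \<subseteq> lattice_of ` SL2"
  proof
    fix \<Lambda> assume "\<Lambda> \<in> unimodular_lattices"
    then obtain g where g: "\<Lambda> = lattice_of g" "\<bar>det g\<bar> = 1"
      by (auto simp: unimodular_lattices_def)
    show "\<Lambda> \<in> lattice_of ` SL2"
    proof (cases "det g = 1")
      case True
      then show ?thesis using g by (auto simp: SL2_def)
    next
      case False
      define s :: "real^2^2" where "s = vector [vector [-1, 0], vector [0, 1]]"
      have s: "s *v n = vector [- n $ 1, n $ 2]" for n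
        by (simp add: s_def vec_eq_iff matrix_vector_mult_def sum_2 forall_2)
      have "det s = -1" by (simp add: s_def det_2)
      moreover have "det g = -1" using False g(2) by linarith
      ultimately have "det (g ** s) = 1" by (simp add: det_mul)
      moreover have "lattice_of s = {n. \<forall>i. n $ i \<in> \<int>}"
      proof -
        have "n = s *v (s *v n)" for n
          by (simp add: s vec_eq_iff forall_2)
        moreover have "(\<forall>i. (s *v n) $ i \<in> \<int>) \<longleftrightarrow> (\<forall>i. n $ i \<in> \<int>)" for n
          by (simp add: s forall_2)
        ultimately show ?thesis
          unfolding lattice_of_def by blast
      qed
      then have "lattice_of (g ** s) = lattice_of g"
        unfolding lattice_of_mult by (simp only: act_def lattice_of_def)
      ultimately show ?thesis using g by (auto simp: SL2_def)
    qed
  qed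
qed

text \<open>The quotient topology of \<open>SL\<^sub>2(\<real>)/SL\<^sub>2(\<int>)\<close>, carried by the lattices
  \<open>g\<int>\<^sup>2\<close> themselves.\<close>

definition lattice_topology :: "(real^2) set topology" where
  "lattice_topology = topology (\<lambda>U. U \<subseteq> unimodular_lattices \<and>
     openin (top_of_set SL2) {g \<in> SL2. lattice_of g \<in> U})"

lemma openin_lattice_topology:
  "openin lattice_topology U \<longleftrightarrow>
     U \<subseteq> unimodular_lattices \<and> openin (top_of_set SL2) {g \<in> SL2. lattice_of g \<in> U}"
proof -
  have "istopology (\<lambda>U. U \<subseteq> unimodular_lattices \<and>
     openin (top_of_set SL2) {g \<in> SL2. lattice_of g \<in> U})"
    unfolding istopology_def
  proof (intro conjI allI impI)
    fix S T :: "(real^2) set set"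
    assume "S \<subseteq> unimodular_lattices \<and> openin (top_of_set SL2) {g \<in> SL2. lattice_of g \<in> S}"
      and "T \<subseteq> unimodular_lattices \<and> openin (top_of_set SL2) {g \<in> SL2. lattice_of g \<in> T}"
    moreover have "{g \<in> SL2. lattice_of g \<in> S \<inter> T} =
      {g \<in> SL2. lattice_of g \<in> S} \<inter> {g \<in> SL2. lattice_of g \<in> T}" by auto
    ultimately show "S \<inter> T \<subseteq> unimodular_lattices"
      "openin (top_of_set SL2) {g \<in> SL2. lattice_of g \<in> S \<inter> T}" by auto
  next
    fix K :: "(real^2) set set set"
    assume K: "\<forall>S\<in>K. S \<subseteq> unimodular_lattices \<and> openin (top_of_set SL2) {g \<in> SL2. lattice_of g \<in> S}"
    then show "\<Union>K \<subseteq> unimodular_lattices" by auto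
    have "{g \<in> SL2. lattice_of g \<in> \<Union>K} = (\<Union>S\<in>K. {g \<in> SL2. lattice_of g \<in> S})" by auto
    then show "openin (top_of_set SL2) {g \<in> SL2. lattice_of g \<in> \<Union>K}"
      using K by auto
  qed
  then show ?thesis by (simp add: lattice_topology_def)
qed

lemma topspace_lattice_topology: "topspace lattice_topology = unimodular_lattices"
proof -
  have "{g \<in> SL2. lattice_of g \<in> unimodular_lattices} = SL2"
    by (auto simp: unimodular_lattices_eq)
  then have "openin lattice_topology unimodular_lattices"
    by (simp add: openin_lattice_topology)
  then show ?thesis
    unfolding topspace_def by (auto simp: openin_lattice_topology)
qed

lemma quotient_map_lattice_of: "quotient_map (top_of_set SL2) lattice_topology lattice_of"
  by (simp add: quotient_map_def topspace_lattice_topology openin_lattice_topology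
      unimodular_lattices_eq)

definition borel_lattices :: "(real^2) set measure" where
  "borel_lattices = sigma unimodular_lattices {U. openin lattice_topology U}"

lemma space_borel_lattices [simp]: "space borel_lattices = unimodular_lattices"
  by (simp add: borel_lattices_def space_measure_of_conv)

lemma act_measurable:
  assumes "g \<in> SL2"
  shows "act g \<in> measurable borel_lattices borel_lattices"
proof -
  have act_in: "act g \<Lambda> \<in> unimodular_lattices" if "\<Lambda> \<in> unimodular_lattices" for \<Lambda>
  proof -
    from that obtain h where "h \<in> SL2" "\<Lambda> = lattice_of h"
      by (auto simp: unimodular_lattices_eq)
    with assms have "g ** h \<in> SL2" "act g \<Lambda> = lattice_of (g ** h)"
      by (simp_all add: SL2_def det_mul lattice_of_mult)
    then show ?thesis by (auto simp: unimodular_lattices_eq)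
  qed
  have opn: "openin lattice_topology (act g -` U \<inter> unimodular_lattices)"
    if "openin lattice_topology U" for U
  proof -
    have "continuous_on SL2 (\<lambda>h. g ** h)"
      unfolding matrix_matrix_mult_def by (intro continuous_intros)
    moreover have "(\<lambda>h. g ** h) \<in> SL2 \<rightarrow> SL2"
      using assms by (auto simp: SL2_def det_mul)
    ultimately have "openin (top_of_set SL2) (SL2 \<inter> (\<lambda>h. g ** h) -` {h \<in> SL2. lattice_of h \<in> U})"
      using that by (intro continuous_openin_preimage) (auto simp: openin_lattice_topology)
    moreover have "SL2 \<inter> (\<lambda>h. g ** h) -` {h \<in> SL2. lattice_of h \<in> U} =
        {h \<in> SL2. lattice_of h \<in> act g -` U \<inter> unimodular_lattices}"
      using assms by (auto simp: SL2_def det_mul lattice_of_mult unimodular_lattices_eq)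
    ultimately show ?thesis by (simp add: openin_lattice_topology)
  qed
  show ?thesis
    unfolding borel_lattices_def
  proof (rule measurable_measure_of)
    show "{U. openin lattice_topology U} \<subseteq> Pow unimodular_lattices"
      by (auto simp: openin_lattice_topology)
    show "act g \<in> space (sigma unimodular_lattices {U. openin lattice_topology U}) \<rightarrow> unimodular_lattices"
      using act_in by (auto simp: space_measure_of_conv)
    fix U assume "U \<in> {U. openin lattice_topology U}"
    then show "act g -` U \<inter> space (sigma unimodular_lattices {U. openin lattice_topology U})
        \<in> sets (sigma unimodular_lattices {U. openin lattice_topology U})"
      using opn by (auto simp: space_measure_of_conv sets_measure_of_conv openin_lattice_topology
          intro!: sigma_sets.Basic)
  qed
qed

text \<open>This determines \<open>\<mu>\<close> uniquely: on the homogeneous space \<open>SL\<^sub>2(\<real>)/SL\<^sub>2(\<int>)\<close> the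
  measure induced by Haar measure is, up to scaling, the only finite invariant Borel measure.\<close>

definition invariant_probability :: "(real^2) set measure \<Rightarrow> bool" where
  "invariant_probability \<mu> \<longleftrightarrow> sets \<mu> = sets borel_lattices \<and> emeasure \<mu> (space \<mu>) = 1 \<and>
     (\<forall>g\<in>SL2. distr \<mu> \<mu> (act g) = \<mu>)"

definition alpha1 :: "(real^2) set \<Rightarrow> real" where
  "alpha1 \<Lambda> = (SUP v\<in>\<Lambda> - {0}. 1 / norm v)"

definition unipotent :: "real \<Rightarrow> real^2^2" where
  "unipotent t = vector [vector [1, t], vector [0, 1]]"

text \<open>The supremum is attained, as \<open>alpha1\<close> is continuous on \<open>unimodular_lattices\<close>.\<close>

definition E_set :: "real \<Rightarrow> real \<Rightarrow> (real^2) set set" where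
  "E_set T r = {\<Lambda> \<in> unimodular_lattices.
     (SUP t\<in>{0..T}. ln (alpha1 (act (unipotent t) \<Lambda>))) \<le> r + 1/2 * ln T}"

end

(* For rho = exp (- r), a lattice lies outside E_set T r iff it has a primitive vector whose
   orbit under the flow comes within rho / sqrt T of the origin before time T.  A diagonal
   element carries the set of such vectors to a neighbourhood of the double triangle
   +-{x, y >= 0, x + y < rho} that shrinks to it as T grows, so that F r is the probability that
   a random lattice has no primitive vector in the triangle.

   Summing f over all bases g in SL2 of a lattice and integrating over mu gives a
   left-invariant functional, hence a multiple of Haar measure.  The multiple is 6 / pi^2:
   almost every lattice has exactly two reduced bases, and the set of reduced matrices
   has Haar measure pi^2 / 3.  Selecting from the bases with a given first vector one
   representative turns this into Siegel's formula for the expected number of primitive vectors.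

   If rho^2 < 2, a lattice has at most two primitive vectors in the triangle, and two of them form
   a basis, so inclusion-exclusion gives F r from the area of the triangle and the Haar measure
   of the pairs in it.  For large rho, a lattice missing the triangle has a vector of
   length below 12 / rho, and conversely a primitive vector in a square of side 1 / rho in the
   second quadrant keeps the lattice away from the triangle. *)

theory Submission
  imports Defs
begin

section \<open>Integral matrices and bases of a lattice\<close>

text \<open>The measure \<open>\<mu>\<close> is known only through its invariance and total mass;
  there is no fundamental domain to integrate over. A Borel choice of basis makes sums over bases
  measurable, and Fubini against a Haar measure written in coordinates fixes their means up to a
  factor. That factor is found without a null-set argument on the space of lattices: the closed
  reduction conditions give every lattice at least two bases, the open ones at most two, and the two
  sets of matrices have equal Haar measure, so both means equal 2. The coordinates are the first
  column \<open>v\<close> and a shear parameter \<open>t\<close>, because bases sharing their first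
  vector differ exactly by integral shears. The thresholds on \<open>r\<close> come from
  integrality: lattice vectors have integral determinants, and two vectors of the triangle have
  determinant below rho^2 in absolute value, so independent lattice vectors in it do not exist for
  rho <= 1 and form a basis, up to order, for rho^2 < 2.\<close>

definition cols :: "real^2 \<Rightarrow> real^2 \<Rightarrow> real^2^2" where
  "cols v w = vector [vector [v $ 1, w $ 1], vector [v $ 2, w $ 2]]"

text \<open>The adjugate. On \<open>SL2\<close> it is the inverse, but being linear in the entries
  it is continuous and Borel on all matrices.\<close>

definition adj2 :: "real^2^2 \<Rightarrow> real^2^2" where
  "adj2 g = vector [vector [g $ 2 $ 2, - g $ 1 $ 2], vector [- g $ 2 $ 1, g $ 1 $ 1]]"

definition int_SL2 :: "(real^2^2) set" where
  "int_SL2 = {g \<in> SL2. \<forall>i j. g $ i $ j \<in> \<int>}"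

text \<open>The fibre of the quotient map over \<open>\<Lambda>\<close>; lattices are handled
  through it throughout.\<close>

definition bases :: "(real^2) set \<Rightarrow> (real^2^2) set" where
  "bases \<Lambda> = {g \<in> SL2. lattice_of g = \<Lambda>}"

lemma cols_nth [simp]:
  "cols v w $ 1 $ 1 = v $ 1" "cols v w $ 1 $ 2 = w $ 1"
  "cols v w $ 2 $ 1 = v $ 2" "cols v w $ 2 $ 2 = w $ 2"
  by (simp_all add: cols_def)

lemma column_cols [simp]: "column 1 (cols v w) = v" "column 2 (cols v w) = w"
  by (simp_all add: column_def vec_eq_iff forall_2)

lemma cols_column: "cols (column 1 g) (column 2 g) = g"
  by (simp add: column_def vec_eq_iff forall_2)

lemma det_cols: "det (cols v w) = v $ 1 * w $ 2 - v $ 2 * w $ 1"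
  by (simp add: det_2)

lemma mult_cols: "g ** cols v w = cols (g *v v) (g *v w)"
  by (simp add: vec_eq_iff forall_2 matrix_matrix_mult_def matrix_vector_mult_def sum_2)

lemma column_mult: "column i (g ** h) = g *v column i (h :: real^2^2)"
  by (simp add: vec_eq_iff column_def matrix_matrix_mult_def matrix_vector_mult_def)

lemma cols_mult_vec: "cols v w *v n = n $ 1 *\<^sub>R v + n $ 2 *\<^sub>R w"
  by (simp add: vec_eq_iff forall_2 matrix_vector_mult_def sum_2)

lemma det_cols_mult: "det (cols (g *v v) (g *v w)) = det g * det (cols v w)"
  by (simp add: mult_cols [symmetric] det_mul)

lemma adj2_nth [simp]:
  "adj2 g $ 1 $ 1 = g $ 2 $ 2" "adj2 g $ 1 $ 2 = - g $ 1 $ 2"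
  "adj2 g $ 2 $ 1 = - g $ 2 $ 1" "adj2 g $ 2 $ 2 = g $ 1 $ 1"
  by (simp_all add: adj2_def)

lemma adj2_adj2 [simp]: "adj2 (adj2 g) = g"
  by (simp add: vec_eq_iff forall_2)

lemma adj2_mult: "adj2 (g ** h) = adj2 h ** adj2 g"
  by (simp add: vec_eq_iff forall_2 matrix_matrix_mult_def sum_2 algebra_simps)

lemma det_adj2 [simp]: "det (adj2 g) = det g"
  by (simp add: det_2)

lemma adj2_SL2 [simp]: "adj2 g \<in> SL2 \<longleftrightarrow> g \<in> SL2"
  by (simp add: SL2_def)

lemma mult_SL2: "g \<in> SL2 \<Longrightarrow> h \<in> SL2 \<Longrightarrow> g ** h \<in> SL2"
  by (simp add: SL2_def det_mul)

lemma adj2_left_inverse: "g \<in> SL2 \<Longrightarrow> adj2 g ** g = mat 1"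
  by (simp add: SL2_def det_2 mat_def vec_eq_iff forall_2 matrix_matrix_mult_def sum_2 mult.commute)

lemma adj2_right_inverse: "g \<in> SL2 \<Longrightarrow> g ** adj2 g = mat 1"
  using adj2_left_inverse [of "adj2 g"] by simp

lemma adj2_cancel:
  assumes "g \<in> SL2"
  shows "adj2 g ** (g ** h) = h" "g ** (adj2 g ** h) = h"
  by (simp_all add: matrix_mul_assoc adj2_left_inverse adj2_right_inverse assms)

lemma adj2_cancel_vec:
  assumes "g \<in> SL2"
  shows "adj2 g *v (g *v v) = v" "g *v (adj2 g *v v) = v"
  by (simp_all add: matrix_vector_mul_assoc adj2_left_inverse adj2_right_inverse assms)

lemma inj_SL2_mult: "g \<in> SL2 \<Longrightarrow> inj ((**) g)"
  by (metis adj2_cancel(1) injI)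

lemma SL2_vec_eq_0: "g \<in> SL2 \<Longrightarrow> g *v v = 0 \<longleftrightarrow> v = 0"
  by (metis adj2_cancel_vec(1) matrix_vector_mult_0_right)

lemma column_SL2_nonzero: "g \<in> SL2 \<Longrightarrow> column 1 g \<noteq> 0" "g \<in> SL2 \<Longrightarrow> column 2 g \<noteq> 0"
  by (auto simp: SL2_def det_2 column_def vec_eq_iff forall_2)

section \<open>The group of integral matrices of determinant 1\<close>

lemma countable_int_SL2: "countable int_SL2"
proof -
  have "countable (\<int> :: real set)"
    by (simp add: Ints_def)
  then have "countable ((\<lambda>((a, b), (c, d)). cols (vector [a, b]) (vector [c, d]))
      ` ((\<int> \<times> \<int>) \<times> (\<int> \<times> \<int>)))"
    by blast
  moreover have "int_SL2 \<subseteq> (\<lambda>((a, b), (c, d)). cols (vector [a, b]) (vector [c, d]))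
      ` ((\<int> \<times> \<int>) \<times> (\<int> \<times> \<int>))"
  proof
    fix g assume g: "g \<in> int_SL2"
    have "g = cols (vector [g $ 1 $ 1, g $ 2 $ 1]) (vector [g $ 1 $ 2, g $ 2 $ 2])"
      by (simp add: vec_eq_iff forall_2)
    with g show "g \<in> (\<lambda>((a, b), (c, d)). cols (vector [a, b]) (vector [c, d]))
      ` ((\<int> \<times> \<int>) \<times> (\<int> \<times> \<int>))"
      unfolding int_SL2_def by (force intro!: image_eqI)
  qed
  ultimately show ?thesis by (rule countable_subset [rotated])
qed

lemma int_SL2_subset: "\<gamma> \<in> int_SL2 \<Longrightarrow> \<gamma> \<in> SL2"
  by (simp add: int_SL2_def)

lemma adj2_int_SL2: "\<gamma> \<in> int_SL2 \<Longrightarrow> adj2 \<gamma> \<in> int_SL2"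
  by (simp add: int_SL2_def forall_2)

lemma mat_1_int_SL2: "mat 1 \<in> int_SL2"
  using det_I [where 'n = 2] by (simp add: int_SL2_def SL2_def) (simp add: mat_def)

text \<open>\<open>\<gamma>\<close> permutes the integer vectors, because its inverse
  \<open>adj2 \<gamma>\<close> is integral as well.\<close>

lemma lattice_of_mult_int:
  assumes "\<gamma> \<in> int_SL2"
  shows "lattice_of (g ** \<gamma>) = lattice_of g"
proof -
  let ?Z = "{n :: real^2. \<forall>i. n $ i \<in> \<int>}"
  have *: "\<delta> *v n \<in> ?Z" if "\<delta> \<in> int_SL2" "n \<in> ?Z" for \<delta> n
    using that by (simp add: int_SL2_def matrix_vector_mult_def sum_2)
  have "lattice_of \<gamma> = ?Z"
  proof
    show "lattice_of \<gamma> \<subseteq> ?Z"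
      using * assms by (auto simp: lattice_of_def)
    show "?Z \<subseteq> lattice_of \<gamma>"
    proof
      fix n assume n: "n \<in> ?Z"
      then have "adj2 \<gamma> *v n \<in> ?Z" using * adj2_int_SL2 assms by blast
      then show "n \<in> lattice_of \<gamma>"
        unfolding lattice_of_def
        using adj2_cancel_vec(2) [of \<gamma> n] assms by (metis image_eqI int_SL2_subset)
    qed
  qed
  then show ?thesis
    unfolding lattice_of_mult by (simp add: act_def) (simp add: lattice_of_def)
qed

section \<open>Lattice vectors, bases and primitive vectors\<close>

lemma lattice_ofE:
  assumes "v \<in> lattice_of g"
  obtains a b :: int where "v = of_int a *\<^sub>R column 1 g + of_int b *\<^sub>R column 2 g"
proof -
  from assms obtain n :: "real^2" where n: "v = g *v n" "\<forall>i. n $ i \<in> \<int>"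
    by (auto simp: lattice_of_def)
  then obtain a b where "n $ 1 = of_int a" "n $ 2 = of_int b"
    by (metis Ints_cases)
  with n that show thesis
    by (metis cols_column cols_mult_vec)
qed

lemma lattice_ofI: "of_int a *\<^sub>R column 1 g + of_int b *\<^sub>R column 2 g \<in> lattice_of g"
proof -
  have "of_int a *\<^sub>R column 1 g + of_int b *\<^sub>R column 2 g = g *v vector [of_int a, of_int b]"
    by (metis cols_column cols_mult_vec vector_2)
  then show ?thesis
    unfolding lattice_of_def by (auto simp: forall_2)
qed

lemma column_in_lattice: "column 1 g \<in> lattice_of g" "column 2 g \<in> lattice_of g"
  using lattice_ofI [of 1 g 0] lattice_ofI [of 0 g 1] by simp_all

lemma lattice_lincomb:
  assumes "v \<in> lattice_of g" "w \<in> lattice_of g"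
  shows "of_int a *\<^sub>R v + of_int b *\<^sub>R w \<in> lattice_of g"
proof -
  obtain a' b' c' d' :: int where "v = of_int a' *\<^sub>R column 1 g + of_int b' *\<^sub>R column 2 g"
    "w = of_int c' *\<^sub>R column 1 g + of_int d' *\<^sub>R column 2 g"
    by (metis lattice_ofE assms)
  then have "of_int a *\<^sub>R v + of_int b *\<^sub>R w =
    of_int (a * a' + b * c') *\<^sub>R column 1 g + of_int (a * b' + b * d') *\<^sub>R column 2 g"
    by (simp add: algebra_simps)
  then show ?thesis by (metis lattice_ofI)
qed

lemma lattice_scale: "v \<in> lattice_of g \<Longrightarrow> of_int a *\<^sub>R v \<in> lattice_of g"
  using lattice_lincomb [of v g v a 0] by simp

lemma lattice_uminus: "v \<in> lattice_of g \<Longrightarrow> - v \<in> lattice_of g"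
  using lattice_scale [of v g "-1"] by simp

text \<open>In the basis \<open>g\<close> both vectors have integer coordinates, and by
  multiplicativity the matrix of these coordinates has determinant 1.\<close>

lemma basisI:
  assumes "g \<in> SL2" "v \<in> lattice_of g" "w \<in> lattice_of g" "det (cols v w) = 1"
  shows "cols v w \<in> bases (lattice_of g)" "\<exists>\<gamma>\<in>int_SL2. cols v w = g ** \<gamma>"
proof -
  obtain m n :: "real^2" where mn: "v = g *v m" "w = g *v n" "\<forall>i. m $ i \<in> \<int>" "\<forall>i. n $ i \<in> \<int>"
    using assms by (auto simp: lattice_of_def)
  have eq: "cols v w = g ** cols m n"
    by (simp add: mn mult_cols)
  have "det (cols m n) = 1"
    using assms eq by (simp add: SL2_def det_mul)
  then have \<gamma>: "cols m n \<in> int_SL2"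
    using mn by (simp add: int_SL2_def SL2_def forall_2)
  show "\<exists>\<gamma>\<in>int_SL2. cols v w = g ** \<gamma>"
    using \<gamma> eq by blast
  show "cols v w \<in> bases (lattice_of g)"
    unfolding bases_def using \<gamma> eq assms(4) by (simp add: lattice_of_mult_int SL2_def)
qed

text \<open>This lets sums over bases be indexed by one fixed countable set, independent of the
  lattice.\<close>

lemma bases_eq:
  assumes "g \<in> bases \<Lambda>"
  shows "bases \<Lambda> = (**) g ` int_SL2"
proof
  have g: "g \<in> SL2" "\<Lambda> = lattice_of g"
    using assms by (auto simp: bases_def)
  then show "(**) g ` int_SL2 \<subseteq> bases \<Lambda>"
    by (auto simp: bases_def lattice_of_mult_int mult_SL2 dest: int_SL2_subset)
  show "bases \<Lambda> \<subseteq> (**) g ` int_SL2"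
  proof
    fix h assume "h \<in> bases \<Lambda>"
    then have h: "h \<in> SL2" "lattice_of h = lattice_of g"
      using g by (auto simp: bases_def)
    have "\<exists>\<gamma>\<in>int_SL2. cols (column 1 h) (column 2 h) = g ** \<gamma>"
      by (rule basisI) (use g h column_in_lattice [of h] in \<open>auto simp: SL2_def cols_column\<close>)
    then show "h \<in> (**) g ` int_SL2" by (auto simp: cols_column)
  qed
qed

lemma bases_nonempty:
  assumes "\<Lambda> \<in> unimodular_lattices"
  obtains g where "g \<in> bases \<Lambda>"
  using assms by (auto simp: bases_def unimodular_lattices_eq)

lemma bases_unimodular: "g \<in> bases \<Lambda> \<Longrightarrow> \<Lambda> \<in> unimodular_lattices"
  by (auto simp: bases_def unimodular_lattices_eq)

lemma bases_SL2: "g \<in> bases \<Lambda> \<Longrightarrow> g \<in> SL2"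
  by (simp add: bases_def)

lemma bases_lattice_of: "g \<in> bases \<Lambda> \<Longrightarrow> lattice_of g = \<Lambda>"
  by (simp add: bases_def)

lemma bases_act:
  assumes "h \<in> SL2"
  shows "bases (act h \<Lambda>) = (**) h ` bases \<Lambda>"
proof
  have inv: "act (adj2 h) (act h \<Lambda>) = \<Lambda>" "act h (act (adj2 h) \<Lambda>) = \<Lambda>" for \<Lambda>
    by (simp_all add: act_def image_image adj2_cancel_vec assms)
  show "(**) h ` bases \<Lambda> \<subseteq> bases (act h \<Lambda>)"
    using assms by (auto simp: bases_def lattice_of_mult mult_SL2)
  show "bases (act h \<Lambda>) \<subseteq> (**) h ` bases \<Lambda>"
  proof
    fix g assume "g \<in> bases (act h \<Lambda>)"
    then have "adj2 h ** g \<in> bases \<Lambda>"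
      using assms inv by (auto simp: bases_def lattice_of_mult mult_SL2)
    then show "g \<in> (**) h ` bases \<Lambda>"
      by (metis adj2_cancel(2) assms image_eqI)
  qed
qed

lemma act_unimodular:
  assumes "h \<in> SL2" "\<Lambda> \<in> unimodular_lattices"
  shows "act h \<Lambda> \<in> unimodular_lattices"
proof -
  obtain g where "g \<in> bases \<Lambda>" using assms(2) by (rule bases_nonempty)
  then have "h ** g \<in> bases (act h \<Lambda>)" using bases_act [OF assms(1)] by blast
  then show ?thesis by (rule bases_unimodular)
qed

lemma det_lattice_Ints:
  assumes "g \<in> SL2" "v \<in> lattice_of g" "w \<in> lattice_of g"
  shows "det (cols v w) \<in> \<int>"
proof -
  obtain m n :: "real^2" where mn: "v = g *v m" "w = g *v n" "\<forall>i. m $ i \<in> \<int>" "\<forall>i. n $ i \<in> \<int>"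
    using assms by (auto simp: lattice_of_def)
  have "det (cols v w) = det (cols m n)"
    using assms by (simp add: mn det_cols_mult SL2_def)
  also have "\<dots> \<in> \<int>"
    using mn by (simp add: det_cols)
  finally show ?thesis .
qed

text \<open>Expand the new second column in the basis \<open>g\<close>: determinant 1 forces the
  coefficient of \<open>column 2 g\<close> to be 1.\<close>

lemma bases_same_column:
  assumes "g \<in> bases \<Lambda>" "h \<in> bases \<Lambda>" "column 1 h = column 1 g"
  obtains k :: int where "column 2 h = column 2 g + of_int k *\<^sub>R column 1 g"
proof -
  have "column 2 h \<in> lattice_of g"
    using assms column_in_lattice(2) [of h] by (simp add: bases_def)
  then obtain a b :: int where ab: "column 2 h = of_int a *\<^sub>R column 1 g + of_int b *\<^sub>R column 2 g"
    by (rule lattice_ofE)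
  have "det (cols (column 1 h) (column 2 h)) = 1" "det (cols (column 1 g) (column 2 g)) = 1"
    using assms(1,2) by (simp_all add: bases_def SL2_def cols_column)
  then have "b * det (cols (column 1 g) (column 2 g)) = 1"
    unfolding assms(3) ab by (simp add: det_cols algebra_simps)
  then have "b = 1"
    using \<open>det (cols (column 1 g) (column 2 g)) = 1\<close> by simp
  with ab have "column 2 h = column 2 g + of_int a *\<^sub>R column 1 g" by simp
  then show thesis by (rule that)
qed

lemma bases_shear:
  assumes "g \<in> bases \<Lambda>"
  shows "cols (column 1 g) (column 2 g + of_int k *\<^sub>R column 1 g) \<in> bases \<Lambda>"
proof -
  have g: "g \<in> SL2" "\<Lambda> = lattice_of g"
    using assms by (auto simp: bases_def)
  have 1: "det (cols (column 1 g) (column 2 g)) = 1"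
    using g by (simp add: SL2_def cols_column)
  show ?thesis unfolding g(2)
  proof (rule basisI)
    show "column 2 g + of_int k *\<^sub>R column 1 g \<in> lattice_of g"
      using lattice_ofI [of k g 1] by (simp add: add.commute)
    show "det (cols (column 1 g) (column 2 g + of_int k *\<^sub>R column 1 g)) = 1"
      using 1 by (simp add: det_cols algebra_simps)
  qed (use g column_in_lattice in auto)
qed

lemma bases_uminus:
  assumes "g \<in> bases \<Lambda>"
  shows "cols (- column 1 g) (- column 2 g) \<in> bases \<Lambda>"
proof -
  have g: "g \<in> SL2" "\<Lambda> = lattice_of g"
    using assms by (auto simp: bases_def)
  have 1: "det (cols (column 1 g) (column 2 g)) = 1"
    using g by (simp add: SL2_def cols_column)
  show ?thesis unfolding g(2)
    by (rule basisI) (use g 1 in \<open>auto simp: det_cols intro!: lattice_uminus column_in_lattice\<close>)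
qed

text \<open>Dividing the coordinates of \<open>v\<close> by their gcd leaves a coprime pair, and
  Bezout coefficients supply the second basis vector.\<close>

lemma lattice_vector_primitive:
  assumes "\<Lambda> \<in> unimodular_lattices" "v \<in> \<Lambda>" "v \<noteq> 0"
  obtains g and k :: nat where "g \<in> bases \<Lambda>" "k > 0" "v = of_nat k *\<^sub>R column 1 g"
proof -
  from assms obtain g where g: "g \<in> bases \<Lambda>" using bases_nonempty by blast
  then have gS: "g \<in> SL2" and L: "\<Lambda> = lattice_of g" by (auto simp: bases_def)
  obtain a b :: int where ab: "v = of_int a *\<^sub>R column 1 g + of_int b *\<^sub>R column 2 g"
    using assms(2) lattice_ofE unfolding L by metis
  define d where "d = gcd a b"
  have "d > 0" using ab assms(3) by (auto simp: d_def)
  obtain a' b' where a': "a = d * a'" "b = d * b'"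
    by (metis d_def gcd_dvd1 gcd_dvd2 dvdE)
  obtain x y where "x * a + y * b = d"
    using bezout_int [of a b] unfolding d_def by blast
  then have "d * (x * a' + y * b') = d * 1" unfolding a' by (simp add: algebra_simps)
  then have xy: "x * a' + y * b' = 1" using \<open>d > 0\<close> by simp
  define v' where "v' = of_int a' *\<^sub>R column 1 g + of_int b' *\<^sub>R column 2 g"
  define w' where "w' = of_int (-y) *\<^sub>R column 1 g + of_int x *\<^sub>R column 2 g"
  have 1: "det (cols (column 1 g) (column 2 g)) = 1"
    using gS by (simp add: SL2_def cols_column)
  have "det (cols v' w') = of_int (x * a' + y * b') * det (cols (column 1 g) (column 2 g))"
    by (simp add: det_cols v'_def w'_def algebra_simps)
  then have "det (cols v' w') = 1" using 1 xy by simp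
  then have "cols v' w' \<in> bases \<Lambda>"
    unfolding L by (intro basisI gS) (auto simp: v'_def w'_def intro: lattice_ofI simp del: of_int_minus)
  moreover have "v = of_nat (nat d) *\<^sub>R column 1 (cols v' w')"
    using \<open>d > 0\<close> by (simp add: ab v'_def a' algebra_simps)
  ultimately show thesis using that [of "cols v' w'" "nat d"] \<open>d > 0\<close> by simp
qed

text \<open>Each first column is an integer multiple of the other, and the two multipliers have
  product 1.\<close>

lemma parallel_columns:
  assumes "g \<in> bases \<Lambda>" "h \<in> bases \<Lambda>" "det (cols (column 1 g) (column 1 h)) = 0"
  shows "column 1 h = column 1 g \<or> column 1 h = - column 1 g"
proof -
  have key: "\<exists>a::int. column 1 h = of_int a *\<^sub>R column 1 g"
    if "g \<in> bases \<Lambda>" "h \<in> bases \<Lambda>" "det (cols (column 1 g) (column 1 h)) = 0" for g h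
  proof -
    have "column 1 h \<in> lattice_of g"
      using that column_in_lattice(1) [of h] by (simp add: bases_def)
    then obtain a b :: int where ab: "column 1 h = of_int a *\<^sub>R column 1 g + of_int b *\<^sub>R column 2 g"
      by (rule lattice_ofE)
    have "det (cols (column 1 g) (column 2 g)) = 1"
      using that by (simp add: bases_def SL2_def cols_column)
    moreover have "det (cols (column 1 g) (column 1 h)) = b * det (cols (column 1 g) (column 2 g))"
      unfolding ab by (simp add: det_cols algebra_simps)
    ultimately have "b = 0" using that by simp
    with ab show ?thesis by auto
  qed
  obtain a :: int where a: "column 1 h = of_int a *\<^sub>R column 1 g"
    using key assms by blast
  have "det (cols (column 1 h) (column 1 g)) = 0"
    using assms(3) by (simp add: det_cols algebra_simps)
  then obtain b :: int where b: "column 1 g = of_int b *\<^sub>R column 1 h"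
    using key assms by blast
  have "column 1 g \<noteq> 0"
    using assms column_SL2_nonzero by (simp add: bases_def)
  moreover have "column 1 g = of_int (b * a) *\<^sub>R column 1 g"
    using a b by (metis mult.commute of_int_mult scaleR_scaleR)
  ultimately have "b * a = 1"
    by (metis of_int_1 of_int_eq_iff scaleR_one scaleR_cancel_right)
  then have "a = 1 \<or> a = -1" using zmult_eq_1_iff by (auto simp: mult.commute)
  with a show ?thesis by auto
qed

section \<open>A Borel section of the quotient map\<close>

lemma continuous_on_mult_SL2 [continuous_intros]:
  fixes f g :: "'a::topological_space \<Rightarrow> real^2^2"
  assumes "continuous_on S f" "continuous_on S g"
  shows "continuous_on S (\<lambda>x. f x ** g x)"
  unfolding matrix_matrix_mult_def by (intro continuous_intros assms)

lemma continuous_on_adj2 [continuous_intros]: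
  assumes "continuous_on S f"
  shows "continuous_on S (\<lambda>x. adj2 (f x))"
proof -
  have eq: "(\<lambda>x. adj2 (f x)) = (\<lambda>x. \<chi> i j. if i = 1 then if j = 1 then f x $ 2 $ 2 else - f x $ 1 $ 2
      else if j = 1 then - f x $ 2 $ 1 else f x $ 1 $ 1)"
    by (simp add: fun_eq_iff vec_eq_iff forall_2)
  have "continuous_on S (\<lambda>x. if i = (1::2) then if j = (1::2) then f x $ 2 $ 2 else - f x $ 1 $ 2
      else if j = 1 then - f x $ 2 $ 1 else f x $ 1 $ 1)" for i j
    using assms by (cases "i = 1"; cases "j = 1") (auto intro!: continuous_intros)
  then show ?thesis
    unfolding eq by (intro continuous_on_vec_lambda)
qed

text \<open>The saturation of \<open>U\<close> is the union of its right translates by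
  \<open>int_SL2\<close>, each of which is open.\<close>

lemma openin_lattice_image:
  assumes "openin (top_of_set SL2) U"
  shows "openin lattice_topology (lattice_of ` U)"
proof -
  have US: "U \<subseteq> SL2" using assms by (rule openin_imp_subset)
  have "openin (top_of_set SL2) (SL2 \<inter> (\<lambda>g. g ** \<gamma>) -` U)" if "\<gamma> \<in> int_SL2" for \<gamma>
    by (rule continuous_openin_preimage [OF _ _ assms])
      (use that in \<open>auto intro!: continuous_intros mult_SL2 dest: int_SL2_subset\<close>)
  then have "openin (top_of_set SL2) (\<Union>\<gamma>\<in>int_SL2. SL2 \<inter> (\<lambda>g. g ** \<gamma>) -` U)"
    by blast
  moreover have "{g \<in> SL2. lattice_of g \<in> lattice_of ` U} = (\<Union>\<gamma>\<in>int_SL2. SL2 \<inter> (\<lambda>g. g ** \<gamma>) -` U)"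
    (is "?L = ?R")
  proof
    show "?R \<subseteq> ?L"
      by (auto intro!: rev_image_eqI simp: lattice_of_mult_int)
    show "?L \<subseteq> ?R"
    proof
      fix g assume "g \<in> ?L"
      then obtain h where h: "g \<in> SL2" "h \<in> U" "lattice_of g = lattice_of h" by auto
      then have "h \<in> bases (lattice_of g)" "g \<in> bases (lattice_of g)"
        using US by (auto simp: bases_def)
      then obtain \<gamma> where "\<gamma> \<in> int_SL2" "h = g ** \<gamma>"
        using bases_eq by blast
      with h show "g \<in> ?R" by auto
    qed
  qed
  moreover have "lattice_of ` U \<subseteq> unimodular_lattices"
    using US by (auto simp: unimodular_lattices_eq)
  ultimately show ?thesis
    by (simp add: openin_lattice_topology)
qed

lemma sets_borel_latticesI: "openin lattice_topology U \<Longrightarrow> U \<in> sets borel_lattices"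
  unfolding borel_lattices_def
  by (subst sets_measure_of) (auto simp: openin_lattice_topology)

text \<open>For \<open>x\<close>, \<open>y\<close> near \<open>g\<close> the matrix
  \<open>adj2 x ** y\<close> is near the identity. If the lattices agree it is integral, and
  integers at distance below 1 coincide.\<close>

lemma lattice_of_locally_inj:
  assumes "g \<in> SL2"
  obtains W where "open W" "g \<in> W" "inj_on lattice_of (W \<inter> SL2)"
proof -
  let ?N = "{A :: real^2^2. \<forall>i j. \<bar>A $ i $ j - mat 1 $ i $ j\<bar> < 1}"
  have "?N = (\<Inter>i. \<Inter>j. {A. \<bar>A $ i $ j - mat 1 $ i $ j\<bar> < 1})" by auto
  also have "open \<dots>"
    by (intro open_INT ballI finite open_Collect_less continuous_intros)
  finally have N: "open ?N" .
  have "open ((\<lambda>(g, h). adj2 g ** h) -` ?N)"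
    unfolding case_prod_unfold
    by (rule open_vimage [OF N]) (intro continuous_intros)
  moreover have "(g, g) \<in> (\<lambda>(g, h). adj2 g ** h) -` ?N"
    using assms by (simp add: adj2_left_inverse)
  ultimately obtain A B where AB: "open A" "open B" "(g, g) \<in> A \<times> B"
    "A \<times> B \<subseteq> (\<lambda>(g, h). adj2 g ** h) -` ?N"
    by (rule open_prod_elim)
  show thesis
  proof
    show "open (A \<inter> B)" "g \<in> A \<inter> B" using AB by auto
    show "inj_on lattice_of (A \<inter> B \<inter> SL2)"
    proof (rule inj_onI)
      fix x y assume x: "x \<in> A \<inter> B \<inter> SL2" and y: "y \<in> A \<inter> B \<inter> SL2"
        and "lattice_of x = lattice_of y"
      then have "x \<in> bases (lattice_of x)" "y \<in> bases (lattice_of x)"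
        by (auto simp: bases_def)
      then obtain \<gamma> where \<gamma>: "\<gamma> \<in> int_SL2" "y = x ** \<gamma>"
        using bases_eq by blast
      then have "adj2 x ** y = \<gamma>"
        using x by (simp add: adj2_cancel)
      moreover have "(x, y) \<in> (\<lambda>(g, h). adj2 g ** h) -` ?N" using AB x y by blast
      ultimately have small: "\<bar>\<gamma> $ i $ j - mat 1 $ i $ j\<bar> < 1" for i j by auto
      have "\<gamma> $ i $ j = mat 1 $ i $ j" for i j
      proof -
        have "\<gamma> $ i $ j - mat 1 $ i $ j \<in> \<int>"
          using \<gamma>(1) mat_1_int_SL2 by (auto simp: int_SL2_def)
        then have "\<gamma> $ i $ j - mat 1 $ i $ j = 0"
          using small Ints_nonzero_abs_less1 by blast
        then show ?thesis by simp
      qed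
      then have "\<gamma> = mat 1" by (simp add: vec_eq_iff)
      with \<gamma> show "x = y" by simp
    qed
  qed
qed

text \<open>Images of Borel sets need not be Borel in general. Injectivity on
  \<open>W \<inter> SL2\<close> makes images commute with complements, so induction over the
  generated sigma-algebra goes through.\<close>

lemma lattice_image_sets:
  assumes W: "open W" "inj_on lattice_of (W \<inter> SL2)" and B: "B \<in> sets borel"
  shows "lattice_of ` (B \<inter> (W \<inter> SL2)) \<in> sets borel_lattices"
proof -
  have "B \<in> sigma_sets UNIV {S. open S}"
    using B by (simp add: borel_def)
  then show ?thesis
  proof induction
    case (Basic S)
    then have "openin (top_of_set SL2) (SL2 \<inter> (S \<inter> W))"
      using W by (intro openin_open_Int) auto
    moreover have "SL2 \<inter> (S \<inter> W) = S \<inter> (W \<inter> SL2)" by auto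
    ultimately show ?case
      by (metis openin_lattice_image sets_borel_latticesI)
  next
    case Empty
    then show ?case by simp
  next
    case (Compl S)
    have "openin (top_of_set SL2) (SL2 \<inter> W)"
      using W by (intro openin_open_Int) auto
    then have "lattice_of ` (W \<inter> SL2) \<in> sets borel_lattices"
      by (metis Int_commute openin_lattice_image sets_borel_latticesI)
    moreover have "lattice_of ` ((UNIV - S) \<inter> (W \<inter> SL2)) =
        lattice_of ` (W \<inter> SL2) - lattice_of ` (S \<inter> (W \<inter> SL2))"
      using W(2) unfolding inj_on_def by blast
    ultimately show ?case using Compl by simp
  next
    case (Union S)
    have "lattice_of ` (\<Union> (range S) \<inter> (W \<inter> SL2)) = (\<Union>i. lattice_of ` (S i \<inter> (W \<inter> SL2)))"
      by blast
    then show ?case using Union by simp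
  qed
qed

text \<open>Lindelof yields a countable cover by open sets of injectivity; the section inverts
  \<open>lattice_of\<close> on the first of them that meets the fibre.\<close>

lemma measurable_section:
  obtains s where "s \<in> measurable borel_lattices borel" "\<And>\<Lambda>. \<Lambda> \<in> unimodular_lattices \<Longrightarrow> s \<Lambda> \<in> bases \<Lambda>"
proof -
  let ?F = "{W. open W \<and> inj_on lattice_of (W \<inter> SL2)}"
  obtain F where F: "F \<subseteq> ?F" "countable F" "\<Union>F = \<Union>?F"
    using Lindelof [of ?F] by blast
  have cover: "SL2 \<subseteq> \<Union>F"
    unfolding F(3) using lattice_of_locally_inj by blast
  moreover have "mat 1 \<in> SL2" using mat_1_int_SL2 int_SL2_subset by blast
  ultimately have "F \<noteq> {}" by blast
  define W where "W = from_nat_into F"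
  have rW: "range W = F"
    unfolding W_def using F \<open>F \<noteq> {}\<close> by (simp add: range_from_nat_into)
  have W: "open (W n)" "inj_on lattice_of (W n \<inter> SL2)" for n
    using rW F(1) by blast+
  define N where "N \<Lambda> = (LEAST n. \<Lambda> \<in> lattice_of ` (W n \<inter> SL2))" for \<Lambda>
  define s where "s \<Lambda> = (THE g. g \<in> W (N \<Lambda>) \<inter> SL2 \<and> lattice_of g = \<Lambda>)" for \<Lambda>
  have ex: "\<exists>n. \<Lambda> \<in> lattice_of ` (W n \<inter> SL2)" if "\<Lambda> \<in> unimodular_lattices" for \<Lambda>
  proof -
    obtain g where g: "g \<in> SL2" "lattice_of g = \<Lambda>"
      using \<open>\<Lambda> \<in> unimodular_lattices\<close> by (auto simp: unimodular_lattices_eq)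
    then obtain n where "g \<in> W n" using cover rW by blast
    with g show ?thesis by blast
  qed
  have N: "\<Lambda> \<in> lattice_of ` (W (N \<Lambda>) \<inter> SL2)" if "\<Lambda> \<in> unimodular_lattices" for \<Lambda>
    unfolding N_def using ex [OF that] by (rule LeastI_ex)
  have s: "s \<Lambda> \<in> W (N \<Lambda>) \<inter> SL2" "lattice_of (s \<Lambda>) = \<Lambda>" if "\<Lambda> \<in> unimodular_lattices" for \<Lambda>
  proof -
    have "\<exists>!g. g \<in> W (N \<Lambda>) \<inter> SL2 \<and> lattice_of g = \<Lambda>"
      using N [OF that] W(2) [of "N \<Lambda>"] by (auto simp: inj_on_def)
    from theI' [OF this] show "s \<Lambda> \<in> W (N \<Lambda>) \<inter> SL2" "lattice_of (s \<Lambda>) = \<Lambda>"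
      unfolding s_def by blast+
  qed
  have "s \<in> measurable borel_lattices borel"
  proof (rule measurableI)
    fix B :: "(real^2^2) set" assume B: "B \<in> sets borel"
    \<comment> \<open>Sorted by the value \<open>n\<close> of \<open>N\<close>: there is a basis in
      \<open>B\<close> and \<open>W n\<close>, but none in an earlier set of the cover.\<close>
    have "s -` B \<inter> unimodular_lattices =
      (\<Union>n. lattice_of ` (B \<inter> (W n \<inter> SL2)) - (\<Union>m<n. lattice_of ` (UNIV \<inter> (W m \<inter> SL2))))" (is "?L = ?R")
    proof
      show "?L \<subseteq> ?R"
      proof
        fix \<Lambda> assume \<Lambda>: "\<Lambda> \<in> ?L"
        then have "\<Lambda> \<in> lattice_of ` (B \<inter> (W (N \<Lambda>) \<inter> SL2))"
          using s [of \<Lambda>] by (auto intro!: image_eqI [of _ _ "s \<Lambda>"])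
        moreover have "\<Lambda> \<notin> lattice_of ` (W m \<inter> SL2)" if "m < N \<Lambda>" for m
          using not_less_Least that unfolding N_def by blast
        ultimately show "\<Lambda> \<in> ?R" by auto
      qed
      show "?R \<subseteq> ?L"
      proof
        fix \<Lambda> assume "\<Lambda> \<in> ?R"
        then obtain n where n: "\<Lambda> \<in> lattice_of ` (B \<inter> (W n \<inter> SL2))"
          "\<And>m. m < n \<Longrightarrow> \<Lambda> \<notin> lattice_of ` (W m \<inter> SL2)" by auto
        then have \<Lambda>: "\<Lambda> \<in> unimodular_lattices" by (auto simp: unimodular_lattices_eq)
        have "N \<Lambda> = n"
          unfolding N_def
        proof (rule Least_equality)
          show "\<Lambda> \<in> lattice_of ` (W n \<inter> SL2)" using n(1) by blast
          show "n \<le> m" if "\<Lambda> \<in> lattice_of ` (W m \<inter> SL2)" for m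
            using that n(2) not_le by blast
        qed
        obtain g where g: "g \<in> B" "g \<in> W n \<inter> SL2" "\<Lambda> = lattice_of g" using n(1) by blast
        then have "s \<Lambda> = g"
          using s [OF \<Lambda>] W(2) [of n] \<open>N \<Lambda> = n\<close> by (auto simp: inj_on_def)
        with g \<Lambda> show "\<Lambda> \<in> ?L" by simp
      qed
    qed
    also have "\<dots> \<in> sets borel_lattices"
      using lattice_image_sets [OF W B] lattice_image_sets [OF W, of UNIV]
      by (auto intro!: sets.countable_nat_UN sets.Diff sets.finite_UN)
    finally show "s -` B \<inter> space borel_lattices \<in> sets borel_lattices" by simp
  qed auto
  moreover have "s \<Lambda> \<in> bases \<Lambda>" if "\<Lambda> \<in> unimodular_lattices" for \<Lambda>
    using s [OF that] by (simp add: bases_def)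
  ultimately show thesis by (rule that)
qed

section \<open>Lebesgue integrals in the plane\<close>

lemma borel_measurable_matI:
  fixes f :: "'a \<Rightarrow> real^2^2"
  assumes "\<And>i j. (\<lambda>x. f x $ i $ j) \<in> borel_measurable M"
  shows "f \<in> borel_measurable M"
  by (rule borel_measurable_euclidean_space [THEN iffD2])
    (use assms in \<open>auto simp: Basis_vec_def inner_axis\<close>)

lemma borel_measurable_mat2I:
  fixes f :: "'a \<Rightarrow> real^2^2"
  assumes "(\<lambda>x. f x $ 1 $ 1) \<in> borel_measurable M" "(\<lambda>x. f x $ 1 $ 2) \<in> borel_measurable M"
    "(\<lambda>x. f x $ 2 $ 1) \<in> borel_measurable M" "(\<lambda>x. f x $ 2 $ 2) \<in> borel_measurable M"
  shows "f \<in> borel_measurable M"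
proof (rule borel_measurable_matI)
  show "(\<lambda>x. f x $ i $ j) \<in> borel_measurable M" for i j
    using assms exhaust_2 [of i] exhaust_2 [of j] by auto
qed

lemma borel_measurable_nth_real [measurable (raw)]:
  fixes f :: "'a \<Rightarrow> real^2"
  assumes "f \<in> borel_measurable M"
  shows "(\<lambda>x. f x $ i) \<in> borel_measurable M"
proof -
  have "(\<lambda>v :: real^2. v $ i) \<in> borel_measurable borel"
    by (intro borel_measurable_continuous_onI continuous_intros)
  then show ?thesis using assms by (rule measurable_compose [rotated])
qed

lemma borel_measurable_nth_vec [measurable (raw)]:
  fixes f :: "'a \<Rightarrow> real^2^2"
  assumes "f \<in> borel_measurable M"
  shows "(\<lambda>x. f x $ i) \<in> borel_measurable M"
proof -
  have "(\<lambda>v :: real^2^2. v $ i) \<in> borel_measurable borel"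
    by (intro borel_measurable_continuous_onI continuous_intros)
  then show ?thesis using assms by (rule measurable_compose [rotated])
qed

lemma borel_measurable_vector2 [measurable (raw)]:
  assumes "f \<in> borel_measurable M" "g \<in> borel_measurable M"
  shows "(\<lambda>x. vector [f x, g x] :: real^2) \<in> borel_measurable M"
proof (rule borel_measurable_euclidean_space [THEN iffD2], rule ballI)
  fix b :: "real^2" assume "b \<in> Basis"
  then obtain i where i: "b = axis i 1" by (auto simp: Basis_vec_def)
  show "(\<lambda>x. (vector [f x, g x] :: real^2) \<bullet> b) \<in> borel_measurable M"
    using assms exhaust_2 [of i] by (auto simp: i inner_axis)
qed

lemma borel_measurable_cols [measurable (raw)]:
  assumes "f \<in> borel_measurable M" "g \<in> borel_measurable M"
  shows "(\<lambda>x. cols (f x) (g x)) \<in> borel_measurable M"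
  using assms by (intro borel_measurable_mat2I) simp_all

lemma borel_measurable_mat_mult [measurable (raw)]:
  fixes f g :: "'a \<Rightarrow> real^2^2"
  assumes [measurable]: "f \<in> borel_measurable M" "g \<in> borel_measurable M"
  shows "(\<lambda>x. f x ** g x) \<in> borel_measurable M"
  by (intro borel_measurable_mat2I) (simp_all add: matrix_matrix_mult_def sum_2)

lemma borel_measurable_adj2 [measurable (raw)]:
  assumes [measurable]: "f \<in> borel_measurable M"
  shows "(\<lambda>x. adj2 (f x)) \<in> borel_measurable M"
  by (intro borel_measurable_mat2I) simp_all

lemma borel_measurable_column [measurable (raw)]:
  assumes [measurable]: "f \<in> borel_measurable M"
  shows "(\<lambda>x. column i (f x :: real^2^2)) \<in> borel_measurable M"
proof -
  have "column i (f x) = vector [f x $ 1 $ i, f x $ 2 $ i]" for x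
    by (simp add: column_def vec_eq_iff forall_2)
  then show ?thesis by simp
qed

text \<open>\<open>real^2\<close> is not a product type, so Tonelli is imported by comparing
  Lebesgue measure with the image of the product measure on boxes.\<close>

lemma nn_integral_vec2:
  fixes f :: "real^2 \<Rightarrow> ennreal"
  assumes [measurable]: "f \<in> borel_measurable borel"
  shows "(\<integral>\<^sup>+v. f v \<partial>lborel) = (\<integral>\<^sup>+x. \<integral>\<^sup>+y. f (vector [x, y]) \<partial>lborel \<partial>lborel)"
proof -
  let ?p = "\<lambda>(x, y). vector [x, y] :: real^2"
  have [measurable]: "?p \<in> borel_measurable (lborel \<Otimes>\<^sub>M lborel)"
    unfolding case_prod_unfold by measurable
  have "lborel = distr (lborel \<Otimes>\<^sub>M lborel) borel ?p"
  proof (rule lborel_eqI)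
    fix l u :: "real^2" assume le: "\<And>b. b \<in> Basis \<Longrightarrow> l \<bullet> b \<le> u \<bullet> b"
    have le': "l $ i \<le> u $ i" for i
      using le [of "axis i 1"] by (simp add: inner_axis axis_in_Basis_iff)
    have box: "?p -` box l u = box (l $ 1) (u $ 1) \<times> box (l $ 2) (u $ 2)"
      by (auto simp: mem_box_cart forall_2)
    have "emeasure (distr (lborel \<Otimes>\<^sub>M lborel) borel ?p) (box l u)
        = emeasure (lborel \<Otimes>\<^sub>M lborel) (box (l $ 1) (u $ 1) \<times> box (l $ 2) (u $ 2))"
      by (subst emeasure_distr) (simp_all add: box space_pair_measure)
    also have "\<dots> = (u $ 1 - l $ 1) * (u $ 2 - l $ 2)"
      using le' by (subst lborel.emeasure_pair_measure_Times) (simp_all add: ennreal_mult')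
    also have "(u $ 1 - l $ 1) * (u $ 2 - l $ 2) = (\<Prod>b\<in>Basis. (u - l) \<bullet> b)"
    proof -
      have "measure lborel (cbox l u) = (\<Prod>b\<in>Basis. (u - l) \<bullet> b)"
        using le by (simp add: inner_diff_left)
      moreover have "cbox l u \<noteq> {}" using le by (simp add: box_ne_empty)
      then have "measure lborel (cbox l u) = (\<Prod>i\<in>UNIV. u $ i - l $ i)"
        by (rule content_cbox_cart)
      ultimately show ?thesis by (simp add: UNIV_2)
    qed
    finally show "emeasure (distr (lborel \<Otimes>\<^sub>M lborel) borel ?p) (box l u) = (\<Prod>b\<in>Basis. (u - l) \<bullet> b)" .
  qed simp
  then have "(\<integral>\<^sup>+v. f v \<partial>lborel) = (\<integral>\<^sup>+v. f v \<partial>distr (lborel \<Otimes>\<^sub>M lborel) borel ?p)" by simp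
  also have "\<dots> = (\<integral>\<^sup>+z. f (?p z) \<partial>(lborel \<Otimes>\<^sub>M lborel))"
    by (subst nn_integral_distr) simp_all
  also have "\<dots> = (\<integral>\<^sup>+x. \<integral>\<^sup>+y. f (vector [x, y]) \<partial>lborel \<partial>lborel)"
    by (subst lborel.nn_integral_fst [symmetric]) simp_all
  finally show ?thesis .
qed

lemma borel_measurable_matrix_vector_mult [measurable]:
  "(\<lambda>v. h *v v) \<in> borel_measurable (borel :: (real^2) measure)" for h :: "real^2^2"
  by (intro borel_measurable_continuous_onI linear_continuous_on matrix_vector_mul_bounded_linear)

text \<open>The preimage of a box is its image under \<open>adj2 h\<close>, and linear images scale
  measure by the absolute determinant.\<close>

lemma lborel_distr_SL2:
  assumes "h \<in> SL2"
  shows "distr lborel borel ((*v) h) = lborel"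
proof (rule lborel_eqI [symmetric])
  fix l u :: "real^2" assume le: "\<And>b. b \<in> Basis \<Longrightarrow> l \<bullet> b \<le> u \<bullet> b"
  have pre: "(*v) h -` box l u = (*v) (adj2 h) ` box l u"
    by (force simp: adj2_cancel_vec assms intro: rev_image_eqI)
  have "measure lebesgue ((*v) (adj2 h) ` box l u) = \<bar>det (matrix ((*v) (adj2 h)))\<bar> * measure lebesgue (box l u)"
    by (rule measure_linear_image) auto
  then have 1: "measure lebesgue ((*v) h -` box l u) = measure lebesgue (box l u)"
    using assms by (simp add: pre SL2_def)
  have 2: "(*v) h -` box l u \<in> lmeasurable"
    unfolding pre by (intro measurable_linear_image) auto
  have "(*v) h -` box l u \<inter> space borel \<in> sets borel"
    by (rule measurable_sets [OF borel_measurable_matrix_vector_mult]) simp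
  then have 3: "(*v) h -` box l u \<in> sets borel" by simp
  have "emeasure (distr lborel borel ((*v) h)) (box l u) = emeasure lebesgue ((*v) h -` box l u)"
    using 3 by (subst emeasure_distr) simp_all
  also have "\<dots> = emeasure lebesgue (box l u)"
    using 1 2 by (simp add: emeasure_eq_measure2)
  also have "\<dots> = (\<Prod>b\<in>Basis. (u - l) \<bullet> b)"
    using le by simp
  finally show "emeasure (distr lborel borel ((*v) h)) (box l u) = (\<Prod>b\<in>Basis. (u - l) \<bullet> b)" .
qed simp

lemma nn_integral_lborel_SL2:
  fixes f :: "real^2 \<Rightarrow> ennreal"
  assumes "h \<in> SL2" and [measurable]: "f \<in> borel_measurable borel"
  shows "(\<integral>\<^sup>+v. f (h *v v) \<partial>lborel) = (\<integral>\<^sup>+v. f v \<partial>lborel)"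
proof -
  have "(\<integral>\<^sup>+v. f v \<partial>lborel) = (\<integral>\<^sup>+v. f v \<partial>distr lborel borel ((*v) h))"
    by (simp add: lborel_distr_SL2 assms)
  also have "\<dots> = (\<integral>\<^sup>+v. f (h *v v) \<partial>lborel)"
    by (subst nn_integral_distr) simp_all
  finally show ?thesis by simp
qed

section \<open>Substitutions on the line and the measure dx/|x|\<close>

lemma nn_integral_translate:
  fixes f :: "real \<Rightarrow> ennreal"
  assumes "f \<in> borel_measurable borel"
  shows "(\<integral>\<^sup>+t. f (c + t) \<partial>lborel) = (\<integral>\<^sup>+t. f t \<partial>lborel)"
  using nn_integral_real_affine [OF assms, of 1 c] by simp

lemma nn_integral_reflect:
  fixes f :: "real \<Rightarrow> ennreal"
  assumes "f \<in> borel_measurable borel"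
  shows "(\<integral>\<^sup>+t. f (c - t) \<partial>lborel) = (\<integral>\<^sup>+t. f t \<partial>lborel)"
  using nn_integral_real_affine [OF assms, of "-1" c] by simp

text \<open>The measure dx/x is invariant under multiplication and \<open>ln\<close> carries it to
  the additive one; dilation and inversion thereby become translation and reflection.\<close>

lemma distr_ln_lborel:
  "distr (density lborel (\<lambda>x. indicator {0<..} x * ennreal (1 / x))) borel ln = (lborel :: real measure)"
proof (rule lborel_eqI [symmetric])
  fix l u :: real assume "\<And>b. b \<in> Basis \<Longrightarrow> l \<bullet> b \<le> u \<bullet> b"
  then have le: "l \<le> u" by simp
  let ?f = "\<lambda>x :: real. indicator {0<..} x * ennreal (1 / x)"
  have "ln -` box l u \<inter> space borel \<in> sets borel"
    by (rule measurable_sets [of ln borel borel]) simp_all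
  then have [measurable]: "ln -` box l u \<in> sets borel" by (simp only: space_borel Int_UNIV_right)
  have "emeasure (distr (density lborel ?f) borel ln) (box l u) = emeasure (density lborel ?f) (ln -` box l u)"
    by (subst emeasure_distr) (simp_all del: box_real)
  also have "\<dots> = (\<integral>\<^sup>+x. ?f x * indicator (ln -` box l u) x \<partial>lborel)"
    by (rule emeasure_density) (simp_all del: box_real)
  also have "\<dots> = (\<integral>\<^sup>+x. ennreal (1 / x) * indicator {exp l .. exp u} x \<partial>lborel)"
  proof (rule nn_integral_cong_AE)
    \<comment> \<open>The endpoints are discarded because the box is open, while the fundamental
      theorem below uses a closed interval.\<close>
    have "AE x in lborel. x \<noteq> exp l \<and> x \<noteq> exp u"
      using AE_lborel_singleton by auto
    then show "AE x in lborel. ?f x * indicator (ln -` box l u) x = ennreal (1 / x) * indicator {exp l .. exp u} x"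
    proof eventually_elim
      case (elim x)
      show ?case
      proof (cases "x > 0")
        case True
        then have "ln x \<in> box l u \<longleftrightarrow> x \<in> {exp l .. exp u}"
          using elim exp_less_cancel_iff [of l "ln x"] exp_less_cancel_iff [of "ln x" u] by auto
        then show ?thesis using True by (simp add: indicator_def)
      next
        case False
        then have "x < exp l" by (meson exp_gt_zero not_le order.strict_trans2 leI le_less_trans)
        then show ?thesis using False by (simp add: indicator_def)
      qed
    qed
  qed
  also have "\<dots> = ennreal (ln (exp u) - ln (exp l))"
  proof (rule nn_integral_FTC_Icc)
    fix x assume "x \<in> {exp l..exp u}"
    then have "x > 0" by (auto intro: less_le_trans [OF exp_gt_zero])
    then show "(ln has_real_derivative 1 / x) (at x)" "0 \<le> 1 / x"
      by (auto intro!: derivative_eq_intros simp: field_simps)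
  qed (use le in auto)
  finally show "emeasure (distr (density lborel ?f) borel ln) (box l u) = (\<Prod>b\<in>Basis. (u - l) \<bullet> b)"
    by simp
qed simp

lemma nn_integral_dx_over_x:
  fixes F :: "real \<Rightarrow> ennreal"
  assumes [measurable]: "F \<in> borel_measurable borel"
  shows "(\<integral>\<^sup>+x. indicator {0<..} x * ennreal (1 / x) * F x \<partial>lborel) = (\<integral>\<^sup>+s. F (exp s) \<partial>lborel)"
proof -
  have "(\<integral>\<^sup>+s. F (exp s) \<partial>lborel) =
     (\<integral>\<^sup>+s. F (exp s) \<partial>distr (density lborel (\<lambda>x. indicator {0<..} x * ennreal (1 / x))) borel ln)"
    by (simp add: distr_ln_lborel)
  also have "\<dots> = (\<integral>\<^sup>+x. indicator {0<..} x * ennreal (1 / x) * F (exp (ln x)) \<partial>lborel)"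
    by (subst nn_integral_distr) (simp_all add: nn_integral_density)
  also have "\<dots> = (\<integral>\<^sup>+x. indicator {0<..} x * ennreal (1 / x) * F x \<partial>lborel)"
    by (intro nn_integral_cong) (auto simp: indicator_def)
  finally show ?thesis by simp
qed

lemma nn_integral_da_over_a:
  fixes F :: "real \<Rightarrow> ennreal"
  assumes [measurable]: "F \<in> borel_measurable borel"
  shows "(\<integral>\<^sup>+a. ennreal (1 / \<bar>a\<bar>) * F a \<partial>lborel) =
    (\<integral>\<^sup>+s. F (exp s) \<partial>lborel) + (\<integral>\<^sup>+s. F (- exp s) \<partial>lborel)"
proof -
  let ?g = "\<lambda>F x. indicator {0<..} x * ennreal (1 / x) * F x"
  have "(\<integral>\<^sup>+a. ennreal (1 / \<bar>a\<bar>) * F a \<partial>lborel) = (\<integral>\<^sup>+a. ?g F a + ?g (\<lambda>x. F (- x)) (0 - a) \<partial>lborel)"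
    by (intro nn_integral_cong) (auto simp: indicator_def abs_if)
  also have "\<dots> = (\<integral>\<^sup>+a. ?g F a \<partial>lborel) + (\<integral>\<^sup>+a. ?g (\<lambda>x. F (- x)) (0 - a) \<partial>lborel)"
    by (rule nn_integral_add) simp_all
  also have "(\<integral>\<^sup>+a. ?g (\<lambda>x. F (- x)) (0 - a) \<partial>lborel) = (\<integral>\<^sup>+a. ?g (\<lambda>x. F (- x)) a \<partial>lborel)"
    by (rule nn_integral_reflect) simp
  finally show ?thesis
    by (simp add: nn_integral_dx_over_x)
qed

text \<open>In logarithmic coordinates the substitution is the reflection of \<open>s\<close> to
  \<open>ln \<bar>k\<bar> - s\<close>; a negative \<open>k\<close> also exchanges the two
  half-lines.\<close>

lemma nn_integral_da_over_a_invert: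
  fixes F :: "real \<Rightarrow> ennreal"
  assumes [measurable]: "F \<in> borel_measurable borel" and k: "k \<noteq> 0"
  shows "(\<integral>\<^sup>+a. ennreal (1 / \<bar>a\<bar>) * F (k / a) \<partial>lborel) = (\<integral>\<^sup>+a. ennreal (1 / \<bar>a\<bar>) * F a \<partial>lborel)"
proof -
  define c where "c = \<bar>k\<bar>"
  have c: "c > 0" using k by (simp add: c_def)
  have *: "(\<integral>\<^sup>+s. G (c / exp s) \<partial>lborel) = (\<integral>\<^sup>+s. G (exp s) \<partial>lborel)"
    if [measurable]: "G \<in> borel_measurable borel" for G :: "real \<Rightarrow> ennreal"
  proof -
    have "(\<integral>\<^sup>+s. G (c / exp s) \<partial>lborel) = (\<integral>\<^sup>+s. G (exp (ln c - s)) \<partial>lborel)"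
      using c by (simp add: exp_diff)
    also have "\<dots> = (\<integral>\<^sup>+s. G (exp s) \<partial>lborel)"
      by (rule nn_integral_reflect) simp
    finally show ?thesis .
  qed
  have "(\<integral>\<^sup>+a. ennreal (1 / \<bar>a\<bar>) * F (k / a) \<partial>lborel) =
    (\<integral>\<^sup>+s. F (k / exp s) \<partial>lborel) + (\<integral>\<^sup>+s. F (k / - exp s) \<partial>lborel)"
    by (rule nn_integral_da_over_a) simp
  also have "\<dots> = (\<integral>\<^sup>+s. F (c / exp s) \<partial>lborel) + (\<integral>\<^sup>+s. F (- (c / exp s)) \<partial>lborel)"
    by (cases "k > 0") (simp_all add: c_def add.commute)
  also have "\<dots> = (\<integral>\<^sup>+a. ennreal (1 / \<bar>a\<bar>) * F a \<partial>lborel)"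
    by (subst nn_integral_da_over_a) (simp_all add: * [of F] * [of "\<lambda>x. F (- x)"])
  finally show ?thesis .
qed

section \<open>Haar measure on the special linear group\<close>

text \<open>The matrices of determinant 1 with first column \<open>v \<noteq> 0\<close> are the \<open>frame (v, t)\<close>; in these
  coordinates Haar measure is Lebesgue measure. At \<open>v = 0\<close> division by zero makes \<open>frame\<close>
  the zero matrix, which does not matter on a null set.\<close>

definition normal_vec :: "real^2 \<Rightarrow> real^2" where
  "normal_vec v = (1 / (v \<bullet> v)) *\<^sub>R vector [- v $ 2, v $ 1]"

definition frame :: "(real^2) \<times> real \<Rightarrow> real^2^2" where
  "frame p = cols (fst p) (normal_vec (fst p) + snd p *\<^sub>R fst p)"

definition haar :: "(real^2^2) measure" where
  "haar = distr lborel borel frame"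

lemma inner_vec2: "v \<bullet> w = v $ 1 * w $ 1 + v $ 2 * w $ 2" for v w :: "real^2"
  by (simp add: inner_vec_def sum_2)

lemma normal_vec_nth [simp]:
  "normal_vec v $ 1 = - v $ 2 / (v \<bullet> v)" "normal_vec v $ 2 = v $ 1 / (v \<bullet> v)"
  by (simp_all add: normal_vec_def)

lemma inner_normal_vec [simp]: "v \<bullet> normal_vec v = 0"
  by (simp add: inner_vec2 [of v "normal_vec v"])

lemma det_normal_vec: "v \<noteq> 0 \<Longrightarrow> det (cols v (normal_vec v)) = 1"
proof -
  assume "v \<noteq> 0"
  then have "v \<bullet> v \<noteq> 0" by simp
  moreover have "det (cols v (normal_vec v)) = (v $ 1 * v $ 1 + v $ 2 * v $ 2) / (v \<bullet> v)"
    by (simp add: det_cols add_divide_distrib)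
  ultimately show ?thesis by (simp add: inner_vec2 [of v v])
qed

lemma det_cols_shear: "det (cols v (w + t *\<^sub>R v)) = det (cols v w)"
  by (simp add: det_cols algebra_simps)

lemma frame_SL2: "fst p \<noteq> 0 \<Longrightarrow> frame p \<in> SL2"
  using det_normal_vec [of "fst p"] by (simp add: frame_def SL2_def det_cols_shear)

text \<open>The determinant fixes the component of \<open>w\<close> along
  \<open>normal_vec v\<close>; what remains free is the orthogonal projection to
  \<open>v\<close>.\<close>

lemma cols_frame:
  assumes "det (cols v w) = 1"
  shows "cols v w = frame (v, (v \<bullet> w) / (v \<bullet> v))"
proof -
  have d: "v $ 1 * w $ 2 - v $ 2 * w $ 1 = 1" using assms by (simp add: det_cols)
  then have "v \<noteq> 0" by auto
  then have n: "v \<bullet> v \<noteq> 0" by simp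
  have "w $ 1 * (v \<bullet> v) = - v $ 2 * (v $ 1 * w $ 2 - v $ 2 * w $ 1) + (v \<bullet> w) * v $ 1"
    "w $ 2 * (v \<bullet> v) = v $ 1 * (v $ 1 * w $ 2 - v $ 2 * w $ 1) + (v \<bullet> w) * v $ 2"
    by (simp_all add: inner_vec2 algebra_simps)
  then have "w $ 1 = (- v $ 2 + (v \<bullet> w) * v $ 1) / (v \<bullet> v)"
    "w $ 2 = (v $ 1 + (v \<bullet> w) * v $ 2) / (v \<bullet> v)"
    using n by (simp_all add: d eq_divide_eq)
  then have "w = normal_vec v + ((v \<bullet> w) / (v \<bullet> v)) *\<^sub>R v"
    by (simp add: vec_eq_iff forall_2 add_divide_distrib diff_divide_distrib)
  then show ?thesis by (simp add: frame_def)
qed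

lemma frame_translate:
  assumes "det (cols v w) = 1"
  shows "cols v (w + t *\<^sub>R v) = frame (v, (v \<bullet> w) / (v \<bullet> v) + t)"
proof -
  have "v \<noteq> 0" using assms by (auto simp: det_cols)
  then show ?thesis
    using cols_frame [of v "w + t *\<^sub>R v"] assms
    by (simp add: det_cols_shear inner_add_right add_divide_distrib)
qed

lemma borel_measurable_normal_vec [measurable (raw)]:
  assumes [measurable]: "f \<in> borel_measurable M"
  shows "(\<lambda>x. normal_vec (f x)) \<in> borel_measurable M"
  unfolding normal_vec_def by measurable

lemma borel_measurable_frame [measurable]: "frame \<in> borel_measurable borel"
  unfolding frame_def by (simp flip: borel_prod)

lemma sets_haar [simp, measurable_cong]: "sets haar = sets borel"
  by (simp add: haar_def)

lemma nn_integral_haar: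
  assumes [measurable]: "f \<in> borel_measurable borel"
  shows "(\<integral>\<^sup>+g. f g \<partial>haar) = (\<integral>\<^sup>+v. \<integral>\<^sup>+t. f (frame (v, t)) \<partial>lborel \<partial>lborel)"
proof -
  have "(\<integral>\<^sup>+g. f g \<partial>haar) = (\<integral>\<^sup>+p. f (frame p) \<partial>(lborel \<Otimes>\<^sub>M lborel))"
    unfolding haar_def lborel_prod by (subst nn_integral_distr) simp_all
  also have "\<dots> = (\<integral>\<^sup>+v. \<integral>\<^sup>+t. f (frame (v, t)) \<partial>lborel \<partial>lborel)"
    by (subst lborel.nn_integral_fst [symmetric]) (simp_all add: lborel_prod)
  finally show ?thesis .
qed

lemma measurable_frame_pair [measurable (raw)]:
  assumes [measurable]: "f \<in> borel_measurable M" "g \<in> borel_measurable M"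
  shows "(\<lambda>x. frame (f x, g x)) \<in> borel_measurable M"
  unfolding frame_def by simp

text \<open>A shear only shifts the fibre coordinate, so any completion \<open>w\<close> of
  \<open>v\<close> may serve as the origin of the fibre.\<close>

lemma nn_integral_frame_fibre:
  assumes [measurable]: "f \<in> borel_measurable borel" and "det (cols v w) = 1"
  shows "(\<integral>\<^sup>+t. f (frame (v, t)) \<partial>lborel) = (\<integral>\<^sup>+t. f (cols v (w + t *\<^sub>R v)) \<partial>lborel)"
  unfolding frame_translate [OF assms(2)]
  by (subst nn_integral_translate [where f = "\<lambda>t. f (frame (v, t))"]) simp_all

text \<open>\<open>h\<close> moves the first column by a measure-preserving map. It does not respect
  \<open>normal_vec\<close>, but the discrepancy is a translation of \<open>t\<close> in each
  fibre.\<close>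

lemma nn_integral_haar_left:
  assumes [measurable]: "f \<in> borel_measurable borel" and h: "h \<in> SL2"
  shows "(\<integral>\<^sup>+g. f (h ** g) \<partial>haar) = (\<integral>\<^sup>+g. f g \<partial>haar)"
proof -
  have "(\<integral>\<^sup>+g. f (h ** g) \<partial>haar) = (\<integral>\<^sup>+v. \<integral>\<^sup>+t. f (h ** frame (v, t)) \<partial>lborel \<partial>lborel)"
    by (rule nn_integral_haar) simp
  also have "\<dots> = (\<integral>\<^sup>+v. \<integral>\<^sup>+t. f (frame (h *v v, t)) \<partial>lborel \<partial>lborel)"
  proof (rule nn_integral_cong_AE)
    have "AE v in lborel. v \<noteq> (0 :: real^2)" by (rule AE_lborel_singleton)
    then show "AE v in lborel. (\<integral>\<^sup>+t. f (h ** frame (v, t)) \<partial>lborel) = (\<integral>\<^sup>+t. f (frame (h *v v, t)) \<partial>lborel)"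
    proof eventually_elim
      case (elim v)
      then have "det (cols (h *v v) (h *v normal_vec v)) = 1"
        using h by (simp add: det_cols_mult det_normal_vec SL2_def)
      then have "(\<integral>\<^sup>+t. f (frame (h *v v, t)) \<partial>lborel)
          = (\<integral>\<^sup>+t. f (cols (h *v v) (h *v normal_vec v + t *\<^sub>R (h *v v))) \<partial>lborel)"
        by (rule nn_integral_frame_fibre [OF assms(1)])
      then show ?case
        by (simp add: frame_def mult_cols matrix_vector_right_distrib matrix_vector_mult_scaleR)
    qed
  qed
  also have "\<dots> = (\<integral>\<^sup>+v. \<integral>\<^sup>+t. f (frame (v, t)) \<partial>lborel \<partial>lborel)"
    by (rule nn_integral_lborel_SL2 [OF h]) simp
  finally show ?thesis by (simp add: nn_integral_haar)
qed

text \<open>Inversion is easy to compute in the matrix entries. With (0, 1/a) as origin of the fibre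
  over (a, c), the entry b is a t, whence the density 1/|a|.\<close>

lemma nn_integral_haar_coords:
  assumes [measurable]: "f \<in> borel_measurable borel"
  shows "(\<integral>\<^sup>+g. f g \<partial>haar) = (\<integral>\<^sup>+c. \<integral>\<^sup>+b. \<integral>\<^sup>+a. ennreal (1 / \<bar>a\<bar>) *
    f (cols (vector [a, c]) (vector [b, (1 + b * c) / a])) \<partial>lborel \<partial>lborel \<partial>lborel)"
proof -
  let ?K = "\<lambda>a b c. ennreal (1 / \<bar>a\<bar>) * f (cols (vector [a, c]) (vector [b, (1 + b * c) / a]))"
  have "(\<integral>\<^sup>+g. f g \<partial>haar) = (\<integral>\<^sup>+a. \<integral>\<^sup>+c. \<integral>\<^sup>+t. f (frame (vector [a, c], t)) \<partial>lborel \<partial>lborel \<partial>lborel)"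
    by (simp add: nn_integral_haar nn_integral_vec2)
  also have "\<dots> = (\<integral>\<^sup>+a. \<integral>\<^sup>+c. \<integral>\<^sup>+b. ?K a b c \<partial>lborel \<partial>lborel \<partial>lborel)"
  proof (rule nn_integral_cong_AE)
    have "AE a in lborel. a \<noteq> (0 :: real)" by (rule AE_lborel_singleton)
    then show "AE a in lborel. (\<integral>\<^sup>+c. \<integral>\<^sup>+t. f (frame (vector [a, c], t)) \<partial>lborel \<partial>lborel)
       = (\<integral>\<^sup>+c. \<integral>\<^sup>+b. ?K a b c \<partial>lborel \<partial>lborel)"
    proof eventually_elim
      case (elim a)
      show ?case
      proof (rule nn_integral_cong)
        fix c :: real
        let ?v = "vector [a, c] :: real^2"
        have "(\<integral>\<^sup>+t. f (frame (?v, t)) \<partial>lborel) = (\<integral>\<^sup>+t. f (cols ?v (vector [0, 1 / a] + t *\<^sub>R ?v)) \<partial>lborel)"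
          using elim by (intro nn_integral_frame_fibre) (simp_all add: det_cols)
        \<comment> \<open>The redundant \<open>0 +\<close> gives the integrand the affine shape that
          the substitution below matches.\<close>
        also have "\<dots> = (\<integral>\<^sup>+t. f (cols ?v (vector [0 + a * t, (1 + (0 + a * t) * c) / a])) \<partial>lborel)"
        proof -
          have "vector [0, 1 / a] + t *\<^sub>R ?v = vector [0 + a * t, (1 + (0 + a * t) * c) / a]" for t
            using elim by (simp add: vec_eq_iff forall_2 field_simps)
          then show ?thesis by simp
        qed
        also have "\<dots> = ennreal (1 / \<bar>a\<bar>) * (ennreal \<bar>a\<bar> * \<dots>)"
          using elim by (simp add: mult.assoc [symmetric] ennreal_mult' [symmetric])
        also have "ennreal \<bar>a\<bar> * (\<integral>\<^sup>+t. f (cols ?v (vector [0 + a * t, (1 + (0 + a * t) * c) / a])) \<partial>lborel)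
            = (\<integral>\<^sup>+b. f (cols ?v (vector [b, (1 + b * c) / a])) \<partial>lborel)"
          by (rule nn_integral_real_affine [OF _ elim, symmetric]) simp
        also have "ennreal (1 / \<bar>a\<bar>) * \<dots> = (\<integral>\<^sup>+b. ?K a b c \<partial>lborel)"
          by (rule nn_integral_cmult [symmetric]) simp
        finally show "(\<integral>\<^sup>+t. f (frame (?v, t)) \<partial>lborel) = (\<integral>\<^sup>+b. ?K a b c \<partial>lborel)" .
      qed
    qed
  qed
  also have "\<dots> = (\<integral>\<^sup>+c. \<integral>\<^sup>+a. \<integral>\<^sup>+b. ?K a b c \<partial>lborel \<partial>lborel \<partial>lborel)"
    by (rule lborel_pair.Fubini') simp
  also have "\<dots> = (\<integral>\<^sup>+c. \<integral>\<^sup>+b. \<integral>\<^sup>+a. ?K a b c \<partial>lborel \<partial>lborel \<partial>lborel)"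
    by (intro nn_integral_cong lborel_pair.Fubini') simp
  finally show ?thesis .
qed

text \<open>Inversion changes the signs of \<open>b\<close> and \<open>c\<close> and replaces
  \<open>a\<close> by \<open>(1 + b * c) / a\<close>; each of these substitutions preserves da db dc
  / |a|.\<close>

lemma nn_integral_haar_adj2:
  assumes [measurable]: "f \<in> borel_measurable borel"
  shows "(\<integral>\<^sup>+g. f (adj2 g) \<partial>haar) = (\<integral>\<^sup>+g. f g \<partial>haar)"
proof -
  let ?M = "\<lambda>a b c. cols (vector [a, c]) (vector [b, (1 + b * c) / a])"
  have "(\<integral>\<^sup>+g. f (adj2 g) \<partial>haar) =
    (\<integral>\<^sup>+c. \<integral>\<^sup>+b. \<integral>\<^sup>+a. ennreal (1 / \<bar>a\<bar>) * f (adj2 (?M a b c)) \<partial>lborel \<partial>lborel \<partial>lborel)"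
    by (rule nn_integral_haar_coords) simp
  also have "\<dots> = (\<integral>\<^sup>+c. \<integral>\<^sup>+b. \<integral>\<^sup>+a. ennreal (1 / \<bar>a\<bar>) * f (?M a (0 - b) (0 - c)) \<partial>lborel \<partial>lborel \<partial>lborel)"
  proof (rule nn_integral_cong, rule nn_integral_cong_AE)
    fix c :: real
    \<comment> \<open>Off this null set \<open>1 + b * c\<close> is nonzero. For
      \<open>c = 0\<close> the excluded value is 0, as division by zero gives 0, which does no
      harm.\<close>
    have "AE b in lborel. b \<noteq> - 1 / c" by (rule AE_lborel_singleton)
    then show "AE b in lborel. (\<integral>\<^sup>+a. ennreal (1 / \<bar>a\<bar>) * f (adj2 (?M a b c)) \<partial>lborel) =
      (\<integral>\<^sup>+a. ennreal (1 / \<bar>a\<bar>) * f (?M a (0 - b) (0 - c)) \<partial>lborel)"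
    proof eventually_elim
      case (elim b)
      then have k: "1 + b * c \<noteq> 0"
        by (cases "c = 0") (auto simp: field_simps)
      have "(\<integral>\<^sup>+a. ennreal (1 / \<bar>a\<bar>) * f (adj2 (?M a b c)) \<partial>lborel) =
        (\<integral>\<^sup>+a. ennreal (1 / \<bar>a\<bar>) * f (?M ((1 + b * c) / a) (0 - b) (0 - c)) \<partial>lborel)"
      proof (rule nn_integral_cong_AE)
        have "AE a in lborel. a \<noteq> (0 :: real)" by (rule AE_lborel_singleton)
        then show "AE a in lborel. ennreal (1 / \<bar>a\<bar>) * f (adj2 (?M a b c)) =
            ennreal (1 / \<bar>a\<bar>) * f (?M ((1 + b * c) / a) (0 - b) (0 - c))"
        proof eventually_elim
          case (elim a)
          then have "adj2 (?M a b c) = ?M ((1 + b * c) / a) (0 - b) (0 - c)"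
            using k by (simp add: vec_eq_iff forall_2)
          then show ?case by simp
        qed
      qed
      also have "\<dots> = (\<integral>\<^sup>+a. ennreal (1 / \<bar>a\<bar>) * f (?M a (0 - b) (0 - c)) \<partial>lborel)"
        by (rule nn_integral_da_over_a_invert [where F = "\<lambda>a. f (?M a (0 - b) (0 - c))", OF _ k]) simp
      finally show ?case .
    qed
  qed
  also have "\<dots> = (\<integral>\<^sup>+c. \<integral>\<^sup>+b. \<integral>\<^sup>+a. ennreal (1 / \<bar>a\<bar>) * f (?M a b (0 - c)) \<partial>lborel \<partial>lborel \<partial>lborel)"
    by (intro nn_integral_cong nn_integral_reflect
        [where f = "\<lambda>b. \<integral>\<^sup>+a. ennreal (1 / \<bar>a\<bar>) * f (?M a b (0 - c)) \<partial>lborel" for c]) simp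
  also have "\<dots> = (\<integral>\<^sup>+c. \<integral>\<^sup>+b. \<integral>\<^sup>+a. ennreal (1 / \<bar>a\<bar>) * f (?M a b c) \<partial>lborel \<partial>lborel \<partial>lborel)"
    by (rule nn_integral_reflect
        [where f = "\<lambda>c. \<integral>\<^sup>+b. \<integral>\<^sup>+a. ennreal (1 / \<bar>a\<bar>) * f (?M a b c) \<partial>lborel \<partial>lborel"]) simp
  also have "\<dots> = (\<integral>\<^sup>+g. f g \<partial>haar)"
    by (rule nn_integral_haar_coords [symmetric]) simp
  finally show ?thesis .
qed

text \<open>Inversion turns right translations into left ones.\<close>

lemma nn_integral_haar_right:
  assumes [measurable]: "f \<in> borel_measurable borel" and h: "h \<in> SL2"
  shows "(\<integral>\<^sup>+g. f (g ** h) \<partial>haar) = (\<integral>\<^sup>+g. f g \<partial>haar)"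
proof -
  have "(\<integral>\<^sup>+g. f (g ** h) \<partial>haar) = (\<integral>\<^sup>+g. f (adj2 (adj2 h ** adj2 g)) \<partial>haar)"
    by (simp add: adj2_mult)
  also have "\<dots> = (\<integral>\<^sup>+g. f (adj2 (adj2 h ** g)) \<partial>haar)"
    by (rule nn_integral_haar_adj2 [where f = "\<lambda>g. f (adj2 (adj2 h ** g))"]) simp
  also have "\<dots> = (\<integral>\<^sup>+g. f (adj2 g) \<partial>haar)"
    by (rule nn_integral_haar_left [where f = "\<lambda>g. f (adj2 g)"]) (simp_all add: h)
  finally show ?thesis by (simp add: nn_integral_haar_adj2)
qed

section \<open>Uniqueness of the invariant measure\<close>

definition lattice_basis :: "(real^2) set \<Rightarrow> real^2^2" where
  "lattice_basis = (SOME s. s \<in> measurable borel_lattices borel \<and>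
     (\<forall>\<Lambda>\<in>unimodular_lattices. s \<Lambda> \<in> bases \<Lambda>))"

text \<open>As an integral against counting measure the infinite sum always has a value in
  \<open>ennreal\<close>, and Tonelli applies to it.\<close>

definition basis_sum :: "(real^2^2 \<Rightarrow> ennreal) \<Rightarrow> (real^2) set \<Rightarrow> ennreal" where
  "basis_sum f \<Lambda> = (\<integral>\<^sup>+g. f g \<partial>count_space (bases \<Lambda>))"

lemma lattice_basis:
  shows measurable_lattice_basis [measurable]: "lattice_basis \<in> measurable borel_lattices borel"
    and lattice_basis_bases: "\<Lambda> \<in> unimodular_lattices \<Longrightarrow> lattice_basis \<Lambda> \<in> bases \<Lambda>"
proof -
  have "\<exists>s. s \<in> measurable borel_lattices borel \<and> (\<forall>\<Lambda>\<in>unimodular_lattices. s \<Lambda> \<in> bases \<Lambda>)"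
    using measurable_section by metis
  from someI_ex [OF this]
  show "lattice_basis \<in> measurable borel_lattices borel"
    "\<Lambda> \<in> unimodular_lattices \<Longrightarrow> lattice_basis \<Lambda> \<in> bases \<Lambda>"
    unfolding lattice_basis_def by blast+
qed

lemma basis_sum_eq:
  assumes "g \<in> bases \<Lambda>"
  shows "basis_sum f \<Lambda> = (\<integral>\<^sup>+\<gamma>. f (g ** \<gamma>) \<partial>count_space int_SL2)"
proof -
  have "bij_betw ((**) g) int_SL2 (bases \<Lambda>)"
    unfolding bij_betw_def using bases_eq [OF assms] inj_SL2_mult [OF bases_SL2 [OF assms]]
    by (auto intro: inj_on_subset)
  then show ?thesis
    unfolding basis_sum_def by (rule nn_integral_bij_count_space [symmetric])
qed

lemma basis_sum_act:
  assumes "h \<in> SL2"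
  shows "basis_sum f (act h \<Lambda>) = basis_sum (\<lambda>g. f (h ** g)) \<Lambda>"
proof -
  have "bij_betw ((**) h) (bases \<Lambda>) (bases (act h \<Lambda>))"
    unfolding bij_betw_def using bases_act [OF assms] inj_SL2_mult [OF assms]
    by (auto intro: inj_on_subset)
  then show ?thesis
    unfolding basis_sum_def by (rule nn_integral_bij_count_space [symmetric])
qed

lemma measurable_lattice_basis_mult [measurable]:
  "(\<lambda>(\<Lambda>, \<gamma>). lattice_basis \<Lambda> ** \<gamma>) \<in> borel_measurable (borel_lattices \<Otimes>\<^sub>M count_space int_SL2)"
  by (subst measurable_pair_swap_iff, rule measurable_pair_measure_countable1 [OF countable_int_SL2]) simp

text \<open>The section \<open>lattice_basis\<close> rewrites the sum over a varying fibre as one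
  over the countable set \<open>int_SL2\<close>.\<close>

lemma measurable_basis_sum [measurable]:
  assumes [measurable]: "f \<in> borel_measurable borel"
  shows "basis_sum f \<in> borel_measurable borel_lattices"
proof -
  interpret sigma_finite_measure "count_space int_SL2"
    by (rule sigma_finite_measure_count_space_countable [OF countable_int_SL2])
  have "(\<lambda>\<Lambda>. \<integral>\<^sup>+\<gamma>. f (lattice_basis \<Lambda> ** \<gamma>) \<partial>count_space int_SL2) \<in> borel_measurable borel_lattices"
  proof (rule borel_measurable_nn_integral)
    have "(\<lambda>x. f ((\<lambda>(\<Lambda>, \<gamma>). lattice_basis \<Lambda> ** \<gamma>) x)) \<in> borel_measurable (borel_lattices \<Otimes>\<^sub>M count_space int_SL2)"
      by measurable
    then show "(\<lambda>(\<Lambda>, \<gamma>). f (lattice_basis \<Lambda> ** \<gamma>)) \<in> borel_measurable (borel_lattices \<Otimes>\<^sub>M count_space int_SL2)"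
      by (simp add: case_prod_unfold)
  qed
  moreover have "basis_sum f \<Lambda> = (\<integral>\<^sup>+\<gamma>. f (lattice_basis \<Lambda> ** \<gamma>) \<partial>count_space int_SL2)"
    if "\<Lambda> \<in> space borel_lattices" for \<Lambda>
    using that by (simp add: basis_sum_eq [OF lattice_basis_bases])
  ultimately show ?thesis
    by (rule measurable_cong [THEN iffD2, rotated])
qed

lemma AE_fst_nonzero: "AE p in (lborel :: ((real^2) \<times> real) measure). fst p \<noteq> 0"
proof (rule AE_I)
  show "{p \<in> space lborel. \<not> fst p \<noteq> 0} \<subseteq> {0} \<times> (UNIV :: real set)" by auto
  show "emeasure lborel ({0 :: real^2} \<times> (UNIV :: real set)) = 0"
    unfolding lborel_prod [symmetric] by (subst lborel.emeasure_pair_measure_Times) simp_all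
  show "{0 :: real^2} \<times> (UNIV :: real set) \<in> sets lborel"
    unfolding lborel_prod [symmetric] by simp
qed

locale invariant_measure =
  fixes \<mu> :: "(real^2) set measure"
  assumes inv: "invariant_probability \<mu>"
begin

lemma sets_\<mu> [simp, measurable_cong]: "sets \<mu> = sets borel_lattices"
  using inv by (simp add: invariant_probability_def)

lemma space_\<mu> [simp]: "space \<mu> = unimodular_lattices"
  using sets_eq_imp_space_eq [OF sets_\<mu>] by simp

lemma emeasure_space_\<mu>: "emeasure \<mu> unimodular_lattices = 1"
  using inv unfolding invariant_probability_def by (simp only: space_\<mu>)

sublocale finite_measure \<mu>
  by (rule finite_measureI) (simp add: emeasure_space_\<mu>)

lemma measurable_act: "h \<in> SL2 \<Longrightarrow> act h \<in> measurable \<mu> \<mu>"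
  using act_measurable by (simp cong: measurable_cong_sets)

lemma nn_integral_act:
  assumes "h \<in> SL2" and [measurable]: "F \<in> borel_measurable borel_lattices"
  shows "(\<integral>\<^sup>+\<Lambda>. F (act h \<Lambda>) \<partial>\<mu>) = (\<integral>\<^sup>+\<Lambda>. F \<Lambda> \<partial>\<mu>)"
proof -
  have "(\<integral>\<^sup>+\<Lambda>. F \<Lambda> \<partial>\<mu>) = (\<integral>\<^sup>+\<Lambda>. F \<Lambda> \<partial>distr \<mu> \<mu> (act h))"
    using inv assms by (simp add: invariant_probability_def)
  also have "\<dots> = (\<integral>\<^sup>+\<Lambda>. F (act h \<Lambda>) \<partial>\<mu>)"
    by (rule nn_integral_distr) (simp_all add: measurable_act assms)
  finally show ?thesis by simp
qed

lemma nn_integral_basis_sum_invariant: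
  assumes [measurable]: "f \<in> borel_measurable borel" and h: "h \<in> SL2"
  shows "(\<integral>\<^sup>+\<Lambda>. basis_sum (\<lambda>g. f (h ** g)) \<Lambda> \<partial>\<mu>) = (\<integral>\<^sup>+\<Lambda>. basis_sum f \<Lambda> \<partial>\<mu>)"
  using nn_integral_act [OF h, of "basis_sum f"] by (simp add: basis_sum_act h)

text \<open>Write \<open>\<phi>\<close> as \<open>\<phi> (y ** x)\<close> by right invariance of Haar measure in \<open>y\<close>, swap the integrals,
  move \<open>y\<close> to \<open>f\<close> by left invariance of the sum over bases in \<open>x\<close>, and remove it from
  \<open>f (adj2 y ** x)\<close> because Haar measure is unimodular.\<close>

lemma haar_unique:
  assumes [measurable]: "f \<in> borel_measurable borel" "\<phi> \<in> borel_measurable borel"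
  shows "(\<integral>\<^sup>+\<Lambda>. basis_sum f \<Lambda> \<partial>\<mu>) * (\<integral>\<^sup>+g. \<phi> g \<partial>haar) =
    (\<integral>\<^sup>+\<Lambda>. basis_sum \<phi> \<Lambda> \<partial>\<mu>) * (\<integral>\<^sup>+g. f g \<partial>haar)"
proof -
  \<comment> \<open>Pairs of a lattice and one of its bases are parametrized by a product space, so
    that means of sums over bases become integrals over \<open>N\<close>.\<close>
  define N where "N = \<mu> \<Otimes>\<^sub>M count_space int_SL2"
  define b :: "(real^2) set \<times> (real^2^2) \<Rightarrow> real^2^2" where "b q = lattice_basis (fst q) ** snd q" for q
  interpret C: sigma_finite_measure "count_space int_SL2"
    by (rule sigma_finite_measure_count_space_countable [OF countable_int_SL2])
  interpret P: pair_sigma_finite \<mu> "count_space int_SL2" ..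
  \<comment> \<open>The Haar variable is integrated in the coordinates of \<open>frame\<close>,
    where the measure is \<open>lborel\<close> and sigma-finite.\<close>
  interpret Q: pair_sigma_finite N "lborel :: ((real^2) \<times> real) measure"
    unfolding N_def ..
  have b [measurable]: "b \<in> borel_measurable N"
    using measurable_lattice_basis_mult unfolding N_def b_def case_prod_unfold
    by (simp cong: measurable_cong_sets sets_pair_measure_cong)
  have b_SL2: "b q \<in> SL2" if "q \<in> space N" for q
  proof -
    have "fst q \<in> unimodular_lattices" "snd q \<in> int_SL2"
      using that by (auto simp: N_def space_pair_measure)
    then show ?thesis
      unfolding b_def by (intro mult_SL2 bases_SL2 [OF lattice_basis_bases] int_SL2_subset)
  qed
  have N: "(\<integral>\<^sup>+\<Lambda>. basis_sum F \<Lambda> \<partial>\<mu>) = (\<integral>\<^sup>+q. F (b q) \<partial>N)"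
    if [measurable]: "F \<in> borel_measurable borel" for F
  proof -
    have "(\<lambda>q. F (b q)) \<in> borel_measurable N" by measurable
    then have "(\<integral>\<^sup>+q. F (b q) \<partial>N) = (\<integral>\<^sup>+\<Lambda>. \<integral>\<^sup>+\<gamma>. F (b (\<Lambda>, \<gamma>)) \<partial>count_space int_SL2 \<partial>\<mu>)"
      unfolding N_def by (rule C.nn_integral_fst [symmetric])
    also have "\<dots> = (\<integral>\<^sup>+\<Lambda>. basis_sum F \<Lambda> \<partial>\<mu>)"
      by (intro nn_integral_cong) (simp add: b_def basis_sum_eq [OF lattice_basis_bases])
    finally show ?thesis by simp
  qed
  have haar: "(\<integral>\<^sup>+g. F g \<partial>haar) = (\<integral>\<^sup>+p. F (frame p) \<partial>lborel)"
    if "F \<in> borel_measurable borel" for F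
    unfolding haar_def using that by (subst nn_integral_distr) simp_all
  have "(\<integral>\<^sup>+\<Lambda>. basis_sum f \<Lambda> \<partial>\<mu>) * (\<integral>\<^sup>+g. \<phi> g \<partial>haar) = (\<integral>\<^sup>+q. f (b q) * (\<integral>\<^sup>+g. \<phi> g \<partial>haar) \<partial>N)"
    by (simp add: N nn_integral_multc)
  also have "\<dots> = (\<integral>\<^sup>+q. \<integral>\<^sup>+p. f (b q) * \<phi> (frame p ** b q) \<partial>lborel \<partial>N)"
  proof (rule nn_integral_cong)
    fix q assume q: "q \<in> space N"
    have "(\<integral>\<^sup>+g. \<phi> g \<partial>haar) = (\<integral>\<^sup>+g. \<phi> (g ** b q) \<partial>haar)"
      by (rule nn_integral_haar_right [symmetric]) (simp_all add: b_SL2 q)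
    also have "\<dots> = (\<integral>\<^sup>+p. \<phi> (frame p ** b q) \<partial>lborel)"
      by (rule haar) simp
    finally show "f (b q) * (\<integral>\<^sup>+g. \<phi> g \<partial>haar) = (\<integral>\<^sup>+p. f (b q) * \<phi> (frame p ** b q) \<partial>lborel)"
      by (simp add: nn_integral_cmult)
  qed
  also have "\<dots> = (\<integral>\<^sup>+p. \<integral>\<^sup>+q. f (b q) * \<phi> (frame p ** b q) \<partial>N \<partial>lborel)"
    by (rule Q.Fubini' [symmetric]) simp
  also have "\<dots> = (\<integral>\<^sup>+p. \<integral>\<^sup>+q. f (adj2 (frame p) ** b q) * \<phi> (b q) \<partial>N \<partial>lborel)"
  proof (rule nn_integral_cong_AE)
    show "AE p in lborel. (\<integral>\<^sup>+q. f (b q) * \<phi> (frame p ** b q) \<partial>N)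
        = (\<integral>\<^sup>+q. f (adj2 (frame p) ** b q) * \<phi> (b q) \<partial>N)"
      using AE_fst_nonzero
    proof eventually_elim
      case (elim p)
      then have p: "frame p \<in> SL2" by (rule frame_SL2)
      let ?H = "\<lambda>g. f (adj2 (frame p) ** g) * \<phi> g"
      have "(\<integral>\<^sup>+q. ?H (b q) \<partial>N) = (\<integral>\<^sup>+\<Lambda>. basis_sum ?H \<Lambda> \<partial>\<mu>)"
        by (rule N [symmetric]) simp
      also have "\<dots> = (\<integral>\<^sup>+\<Lambda>. basis_sum (\<lambda>g. ?H (frame p ** g)) \<Lambda> \<partial>\<mu>)"
        by (rule nn_integral_basis_sum_invariant [symmetric]) (simp_all add: p)
      also have "\<dots> = (\<integral>\<^sup>+q. ?H (frame p ** b q) \<partial>N)"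
        by (rule N) simp
      finally show ?case by (simp add: adj2_cancel p)
    qed
  qed
  also have "\<dots> = (\<integral>\<^sup>+q. \<integral>\<^sup>+p. f (adj2 (frame p) ** b q) * \<phi> (b q) \<partial>lborel \<partial>N)"
    by (rule Q.Fubini') simp
  also have "\<dots> = (\<integral>\<^sup>+q. \<phi> (b q) * (\<integral>\<^sup>+g. f g \<partial>haar) \<partial>N)"
  proof (rule nn_integral_cong)
    fix q assume q: "q \<in> space N"
    have "(\<integral>\<^sup>+p. f (adj2 (frame p) ** b q) \<partial>lborel) = (\<integral>\<^sup>+g. f (adj2 g ** b q) \<partial>haar)"
      by (rule haar [symmetric]) simp
    also have "\<dots> = (\<integral>\<^sup>+g. f (g ** b q) \<partial>haar)"
      by (rule nn_integral_haar_adj2 [where f = "\<lambda>g. f (g ** b q)"]) simp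
    also have "\<dots> = (\<integral>\<^sup>+g. f g \<partial>haar)"
      by (rule nn_integral_haar_right) (simp_all add: b_SL2 q)
    finally show "(\<integral>\<^sup>+p. f (adj2 (frame p) ** b q) * \<phi> (b q) \<partial>lborel) = \<phi> (b q) * (\<integral>\<^sup>+g. f g \<partial>haar)"
      by (subst nn_integral_multc) (simp_all add: mult.commute)
  qed
  also have "\<dots> = (\<integral>\<^sup>+\<Lambda>. basis_sum \<phi> \<Lambda> \<partial>\<mu>) * (\<integral>\<^sup>+g. f g \<partial>haar)"
    by (simp add: N nn_integral_multc)
  finally show ?thesis .
qed

end

section \<open>Reduced bases and the mean value formula\<close>

definition reduced :: "(real^2^2) set" where
  "reduced = {g \<in> SL2. 2 * \<bar>column 1 g \<bullet> column 2 g\<bar> \<le> column 1 g \<bullet> column 1 g \<and>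
     column 1 g \<bullet> column 1 g \<le> column 2 g \<bullet> column 2 g}"

definition strictly_reduced :: "(real^2^2) set" where
  "strictly_reduced = {g \<in> SL2. 2 * \<bar>column 1 g \<bullet> column 2 g\<bar> < column 1 g \<bullet> column 1 g \<and>
     column 1 g \<bullet> column 1 g < column 2 g \<bullet> column 2 g}"

section \<open>Gauss reduction of lattice bases\<close>

lemma finite_lattice_ball:
  assumes "\<Lambda> \<in> unimodular_lattices"
  shows "finite {v \<in> \<Lambda>. norm v \<le> R}"
proof -
  obtain g where g: "g \<in> SL2" "\<Lambda> = lattice_of g"
    using assms by (auto simp: unimodular_lattices_eq)
  \<comment> \<open>A crude common bound: Cramer's rule expresses each integer coordinate through
    two entries of \<open>g\<close> and the components of \<open>v\<close>.\<close>
  define K where "K = (\<bar>g $ 1 $ 1\<bar> + \<bar>g $ 1 $ 2\<bar> + \<bar>g $ 2 $ 1\<bar> + \<bar>g $ 2 $ 2\<bar>) * R"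
  let ?A = "{- \<lceil>K\<rceil> .. \<lceil>K\<rceil>}"
  have "finite ((\<lambda>(a, b). of_int a *\<^sub>R column 1 g + of_int b *\<^sub>R column 2 g) ` (?A \<times> ?A))"
    by (intro finite_imageI finite_cartesian_product) simp_all
  moreover have "{v \<in> \<Lambda>. norm v \<le> R} \<subseteq> (\<lambda>(a, b). of_int a *\<^sub>R column 1 g + of_int b *\<^sub>R column 2 g) ` (?A \<times> ?A)"
  proof
    fix v assume "v \<in> {v \<in> \<Lambda>. norm v \<le> R}"
    then have v: "v \<in> lattice_of g" "norm v \<le> R" using g by auto
    obtain a b :: int where ab: "v = of_int a *\<^sub>R column 1 g + of_int b *\<^sub>R column 2 g"
      using v(1) by (rule lattice_ofE)
    have 1: "g $ 1 $ 1 * g $ 2 $ 2 - g $ 1 $ 2 * g $ 2 $ 1 = 1"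
      using g by (simp add: SL2_def det_2)
    have v12: "v $ 1 = of_int a * g $ 1 $ 1 + of_int b * g $ 1 $ 2"
      "v $ 2 = of_int a * g $ 2 $ 1 + of_int b * g $ 2 $ 2"
      by (simp_all add: ab column_def)
    have "of_int a * (g $ 1 $ 1 * g $ 2 $ 2 - g $ 1 $ 2 * g $ 2 $ 1) = g $ 2 $ 2 * v $ 1 - g $ 1 $ 2 * v $ 2"
      "of_int b * (g $ 1 $ 1 * g $ 2 $ 2 - g $ 1 $ 2 * g $ 2 $ 1) = g $ 1 $ 1 * v $ 2 - g $ 2 $ 1 * v $ 1"
      unfolding v12 by (simp_all add: algebra_simps)
    then have a: "of_int a = g $ 2 $ 2 * v $ 1 - g $ 1 $ 2 * v $ 2"
      and b: "of_int b = g $ 1 $ 1 * v $ 2 - g $ 2 $ 1 * v $ 1"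
      by (simp_all add: 1)
    have vR: "\<bar>v $ i\<bar> \<le> R" for i
      using v(2) component_le_norm_cart [of v i] by linarith
    then have R: "0 \<le> R" by (meson abs_ge_zero order_trans)
    have m: "\<bar>x * v $ i\<bar> \<le> \<bar>x\<bar> * R" for x i
      unfolding abs_mult by (intro mult_left_mono vR) simp
    have n: "0 \<le> \<bar>x\<bar> * R" for x using R by simp
    have "\<bar>of_int a\<bar> \<le> K"
      using m [of "g $ 2 $ 2" 1] m [of "g $ 1 $ 2" 2] n [of "g $ 1 $ 1"] n [of "g $ 2 $ 1"]
      unfolding a K_def distrib_right by linarith
    moreover have "\<bar>of_int b\<bar> \<le> K"
      using m [of "g $ 1 $ 1" 2] m [of "g $ 2 $ 1" 1] n [of "g $ 1 $ 2"] n [of "g $ 2 $ 2"]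
      unfolding b K_def distrib_right by linarith
    ultimately have "\<bar>a\<bar> \<le> \<lceil>K\<rceil>" "\<bar>b\<bar> \<le> \<lceil>K\<rceil>"
      by (simp_all add: le_ceiling_iff)
    then show "v \<in> (\<lambda>(a, b). of_int a *\<^sub>R column 1 g + of_int b *\<^sub>R column 2 g) ` (?A \<times> ?A)"
      unfolding ab by (auto simp: abs_le_iff intro!: image_eqI [of _ _ "(a, b)"])
  qed
  ultimately show ?thesis by (rule finite_subset [rotated])
qed

lemma shortest_vector:
  assumes "\<Lambda> \<in> unimodular_lattices"
  obtains v where "v \<in> \<Lambda>" "v \<noteq> 0" "\<And>w. w \<in> \<Lambda> \<Longrightarrow> w \<noteq> 0 \<Longrightarrow> norm v \<le> norm w"
proof -
  obtain g where g: "g \<in> bases \<Lambda>" using assms by (rule bases_nonempty)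
  let ?S = "{w \<in> \<Lambda>. norm w \<le> norm (column 1 g)} - {0}"
  have c: "column 1 g \<in> ?S"
    using g column_SL2_nonzero(1) [OF bases_SL2 [OF g]] column_in_lattice(1) [of g] by (auto simp: bases_def)
  have "finite ?S" using finite_lattice_ball [OF assms] by simp
  moreover have "?S \<noteq> {}" using c by blast
  ultimately obtain v where v: "v \<in> ?S" "\<And>w. w \<in> ?S \<Longrightarrow> norm v \<le> norm w"
    using arg_min_if_finite [of ?S norm] not_le by blast
  show thesis
  proof
    show "v \<in> \<Lambda>" "v \<noteq> 0" using v by auto
    show "norm v \<le> norm w" if "w \<in> \<Lambda>" "w \<noteq> 0" for w
      using that v(2) [of w] v(2) [OF c] by (cases "norm w \<le> norm (column 1 g)") auto
  qed
qed

text \<open>The primitive vector below a shortest vector is itself shortest. Complete it to a basis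
  and subtract the nearest integral multiple, which brings the shear coordinate into
  [-1/2, 1/2].\<close>

lemma reduced_basis_exists:
  assumes "\<Lambda> \<in> unimodular_lattices"
  obtains g where "g \<in> bases \<Lambda>" "g \<in> reduced"
proof -
  obtain v where v: "v \<in> \<Lambda>" "v \<noteq> 0" "\<And>w. w \<in> \<Lambda> \<Longrightarrow> w \<noteq> 0 \<Longrightarrow> norm v \<le> norm w"
    using assms by (rule shortest_vector) blast
  obtain g k where g: "g \<in> bases \<Lambda>" "k > 0" "v = of_nat k *\<^sub>R column 1 g"
    using lattice_vector_primitive [OF assms v(1,2)] by metis
  have "norm (column 1 g) \<le> norm v" unfolding g(3) using g(2) by (simp add: mult_le_cancel_right1)
  then have short: "norm (column 1 g) \<le> norm w" if "w \<in> \<Lambda>" "w \<noteq> 0" for w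
    using v(3) that by (meson order_trans)
  have c1: "column 1 g \<noteq> 0" using g column_SL2_nonzero bases_SL2 by blast
  define t where "t = (column 1 g \<bullet> column 2 g) / (column 1 g \<bullet> column 1 g)"
  define h where "h = cols (column 1 g) (column 2 g + of_int (- round t) *\<^sub>R column 1 g)"
  have h: "h \<in> bases \<Lambda>" unfolding h_def by (rule bases_shear [OF g(1)])
  have "column 2 h \<in> \<Lambda>" "column 2 h \<noteq> 0"
    using h column_in_lattice(2) [of h] column_SL2_nonzero(2) [of h] by (auto simp: bases_def)
  then have "norm (column 1 g) \<le> norm (column 2 h)" by (rule short)
  then have 1: "column 1 h \<bullet> column 1 h \<le> column 2 h \<bullet> column 2 h"
    by (simp add: h_def norm_le)
  have "column 1 h \<bullet> column 2 h = (t - of_int (round t)) * (column 1 g \<bullet> column 1 g)"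
    using c1 by (simp add: h_def inner_diff_right t_def algebra_simps)
  moreover have "\<bar>t - of_int (round t)\<bar> \<le> 1 / 2"
    using of_int_round_abs_le [of t] by (simp add: abs_minus_commute)
  then have "\<bar>t - of_int (round t)\<bar> * (column 1 g \<bullet> column 1 g) \<le> 1 / 2 * (column 1 g \<bullet> column 1 g)"
    by (rule mult_right_mono) simp
  ultimately have "2 * \<bar>column 1 h \<bullet> column 2 h\<bar> \<le> column 1 h \<bullet> column 1 h"
    by (simp add: abs_mult h_def)
  with 1 h have "h \<in> reduced" by (simp add: reduced_def bases_SL2)
  with h show thesis by (rule that)
qed

text \<open>For \<open>w\<close> = a v + b u with b nonzero, strict reduction puts the squared
  length of \<open>w\<close> above a^2 - |a b| + b^2 times that of v, and this integer form is at
  least 1.\<close>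

lemma strictly_reduced_shortest:
  assumes g: "g \<in> strictly_reduced" and w: "w \<in> lattice_of g" "w \<noteq> 0" "w \<bullet> w \<le> column 1 g \<bullet> column 1 g"
  shows "w = column 1 g \<or> w = - column 1 g"
proof -
  let ?v = "column 1 g" and ?u = "column 2 g"
  obtain a b :: int where ab: "w = of_int a *\<^sub>R ?v + of_int b *\<^sub>R ?u"
    using w(1) by (rule lattice_ofE)
  have red: "2 * \<bar>?v \<bullet> ?u\<bar> < ?v \<bullet> ?v" "?v \<bullet> ?v < ?u \<bullet> ?u"
    using g by (auto simp: strictly_reduced_def)
  then have v: "?v \<bullet> ?v > 0" by linarith
  have ww: "w \<bullet> w = (of_int a)\<^sup>2 * (?v \<bullet> ?v) + 2 * (of_int a * of_int b) * (?v \<bullet> ?u) + (of_int b)\<^sup>2 * (?u \<bullet> ?u)"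
    unfolding ab by (simp add: inner_add_left inner_add_right inner_commute algebra_simps power2_eq_square)
  have "b = 0"
  proof (rule ccontr)
    assume b: "b \<noteq> 0"
    have "2 * (of_int a * of_int b) * (?v \<bullet> ?u) \<ge> - (2 * \<bar>of_int a * of_int b\<bar> * \<bar>?v \<bullet> ?u\<bar>)"
      by (metis abs_ge_minus_self abs_mult abs_numeral minus_le_iff)
    moreover have "\<bar>of_int a * of_int b\<bar> * (2 * \<bar>?v \<bullet> ?u\<bar>) \<le> \<bar>of_int a * of_int b\<bar> * (?v \<bullet> ?v)"
      using red by (intro mult_left_mono) auto
    moreover have "(of_int b)\<^sup>2 * (?v \<bullet> ?v) < (of_int b)\<^sup>2 * (?u \<bullet> ?u)"
      using red b by simp
    ultimately have "((of_int a)\<^sup>2 - \<bar>of_int a * of_int b\<bar> + (of_int b)\<^sup>2) * (?v \<bullet> ?v) < w \<bullet> w"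
      unfolding ww by (simp add: algebra_simps)
    moreover have "(1 :: real) \<le> (of_int a)\<^sup>2 - \<bar>of_int a * of_int b\<bar> + (of_int b)\<^sup>2"
    proof -
      have "1 \<le> a\<^sup>2 - \<bar>a * b\<bar> + b\<^sup>2"
      proof (cases "a = 0")
        case True
        then show ?thesis using b by (simp add: int_one_le_iff_zero_less)
      next
        case False
        \<comment> \<open>By the arithmetic-geometric mean the form is at least |a b|, which is at
          least 1.\<close>
        have "0 \<le> (\<bar>a\<bar> - \<bar>b\<bar>)\<^sup>2" by simp
        then have "2 * \<bar>a * b\<bar> \<le> a\<^sup>2 + b\<^sup>2" by (simp add: power2_diff abs_mult)
        moreover have "\<bar>a * b\<bar> \<ge> 1" using False b by (simp add: int_one_le_iff_zero_less)
        ultimately show ?thesis by linarith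
      qed
      then have "(of_int 1 :: real) \<le> of_int (a\<^sup>2 - \<bar>a * b\<bar> + b\<^sup>2)" by (simp only: of_int_le_iff)
      then show ?thesis by simp
    qed
    then have "1 * (?v \<bullet> ?v) \<le> ((of_int a)\<^sup>2 - \<bar>of_int a * of_int b\<bar> + (of_int b)\<^sup>2) * (?v \<bullet> ?v)"
      using v by (intro mult_right_mono) auto
    ultimately show False using w(3) by linarith
  qed
  then have "of_int (a\<^sup>2) * (?v \<bullet> ?v) \<le> of_int 1 * (?v \<bullet> ?v)" using w(3) ww by simp
  then have "a\<^sup>2 \<le> 1" using v by (simp only: mult_le_cancel_right_pos of_int_le_iff)
  moreover have "a \<noteq> 0" using w(2) \<open>b = 0\<close> ab by auto
  ultimately have "\<bar>a\<bar> = 1" by (simp add: abs_square_le_1)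
  then show ?thesis using \<open>b = 0\<close> ab by (auto simp: abs_eq_iff')
qed

text \<open>By minimality the shorter of the two first columns is the other one up to sign. Equal
  first columns leave an integral shear, and the strict inequalities confine it to 0.\<close>

lemma strictly_reduced_unique:
  assumes g: "g \<in> bases \<Lambda>" "g \<in> strictly_reduced" and h: "h \<in> bases \<Lambda>" "h \<in> strictly_reduced"
  shows "h = g \<or> h = cols (- column 1 g) (- column 2 g)"
proof -
  have aux: "h = g" if g: "g \<in> bases \<Lambda>" "g \<in> strictly_reduced" and h: "h \<in> bases \<Lambda>" "h \<in> strictly_reduced"
    and eq: "column 1 h = column 1 g" for g h
  proof -
    obtain k :: int where k: "column 2 h = column 2 g + of_int k *\<^sub>R column 1 g"
      using g(1) h(1) eq by (rule bases_same_column)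
    let ?v = "column 1 g"
    have 1: "2 * \<bar>?v \<bullet> column 2 g\<bar> < ?v \<bullet> ?v" "2 * \<bar>?v \<bullet> column 2 h\<bar> < ?v \<bullet> ?v"
      using g(2) h(2) eq by (auto simp: strictly_reduced_def)
    have "of_int k * (?v \<bullet> ?v) = ?v \<bullet> column 2 h - ?v \<bullet> column 2 g"
      unfolding k by (simp add: inner_add_right)
    then have "\<bar>of_int k * (?v \<bullet> ?v)\<bar> < 1 * (?v \<bullet> ?v)" using 1 by linarith
    moreover have "\<bar>of_int k * (?v \<bullet> ?v)\<bar> = \<bar>of_int k\<bar> * (?v \<bullet> ?v)" by (simp add: abs_mult)
    moreover have "?v \<bullet> ?v > 0" using 1 by linarith
    ultimately have "\<bar>of_int k :: real\<bar> < 1" by (simp only: mult_less_cancel_right_pos)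
    then have "k = 0" by linarith
    then show ?thesis using k eq by (metis add.right_neutral cols_column of_int_0 scale_zero_left)
  qed
  have "column 1 h \<in> lattice_of g" "column 1 g \<in> lattice_of h"
    using column_in_lattice(1) [of h] column_in_lattice(1) [of g] g h by (auto simp: bases_def)
  moreover have "column 1 g \<noteq> 0" "column 1 h \<noteq> 0"
    using g h column_SL2_nonzero bases_SL2 by blast+
  ultimately have "column 1 h = column 1 g \<or> column 1 h = - column 1 g"
    using strictly_reduced_shortest [OF g(2), of "column 1 h"] strictly_reduced_shortest [OF h(2), of "column 1 g"]
    by (cases "column 1 h \<bullet> column 1 h \<le> column 1 g \<bullet> column 1 g") auto
  then show ?thesis
  proof
    assume "column 1 h = column 1 g"
    then show ?thesis using aux g h by blast
  next
    assume *: "column 1 h = - column 1 g"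
    let ?g = "cols (- column 1 g) (- column 2 g)"
    have "?g \<in> bases \<Lambda>" using g bases_uminus by blast
    moreover from this have "?g \<in> strictly_reduced"
      using g by (simp add: strictly_reduced_def bases_SL2)
    ultimately show ?thesis using aux [of ?g h] h * by simp
  qed
qed

lemma basis_sum_indicator:
  "basis_sum (indicator F) \<Lambda> = (if finite (bases \<Lambda> \<inter> F) then of_nat (card (bases \<Lambda> \<inter> F)) else \<infinity>)"
proof -
  have "basis_sum (indicator F) \<Lambda> = (\<integral>\<^sup>+g. indicator (bases \<Lambda> \<inter> F) g \<partial>count_space (bases \<Lambda>))"
    unfolding basis_sum_def by (intro nn_integral_cong) (simp add: indicator_def)
  also have "\<dots> = emeasure (count_space (bases \<Lambda>)) (bases \<Lambda> \<inter> F)"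
    by (rule nn_integral_indicator) simp
  finally show ?thesis by (simp add: emeasure_count_space)
qed

lemma card_le_basis_sum:
  assumes "A \<subseteq> bases \<Lambda> \<inter> F" "finite A"
  shows "of_nat (card A) \<le> basis_sum (indicator F) \<Lambda>"
  unfolding basis_sum_indicator using assms by (auto intro!: card_mono)

lemma basis_sum_le_card:
  assumes "bases \<Lambda> \<inter> F \<subseteq> A" "finite A"
  shows "basis_sum (indicator F) \<Lambda> \<le> of_nat (card A)"
  unfolding basis_sum_indicator using assms finite_subset [of "bases \<Lambda> \<inter> F" A] by (auto intro!: card_mono)

lemma basis_sum_reduced:
  assumes "\<Lambda> \<in> unimodular_lattices"
  shows "2 \<le> basis_sum (indicator reduced) \<Lambda>"
proof -
  obtain g where g: "g \<in> bases \<Lambda>" "g \<in> reduced" using assms by (rule reduced_basis_exists)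
  let ?g = "cols (- column 1 g) (- column 2 g)"
  have "?g \<in> bases \<Lambda>" using g bases_uminus by blast
  moreover from this have "?g \<in> reduced" using g by (simp add: reduced_def bases_SL2)
  ultimately have "of_nat (card {g, ?g}) \<le> basis_sum (indicator reduced) \<Lambda>"
    using g by (intro card_le_basis_sum) auto
  moreover have "g \<noteq> ?g"
  proof
    assume "g = ?g"
    then have "column 1 g = - column 1 g" by (metis column_cols(1))
    then have "column 1 g = 0" by (simp add: vec_eq_iff)
    then show False using column_SL2_nonzero(1) [OF bases_SL2 [OF g(1)]] by simp
  qed
  ultimately show ?thesis by simp
qed

lemma basis_sum_strictly_reduced: "basis_sum (indicator strictly_reduced) \<Lambda> \<le> 2"
proof -
  obtain A where A: "bases \<Lambda> \<inter> strictly_reduced \<subseteq> A" "finite A" "card A \<le> 2"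
  proof (cases "bases \<Lambda> \<inter> strictly_reduced = {}")
    case True
    then show thesis using that [of "{}"] by simp
  next
    case False
    then obtain g where g: "g \<in> bases \<Lambda>" "g \<in> strictly_reduced" by blast
    show thesis
    proof (rule that)
      show "bases \<Lambda> \<inter> strictly_reduced \<subseteq> {g, cols (- column 1 g) (- column 2 g)}"
        using strictly_reduced_unique [OF g] by blast
      show "card {g, cols (- column 1 g) (- column 2 g)} \<le> 2"
        by (rule order_trans [OF card_insert_le_m1]) auto
    qed simp
  qed
  have "basis_sum (indicator strictly_reduced) \<Lambda> \<le> of_nat (card A)"
    by (rule basis_sum_le_card [OF A(1,2)])
  also have "\<dots> \<le> of_nat 2" using A(3) by (simp only: of_nat_le_iff)
  finally show ?thesis by simp
qed

section \<open>Haar measure of the reduced matrices\<close>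

lemma inner_normal_vec_self: "normal_vec v \<bullet> normal_vec v = 1 / (v \<bullet> v)"
proof -
  have "normal_vec v \<bullet> normal_vec v = (v $ 1 * v $ 1 + v $ 2 * v $ 2) / ((v \<bullet> v) * (v \<bullet> v))"
    by (simp add: inner_vec2 [of "normal_vec v"] add_divide_distrib)
  then show ?thesis by (simp add: inner_vec2 [of v v, symmetric])
qed

lemma column_frame [simp]:
  "column 1 (frame p) = fst p" "column 2 (frame p) = normal_vec (fst p) + snd p *\<^sub>R fst p"
  by (simp_all add: frame_def)

lemma inner_frame:
  "fst p \<bullet> (normal_vec (fst p) + snd p *\<^sub>R fst p) = snd p * (fst p \<bullet> fst p)"
  "(normal_vec (fst p) + snd p *\<^sub>R fst p) \<bullet> (normal_vec (fst p) + snd p *\<^sub>R fst p) =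
     1 / (fst p \<bullet> fst p) + (snd p)\<^sup>2 * (fst p \<bullet> fst p)"
proof -
  have "normal_vec (fst p) \<bullet> fst p = 0" by (simp add: inner_commute)
  then show "fst p \<bullet> (normal_vec (fst p) + snd p *\<^sub>R fst p) = snd p * (fst p \<bullet> fst p)"
    "(normal_vec (fst p) + snd p *\<^sub>R fst p) \<bullet> (normal_vec (fst p) + snd p *\<^sub>R fst p) =
     1 / (fst p \<bullet> fst p) + (snd p)\<^sup>2 * (fst p \<bullet> fst p)"
    by (simp_all add: inner_add_left inner_add_right inner_normal_vec_self power2_eq_square)
qed

text \<open>For x the squared length of the first column, the length condition in
  \<open>frame\<close> coordinates is x <= 1/x + t^2 x. For |t| < 1 the largest such x is the square
  of this radius.\<close>

definition reduced_radius :: "real \<Rightarrow> real" where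
  "reduced_radius t = sqrt (1 / sqrt (1 - t\<^sup>2))"

lemma radius_aux:
  assumes "x > 0" "t\<^sup>2 < 1"
  shows "x \<le> 1 / x + t\<^sup>2 * x \<longleftrightarrow> x \<le> 1 / sqrt (1 - t\<^sup>2)"
    "x < 1 / x + t\<^sup>2 * x \<longleftrightarrow> x < 1 / sqrt (1 - t\<^sup>2)"
proof -
  let ?s = "sqrt (1 - t\<^sup>2)"
  have s: "?s > 0" "?s\<^sup>2 = 1 - t\<^sup>2" using assms by simp_all
  have "x \<le> 1 / x + t\<^sup>2 * x \<longleftrightarrow> (x * ?s)\<^sup>2 \<le> 1\<^sup>2"
    "x < 1 / x + t\<^sup>2 * x \<longleftrightarrow> (x * ?s)\<^sup>2 < 1\<^sup>2"
    unfolding power_mult_distrib s using assms by (simp_all add: field_simps power2_eq_square)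
  moreover have "(x * ?s)\<^sup>2 \<le> 1\<^sup>2 \<longleftrightarrow> x * ?s \<le> 1"
    using assms s by (intro abs_le_square_iff [of "x * ?s" 1, symmetric, THEN trans]) simp
  moreover have "(x * ?s)\<^sup>2 < 1\<^sup>2 \<longleftrightarrow> x * ?s < 1"
    using assms s abs_square_less_1 [of "x * ?s"] by simp
  ultimately show "x \<le> 1 / x + t\<^sup>2 * x \<longleftrightarrow> x \<le> 1 / ?s" "x < 1 / x + t\<^sup>2 * x \<longleftrightarrow> x < 1 / ?s"
    using s by (simp_all add: field_simps)
qed

lemma frame_reduced:
  assumes "v \<noteq> 0"
  shows "frame (v, t) \<in> reduced \<longleftrightarrow> \<bar>t\<bar> \<le> 1/2 \<and> v \<in> cball 0 (reduced_radius t)"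
    "frame (v, t) \<in> strictly_reduced \<longleftrightarrow> \<bar>t\<bar> < 1/2 \<and> v \<in> ball 0 (reduced_radius t)"
proof -
  have vv: "v \<bullet> v > 0" using assms by simp
  have t1: "t\<^sup>2 < 1" if "\<bar>t\<bar> \<le> 1/2"
    using that by (simp add: abs_square_less_1)
  have t: "2 * \<bar>t * (v \<bullet> v)\<bar> \<le> v \<bullet> v \<longleftrightarrow> \<bar>t\<bar> \<le> 1/2" "2 * \<bar>t * (v \<bullet> v)\<bar> < v \<bullet> v \<longleftrightarrow> \<bar>t\<bar> < 1/2"
    using mult_le_cancel_right_pos [OF vv, of "2 * \<bar>t\<bar>" 1] mult_less_cancel_right_pos [OF vv, of "2 * \<bar>t\<bar>" 1]
      vv by (simp_all add: abs_mult mult.commute)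
  have S: "frame (v, t) \<in> SL2" using assms by (simp add: frame_SL2)
  have n: "v \<in> cball 0 (reduced_radius t) \<longleftrightarrow> v \<bullet> v \<le> 1 / sqrt (1 - t\<^sup>2)"
    "v \<in> ball 0 (reduced_radius t) \<longleftrightarrow> v \<bullet> v < 1 / sqrt (1 - t\<^sup>2)"
    unfolding reduced_radius_def by (simp_all add: norm_eq_sqrt_inner)
  show "frame (v, t) \<in> reduced \<longleftrightarrow> \<bar>t\<bar> \<le> 1/2 \<and> v \<in> cball 0 (reduced_radius t)"
    using S inner_frame [of "(v, t)"] t radius_aux(1) [OF vv t1] unfolding n reduced_def
    by auto
  show "frame (v, t) \<in> strictly_reduced \<longleftrightarrow> \<bar>t\<bar> < 1/2 \<and> v \<in> ball 0 (reduced_radius t)"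
    using S inner_frame [of "(v, t)"] t radius_aux(2) [OF vv t1] unfolding n strictly_reduced_def
    by auto
qed

lemma sets_SL2 [measurable]: "SL2 \<in> sets borel"
proof -
  have "SL2 = {g :: real^2^2. g $ 1 $ 1 * g $ 2 $ 2 - g $ 1 $ 2 * g $ 2 $ 1 = 1}"
    by (simp add: SL2_def det_2)
  also have "closed \<dots>" by (intro closed_Collect_eq continuous_intros)
  finally show ?thesis by (rule borel_closed)
qed

lemma sets_reduced [measurable]: "reduced \<in> sets borel" "strictly_reduced \<in> sets borel"
proof -
  have "reduced = {g \<in> space borel. g \<in> SL2 \<and> 2 * \<bar>column 1 g \<bullet> column 2 g\<bar> \<le> column 1 g \<bullet> column 1 g \<and>
     column 1 g \<bullet> column 1 g \<le> column 2 g \<bullet> column 2 g}"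
    by (simp add: reduced_def)
  also have "\<dots> \<in> sets borel" by measurable
  finally show "reduced \<in> sets borel" .
  have "strictly_reduced = {g \<in> space borel. g \<in> SL2 \<and> 2 * \<bar>column 1 g \<bullet> column 2 g\<bar> < column 1 g \<bullet> column 1 g \<and>
     column 1 g \<bullet> column 1 g < column 2 g \<bullet> column 2 g}"
    by (simp add: strictly_reduced_def)
  also have "\<dots> \<in> sets borel" by measurable
  finally show "strictly_reduced \<in> sets borel" .
qed

text \<open>The integrand is the area of the disc of radius \<open>reduced_radius t\<close>, and
  arcsin(1/2) = pi/6.\<close>

lemma nn_integral_arcsin:
  "(\<integral>\<^sup>+t. ennreal (pi / sqrt (1 - t\<^sup>2)) * indicator {- 1/2..1/2} t \<partial>lborel) = ennreal (pi\<^sup>2 / 3)"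
proof -
  have "(\<integral>\<^sup>+t. ennreal (pi / sqrt (1 - t\<^sup>2)) * indicator {- 1/2..1/2} t \<partial>lborel) =
    ennreal (pi * arcsin (1/2) - pi * arcsin (- 1/2))"
  proof (rule nn_integral_FTC_Icc)
    fix t :: real assume "t \<in> {- 1/2..1/2}"
    then have "- 1 < t" "t < 1" by auto
    then show "((\<lambda>t. pi * arcsin t) has_real_derivative pi / sqrt (1 - t\<^sup>2)) (at t)"
      by (auto intro!: derivative_eq_intros simp: divide_inverse)
    have "t\<^sup>2 < 1" using \<open>- 1 < t\<close> \<open>t < 1\<close> by (simp add: abs_square_less_1)
    then show "0 \<le> pi / sqrt (1 - t\<^sup>2)" by simp
  qed simp_all
  also have "arcsin (1/2 :: real) = pi / 6"
    using arcsin_sin [of "pi / 6"] by (simp add: sin_30)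
  also have "arcsin (- 1/2 :: real) = - (pi / 6)"
    using arcsin_sin [of "- (pi / 6)"] by (simp add: sin_30)
  finally show ?thesis by (simp add: power2_eq_square)
qed

lemma emeasure_reduced_disc:
  assumes "\<bar>t\<bar> \<le> 1/2"
  shows "emeasure lborel (cball 0 (reduced_radius t) :: (real^2) set) = ennreal (pi / sqrt (1 - t\<^sup>2))"
    "emeasure lborel (ball 0 (reduced_radius t) :: (real^2) set) = ennreal (pi / sqrt (1 - t\<^sup>2))"
proof -
  have "t\<^sup>2 < 1" using assms by (simp add: abs_square_less_1)
  then show "emeasure lborel (cball 0 (reduced_radius t) :: (real^2) set) = ennreal (pi / sqrt (1 - t\<^sup>2))"
    "emeasure lborel (ball 0 (reduced_radius t) :: (real^2) set) = ennreal (pi / sqrt (1 - t\<^sup>2))"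
    by (simp_all add: emeasure_cball emeasure_ball unit_ball_vol_2 reduced_radius_def)
qed

text \<open>With \<open>v\<close> integrated first, the slice at shear \<open>t\<close> is a closed
  or open disc. The two sets differ only in bounding circles and at |t| = 1/2, which is
  null.\<close>

lemma haar_reduced:
  "(\<integral>\<^sup>+g. indicator reduced g \<partial>haar) = ennreal (pi\<^sup>2 / 3)"
  "(\<integral>\<^sup>+g. indicator strictly_reduced g \<partial>haar) = ennreal (pi\<^sup>2 / 3)"
proof -
  have swap: "(\<integral>\<^sup>+g. f g \<partial>haar) = (\<integral>\<^sup>+t. \<integral>\<^sup>+v. f (frame (v, t)) \<partial>lborel \<partial>lborel)"
    if [measurable]: "f \<in> borel_measurable borel" for f
    unfolding nn_integral_haar [OF that] by (rule lborel_pair.Fubini') simp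
  have nz: "AE v in lborel. v \<noteq> (0 :: real^2)" by (rule AE_lborel_singleton)
  have "(\<integral>\<^sup>+v. indicator reduced (frame (v, t)) \<partial>lborel) = ennreal (pi / sqrt (1 - t\<^sup>2)) * indicator {- 1/2..1/2} t" for t
  proof -
    have "(\<integral>\<^sup>+v. indicator reduced (frame (v, t)) \<partial>lborel) =
      (\<integral>\<^sup>+v. indicator {- 1/2..1/2} t * indicator (cball 0 (reduced_radius t) :: (real^2) set) v \<partial>lborel)"
      using nz by (intro nn_integral_cong_AE) (auto simp: frame_reduced indicator_def abs_le_iff elim!: eventually_mono)
    also have "\<dots> = indicator {- 1/2..1/2} t * emeasure lborel (cball 0 (reduced_radius t) :: (real^2) set)"
      by (rule nn_integral_cmult_indicator) simp
    also have "\<dots> = ennreal (pi / sqrt (1 - t\<^sup>2)) * indicator {- 1/2..1/2} t"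
      by (auto simp: indicator_def emeasure_reduced_disc(1))
    finally show ?thesis .
  qed
  then show "(\<integral>\<^sup>+g. indicator reduced g \<partial>haar) = ennreal (pi\<^sup>2 / 3)"
    by (subst swap) (simp_all only: nn_integral_arcsin, measurable)
  have "(\<integral>\<^sup>+v. indicator strictly_reduced (frame (v, t)) \<partial>lborel) =
      ennreal (pi / sqrt (1 - t\<^sup>2)) * indicator {- 1/2<..<1/2} t" for t
  proof -
    have "(\<integral>\<^sup>+v. indicator strictly_reduced (frame (v, t)) \<partial>lborel) =
      (\<integral>\<^sup>+v. indicator {- 1/2<..<1/2} t * indicator (ball 0 (reduced_radius t) :: (real^2) set) v \<partial>lborel)"
      using nz by (intro nn_integral_cong_AE) (auto simp: frame_reduced indicator_def abs_less_iff elim!: eventually_mono)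
    also have "\<dots> = indicator {- 1/2<..<1/2} t * emeasure lborel (ball 0 (reduced_radius t) :: (real^2) set)"
      by (rule nn_integral_cmult_indicator) simp
    also have "\<dots> = ennreal (pi / sqrt (1 - t\<^sup>2)) * indicator {- 1/2<..<1/2} t"
      by (auto simp: indicator_def emeasure_reduced_disc(2))
    finally show ?thesis .
  qed
  then have "(\<integral>\<^sup>+g. indicator strictly_reduced g \<partial>haar) =
    (\<integral>\<^sup>+t. ennreal (pi / sqrt (1 - t\<^sup>2)) * indicator {- 1/2<..<1/2} t \<partial>lborel)"
    by (subst swap) (simp_all del: nn_integral_indicator)
  also have "\<dots> = (\<integral>\<^sup>+t. ennreal (pi / sqrt (1 - t\<^sup>2)) * indicator {- 1/2..1/2} t \<partial>lborel)"
  proof (rule nn_integral_cong_AE)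
    have "AE t in lborel. t \<noteq> - 1/2 \<and> t \<noteq> (1/2 :: real)"
      by (intro AE_conjI AE_lborel_singleton)
    then show "AE t in lborel. ennreal (pi / sqrt (1 - t\<^sup>2)) * indicator {- 1/2<..<1/2} t =
        ennreal (pi / sqrt (1 - t\<^sup>2)) * indicator {- 1/2..1/2} t"
      by eventually_elim (auto simp: indicator_def)
  qed
  finally show "(\<integral>\<^sup>+g. indicator strictly_reduced g \<partial>haar) = ennreal (pi\<^sup>2 / 3)"
    by (simp only: nn_integral_arcsin)
qed

context invariant_measure begin

theorem nn_integral_basis_sum:
  assumes [measurable]: "f \<in> borel_measurable borel"
  shows "(\<integral>\<^sup>+\<Lambda>. basis_sum f \<Lambda> \<partial>\<mu>) = ennreal (6 / pi\<^sup>2) * (\<integral>\<^sup>+g. f g \<partial>haar)"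
proof -
  let ?M = "\<lambda>f. \<integral>\<^sup>+\<Lambda>. basis_sum f \<Lambda> \<partial>\<mu>"
  have "ennreal (3 / pi\<^sup>2) * ennreal (pi\<^sup>2 / 3) = 1"
    by (simp add: ennreal_mult' [symmetric])
  \<comment> \<open>Cancels a finite factor in \<open>ennreal\<close>, where the means are not yet
    known to be finite.\<close>
  then have c: "ennreal (3 / pi\<^sup>2) * (a * ennreal (pi\<^sup>2 / 3)) = a" for a
    by (simp add: mult.left_commute [of _ a])
  have "?M (indicator strictly_reduced) * ennreal (pi\<^sup>2 / 3) = ?M (indicator reduced) * ennreal (pi\<^sup>2 / 3)"
    using haar_unique [of "indicator strictly_reduced" "indicator reduced"] by (simp add: haar_reduced)
  then have eq: "?M (indicator strictly_reduced) = ?M (indicator reduced)"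
    using c by metis
  have "(\<integral>\<^sup>+\<Lambda>. 2 \<partial>\<mu>) \<le> ?M (indicator reduced)"
    by (intro nn_integral_mono) (simp add: basis_sum_reduced)
  moreover have "?M (indicator strictly_reduced) \<le> (\<integral>\<^sup>+\<Lambda>. 2 \<partial>\<mu>)"
    by (intro nn_integral_mono) (simp add: basis_sum_strictly_reduced)
  ultimately have "?M (indicator reduced) = 2"
    using eq by (simp add: emeasure_space_\<mu>)
  then have "?M f * ennreal (pi\<^sup>2 / 3) = 2 * (\<integral>\<^sup>+g. f g \<partial>haar)"
    using haar_unique [of f "indicator reduced"] by (simp add: haar_reduced)
  then have "?M f = ennreal (3 / pi\<^sup>2) * (2 * (\<integral>\<^sup>+g. f g \<partial>haar))"
    using c [of "?M f"] by simp
  \<comment> \<open>The constant is the common mean 2 divided by the Haar measure pi^2/3.\<close>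
  also have "\<dots> = ennreal (3 / pi\<^sup>2 * 2) * (\<integral>\<^sup>+g. f g \<partial>haar)"
    by (subst ennreal_mult) (simp_all add: mult.assoc)
  finally show ?thesis by simp
qed

end

section \<open>Counting primitive vectors\<close>

text \<open>Primitivity is encoded as extendability to a basis, which ties it directly to
  \<open>basis_sum\<close>.\<close>

definition primitive :: "(real^2) set \<Rightarrow> (real^2) set" where
  "primitive \<Lambda> = column 1 ` bases \<Lambda>"

definition hits :: "(real^2) set \<Rightarrow> (real^2) set set" where
  "hits D = {\<Lambda> \<in> unimodular_lattices. primitive \<Lambda> \<inter> D \<noteq> {}}"

text \<open>In \<open>frame\<close> coordinates the inner product conditions say that
  \<open>t\<close> lies in [0, 1), which selects one basis from each orbit of integral
  shears.\<close>

definition unit_frames :: "(real^2) set \<Rightarrow> (real^2^2) set" where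
  "unit_frames D = {g. column 1 g \<in> D \<and> 0 \<le> column 1 g \<bullet> column 2 g \<and>
     column 1 g \<bullet> column 2 g < column 1 g \<bullet> column 1 g}"

lemma primitiveE:
  assumes "v \<in> primitive \<Lambda>"
  obtains g where "g \<in> bases \<Lambda>" "column 1 g = v"
  using assms by (auto simp: primitive_def)

lemma primitiveI: "g \<in> bases \<Lambda> \<Longrightarrow> column 1 g \<in> primitive \<Lambda>"
  by (simp add: primitive_def)

text \<open>Replacing the basis (v, w) by (w, -v) moves the second vector into first place.\<close>

lemma primitive_column2:
  assumes "g \<in> bases \<Lambda>"
  shows "column 2 g \<in> primitive \<Lambda>"
proof -
  have g: "g \<in> SL2" "\<Lambda> = lattice_of g" using assms by (auto simp: bases_def)
  have "det (cols (column 1 g) (column 2 g)) = 1" using g by (simp add: SL2_def cols_column)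
  then have "cols (column 2 g) (- column 1 g) \<in> bases \<Lambda>"
    unfolding g(2) by (intro basisI g lattice_uminus column_in_lattice) (simp add: det_cols algebra_simps)
  then show ?thesis using primitiveI by fastforce
qed

lemma primitive_uminus: "v \<in> primitive \<Lambda> \<Longrightarrow> - v \<in> primitive \<Lambda>"
  by (metis bases_uminus column_cols(1) primitiveE primitiveI)

lemma primitive_nonzero: "v \<in> primitive \<Lambda> \<Longrightarrow> v \<noteq> 0"
  by (metis bases_SL2 column_SL2_nonzero(1) primitiveE)

lemma primitive_in_lattice: "v \<in> primitive \<Lambda> \<Longrightarrow> v \<in> \<Lambda>"
  by (metis bases_lattice_of column_in_lattice(1) primitiveE)

lemma primitive_act: "h \<in> SL2 \<Longrightarrow> primitive (act h \<Lambda>) = (*v) h ` primitive \<Lambda>"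
  by (simp add: primitive_def bases_act image_image column_mult)

lemma det_primitive_Ints:
  assumes "v \<in> primitive \<Lambda>" "w \<in> primitive \<Lambda>"
  shows "det (cols v w) \<in> \<int>"
proof -
  obtain g where g: "g \<in> bases \<Lambda>" using assms(1) by (auto simp: primitive_def)
  show ?thesis
    by (rule det_lattice_Ints [OF bases_SL2 [OF g]])
      (use assms bases_lattice_of [OF g] primitive_in_lattice in auto)
qed

lemma parallel_primitive:
  assumes "v \<in> primitive \<Lambda>" "w \<in> primitive \<Lambda>" "det (cols v w) = 0"
  shows "w = v \<or> w = - v"
proof -
  obtain g h where "g \<in> bases \<Lambda>" "column 1 g = v" "h \<in> bases \<Lambda>" "column 1 h = w"
    using assms(1,2) by (auto simp: primitive_def)
  then show ?thesis using parallel_columns [of g \<Lambda> h] assms(3) by simp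
qed

lemma primitive_basis:
  assumes "v \<in> primitive \<Lambda>" "w \<in> primitive \<Lambda>" "det (cols v w) = 1"
  shows "cols v w \<in> bases \<Lambda>"
proof -
  obtain g where g: "g \<in> bases \<Lambda>" using assms(1) by (auto simp: primitive_def)
  have "cols v w \<in> bases (lattice_of g)"
    by (rule basisI [OF bases_SL2 [OF g] _ _ assms(3)])
      (use assms bases_lattice_of [OF g] primitive_in_lattice in auto)
  then show ?thesis by (simp add: bases_lattice_of [OF g])
qed

text \<open>Surjectivity: subtract the floor of the shear coordinate. Injectivity: two numbers in
  [0, 1) do not differ by a nonzero integer.\<close>

lemma bij_betw_unit_frames:
  "bij_betw (column 1) (bases \<Lambda> \<inter> unit_frames D) (primitive \<Lambda> \<inter> D)"
  unfolding bij_betw_def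
proof
  show "inj_on (column 1) (bases \<Lambda> \<inter> unit_frames D)"
  proof (rule inj_onI)
    fix g h assume g: "g \<in> bases \<Lambda> \<inter> unit_frames D" and h: "h \<in> bases \<Lambda> \<inter> unit_frames D"
      and eq: "column 1 g = column 1 h"
    obtain k :: int where k: "column 2 h = column 2 g + of_int k *\<^sub>R column 1 g"
      using g h eq bases_same_column by (metis IntD1)
    have "column 1 g \<noteq> 0" using g column_SL2_nonzero bases_SL2 by blast
    then have v: "column 1 g \<bullet> column 1 g > 0" by simp
    have "column 1 g \<bullet> column 2 h = column 1 g \<bullet> column 2 g + of_int k * (column 1 g \<bullet> column 1 g)"
      by (simp add: k inner_add_right)
    then have "\<bar>of_int k * (column 1 g \<bullet> column 1 g)\<bar> < 1 * (column 1 g \<bullet> column 1 g)"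
      using g h eq by (auto simp: unit_frames_def)
    then have "\<bar>of_int k\<bar> * (column 1 g \<bullet> column 1 g) < 1 * (column 1 g \<bullet> column 1 g)"
      by (simp add: abs_mult)
    then have "\<bar>of_int k :: real\<bar> < 1" using v by (simp only: mult_less_cancel_right_pos)
    then have "k = 0" by linarith
    then show "g = h" using k eq by (metis add.right_neutral cols_column of_int_0 scale_zero_left)
  qed
  show "column 1 ` (bases \<Lambda> \<inter> unit_frames D) = primitive \<Lambda> \<inter> D"
  proof
    show "column 1 ` (bases \<Lambda> \<inter> unit_frames D) \<subseteq> primitive \<Lambda> \<inter> D"
      by (auto simp: primitive_def unit_frames_def)
    show "primitive \<Lambda> \<inter> D \<subseteq> column 1 ` (bases \<Lambda> \<inter> unit_frames D)"
    proof
      fix v assume v: "v \<in> primitive \<Lambda> \<inter> D"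
      then obtain g where g: "g \<in> bases \<Lambda>" "column 1 g = v" by (auto simp: primitive_def)
      have v0: "v \<bullet> v > 0" using v primitive_nonzero by auto
      define t where "t = (v \<bullet> column 2 g) / (v \<bullet> v)"
      define h where "h = cols (column 1 g) (column 2 g + of_int (- \<lfloor>t\<rfloor>) *\<^sub>R column 1 g)"
      have h: "h \<in> bases \<Lambda>" unfolding h_def by (rule bases_shear [OF g(1)])
      have "column 1 h \<bullet> column 2 h = (t - of_int \<lfloor>t\<rfloor>) * (v \<bullet> v)"
        using v0 by (simp add: h_def g t_def inner_diff_right left_diff_distrib)
      moreover have "0 \<le> (t - of_int \<lfloor>t\<rfloor>) * (v \<bullet> v)"
        by simp
      moreover have "(t - of_int \<lfloor>t\<rfloor>) * (v \<bullet> v) < 1 * (v \<bullet> v)"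
        using v0 by (intro mult_strict_right_mono) linarith+
      ultimately have "h \<in> unit_frames D"
        using v by (simp add: unit_frames_def) (simp add: h_def g)
      moreover have "column 1 h = v" by (simp add: h_def g)
      ultimately show "v \<in> column 1 ` (bases \<Lambda> \<inter> unit_frames D)" using h by blast
    qed
  qed
qed

lemma basis_sum_unit_frames:
  "basis_sum (indicator (unit_frames D)) \<Lambda> =
     (if finite (primitive \<Lambda> \<inter> D) then of_nat (card (primitive \<Lambda> \<inter> D)) else \<infinity>)"
  using bij_betw_unit_frames [of \<Lambda> D] bij_betw_finite bij_betw_same_card
  unfolding basis_sum_indicator by metis

lemma sets_unit_frames [measurable]:
  assumes [measurable]: "D \<in> sets borel"
  shows "unit_frames D \<in> sets borel"
proof -
  have "unit_frames D = {g \<in> space borel. column 1 g \<in> D \<and> 0 \<le> column 1 g \<bullet> column 2 g \<and>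
     column 1 g \<bullet> column 2 g < column 1 g \<bullet> column 1 g}"
    by (simp add: unit_frames_def)
  also have "\<dots> \<in> sets borel" by measurable
  finally show ?thesis .
qed

text \<open>Each fibre over a vector of \<open>D\<close> contributes the length of [0, 1).\<close>

lemma haar_unit_frames:
  assumes [measurable]: "D \<in> sets borel"
  shows "emeasure haar (unit_frames D) = emeasure lborel D"
proof -
  have "emeasure haar (unit_frames D) = (\<integral>\<^sup>+g. indicator (unit_frames D) g \<partial>haar)" by simp
  also have "\<dots> =
      (\<integral>\<^sup>+v. \<integral>\<^sup>+t. indicator (unit_frames D) (frame (v, t)) \<partial>lborel \<partial>lborel)"
    by (rule nn_integral_haar) simp
  also have "\<dots> = (\<integral>\<^sup>+v. indicator D v \<partial>lborel)"
  proof (rule nn_integral_cong_AE)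
    have "AE v in lborel. v \<noteq> (0 :: real^2)" by (rule AE_lborel_singleton)
    then show "AE v in lborel. (\<integral>\<^sup>+t. indicator (unit_frames D) (frame (v, t)) \<partial>lborel) = indicator D v"
    proof eventually_elim
      case (elim v)
      then have v: "v \<bullet> v > 0" by simp
      have "0 \<le> t * (v \<bullet> v) \<longleftrightarrow> 0 \<le> t" "t * (v \<bullet> v) < v \<bullet> v \<longleftrightarrow> t < 1" for t
        using mult_le_cancel_right_pos [OF v, of 0 t] mult_less_cancel_right_pos [OF v, of t 1]
        by (simp_all only: mult_zero_left mult_1_left)
      then have "frame (v, t) \<in> unit_frames D \<longleftrightarrow> v \<in> D \<and> t \<in> {0..<1}" for t
        using inner_frame(1) [of "(v, t)"] by (simp add: unit_frames_def)
      then have "(\<integral>\<^sup>+t. indicator (unit_frames D) (frame (v, t)) \<partial>lborel) =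
        (\<integral>\<^sup>+t. indicator D v * indicator {0..<1 :: real} t \<partial>lborel)"
        by (intro nn_integral_cong) (auto simp: indicator_def)
      also have "\<dots> = indicator D v * emeasure lborel {0..<1 :: real}"
        by (rule nn_integral_cmult_indicator) simp
      finally show ?case by simp
    qed
  qed
  finally show ?thesis by simp
qed

context invariant_measure begin

text \<open>Hitting \<open>D\<close> is the nonvanishing of a measurable count.\<close>

lemma sets_hits [measurable]:
  assumes [measurable]: "D \<in> sets borel"
  shows "hits D \<in> sets borel_lattices"
proof -
  have "hits D = {\<Lambda> \<in> space borel_lattices. basis_sum (indicator (unit_frames D)) \<Lambda> \<noteq> 0}"
    by (auto simp: hits_def basis_sum_unit_frames)
  also have "\<dots> \<in> sets borel_lattices" by measurable
  finally show ?thesis .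
qed

text \<open>First moment bound: the indicator is at most the number of primitive vectors in
  \<open>D\<close>, whose mean is known.\<close>

lemma emeasure_hits_le:
  assumes [measurable]: "D \<in> sets borel"
  shows "emeasure \<mu> (hits D) \<le> ennreal (6 / pi\<^sup>2) * emeasure lborel D"
proof -
  have "emeasure \<mu> (hits D) = (\<integral>\<^sup>+\<Lambda>. indicator (hits D) \<Lambda> \<partial>\<mu>)" by simp
  also have "\<dots> \<le> (\<integral>\<^sup>+\<Lambda>. basis_sum (indicator (unit_frames D)) \<Lambda> \<partial>\<mu>)"
  proof (rule nn_integral_mono)
    fix \<Lambda>
    show "indicator (hits D) \<Lambda> \<le> basis_sum (indicator (unit_frames D)) \<Lambda>"
      by (auto simp: basis_sum_unit_frames indicator_def hits_def Suc_le_eq card_gt_0_iff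
          simp flip: of_nat_1 simp del: of_nat_Suc)
  qed
  also have "\<dots> = ennreal (6 / pi\<^sup>2) * emeasure lborel D"
    by (simp add: nn_integral_basis_sum haar_unit_frames)
  finally show ?thesis .
qed

text \<open>The first moment bound is sharp when the count only takes the values 0 and 1.\<close>

lemma emeasure_hits_eq:
  assumes [measurable]: "D \<in> sets borel"
    and unique: "\<And>\<Lambda> v w. v \<in> primitive \<Lambda> \<inter> D \<Longrightarrow> w \<in> primitive \<Lambda> \<inter> D \<Longrightarrow> v = w"
  shows "emeasure \<mu> (hits D) = ennreal (6 / pi\<^sup>2) * emeasure lborel D"
proof -
  have "emeasure \<mu> (hits D) = (\<integral>\<^sup>+\<Lambda>. indicator (hits D) \<Lambda> \<partial>\<mu>)" by simp
  also have "\<dots> = (\<integral>\<^sup>+\<Lambda>. basis_sum (indicator (unit_frames D)) \<Lambda> \<partial>\<mu>)"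
  proof (rule nn_integral_cong)
    fix \<Lambda> assume \<Lambda>: "\<Lambda> \<in> space \<mu>"
    show "indicator (hits D) \<Lambda> = basis_sum (indicator (unit_frames D)) \<Lambda>"
    proof (cases "primitive \<Lambda> \<inter> D = {}")
      case True
      then show ?thesis by (simp add: basis_sum_unit_frames hits_def)
    next
      case False
      then obtain v where "primitive \<Lambda> \<inter> D = {v}" using unique by blast
      then show ?thesis using \<Lambda> by (simp add: basis_sum_unit_frames hits_def)
    qed
  qed
  also have "\<dots> = ennreal (6 / pi\<^sup>2) * emeasure lborel D"
    by (simp add: nn_integral_basis_sum haar_unit_frames)
  finally show ?thesis .
qed

lemma measure_act:
  assumes h: "h \<in> SL2" and [measurable]: "A \<in> sets borel_lattices"
  shows "measure \<mu> (act h -` A \<inter> unimodular_lattices) = measure \<mu> A"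
proof -
  have "measure \<mu> A = measure (distr \<mu> \<mu> (act h)) A"
    using inv h by (simp add: invariant_probability_def)
  also have "\<dots> = measure \<mu> (act h -` A \<inter> unimodular_lattices)"
    by (subst measure_distr) (simp_all add: measurable_act h)
  finally show ?thesis by simp
qed

lemma measure_hits_act:
  assumes "h \<in> SL2" and [measurable]: "D \<in> sets borel"
  shows "measure \<mu> (hits {v. h *v v \<in> D}) = measure \<mu> (hits D)"
proof -
  have "act h -` hits D \<inter> unimodular_lattices = hits {v. h *v v \<in> D}"
    by (auto simp: hits_def primitive_act act_unimodular assms)
  then show ?thesis using measure_act [OF assms(1), of "hits D"] by simp
qed

end

section \<open>Primitive vectors in a triangle\<close>

text \<open>\<open>\<epsilon> = 0\<close> is the limiting triangle; a positive
  \<open>\<epsilon>\<close> absorbs the error at finite time. One half of the symmetric figure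
  suffices, as primitive vectors come with their negatives.\<close>

definition triangle :: "real \<Rightarrow> real \<Rightarrow> (real^2) set" where
  "triangle \<epsilon> \<rho> = {v. - \<epsilon> \<le> v $ 1 \<and> - \<epsilon> \<le> v $ 2 \<and> v $ 1 + v $ 2 < \<rho>}"

definition triangle_pairs :: "real \<Rightarrow> (real^2^2) set" where
  "triangle_pairs \<rho> = {g. column 1 g \<in> triangle 0 \<rho> \<and> column 2 g \<in> triangle 0 \<rho>}"

lemma sets_triangle [measurable]: "triangle \<epsilon> \<rho> \<in> sets borel"
proof -
  have "triangle \<epsilon> \<rho> = {v \<in> space borel. - \<epsilon> \<le> v $ 1 \<and> - \<epsilon> \<le> v $ 2 \<and> v $ 1 + v $ 2 < \<rho>}"
    by (simp add: triangle_def)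
  also have "\<dots> \<in> sets borel" by measurable
  finally show ?thesis .
qed

lemma sets_triangle_pairs [measurable]: "triangle_pairs \<rho> \<in> sets borel"
proof -
  have "triangle_pairs \<rho> = {g \<in> space borel. column 1 g \<in> triangle 0 \<rho> \<and> column 2 g \<in> triangle 0 \<rho>}"
    by (simp add: triangle_pairs_def)
  also have "\<dots> \<in> sets borel" by measurable
  finally show ?thesis .
qed

lemma emeasure_vec2:
  assumes [measurable]: "D \<in> sets borel"
  shows "emeasure lborel D = (\<integral>\<^sup>+x. \<integral>\<^sup>+y. indicator D (vector [x, y] :: real^2) \<partial>lborel \<partial>lborel)"
proof -
  have "emeasure lborel D = (\<integral>\<^sup>+v. indicator D v \<partial>lborel)" by simp
  also have "\<dots> = (\<integral>\<^sup>+x. \<integral>\<^sup>+y. indicator D (vector [x, y] :: real^2) \<partial>lborel \<partial>lborel)"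
    by (rule nn_integral_vec2) simp
  finally show ?thesis .
qed

lemma emeasure_triangle:
  assumes "0 \<le> \<rho> + 2 * \<epsilon>"
  shows "emeasure lborel (triangle \<epsilon> \<rho>) = ennreal ((\<rho> + 2 * \<epsilon>)\<^sup>2 / 2)"
proof -
  have "emeasure lborel (triangle \<epsilon> \<rho>) =
    (\<integral>\<^sup>+x. ennreal (\<rho> + \<epsilon> - x) * indicator {- \<epsilon>..\<rho> + \<epsilon>} x \<partial>lborel)"
    unfolding emeasure_vec2 [OF sets_triangle]
  proof (rule nn_integral_cong)
    fix x :: real
    have "(\<integral>\<^sup>+y. indicator (triangle \<epsilon> \<rho>) (vector [x, y] :: real^2) \<partial>lborel) =
      (\<integral>\<^sup>+y. indicator {- \<epsilon>..} x * indicator {- \<epsilon>..<\<rho> - x} y \<partial>lborel)"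
      by (intro nn_integral_cong) (auto simp: triangle_def indicator_def)
    also have "\<dots> = indicator {- \<epsilon>..} x * emeasure lborel {- \<epsilon>..<\<rho> - x}"
      by (rule nn_integral_cmult_indicator) simp
    also have "\<dots> = ennreal (\<rho> + \<epsilon> - x) * indicator {- \<epsilon>..\<rho> + \<epsilon>} x"
      by (cases "- \<epsilon> \<le> \<rho> - x") (auto simp: indicator_def algebra_simps)
    finally show "(\<integral>\<^sup>+y. indicator (triangle \<epsilon> \<rho>) (vector [x, y] :: real^2) \<partial>lborel) =
        ennreal (\<rho> + \<epsilon> - x) * indicator {- \<epsilon>..\<rho> + \<epsilon>} x" .
  qed
  \<comment> \<open>Boundary values of the antiderivative -(\<rho> + \<epsilon> - x)^2 / 2.\<close>
  also have "\<dots> = ennreal ((- ((\<rho> + \<epsilon>) - (\<rho> + \<epsilon>))\<^sup>2 / 2) - (- ((\<rho> + \<epsilon>) - (- \<epsilon>))\<^sup>2 / 2))"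
    by (rule nn_integral_FTC_Icc) (use assms in \<open>auto intro!: derivative_eq_intros simp: field_simps\<close>)
  finally show ?thesis by (simp add: algebra_simps)
qed

text \<open>The Haar measure of \<open>triangle_pairs \<rho>\<close>. For
  \<open>\<rho> \<le> 1\<close> there are no such pairs of determinant 1, since
  \<open>\<rho>^2\<close> bounds the determinant strictly.\<close>

definition pair_volume :: "real \<Rightarrow> real" where
  "pair_volume \<rho> = (if \<rho> \<le> 1 then 0 else \<rho>\<^sup>2 - 1 - 2 * ln \<rho> - 2 * (ln \<rho>)\<^sup>2)"

text \<open>The derivative is 2/x (x^2 - 1 - 2 ln x), nonnegative by ln y <= y - 1 at y = x^2. Since
  \<open>ennreal\<close> sends negative numbers to 0, \<open>haar_triangle_pairs\<close> does not
  settle the sign.\<close>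

lemma pair_volume_nonneg:
  assumes "0 < \<rho>"
  shows "0 \<le> pair_volume \<rho>"
proof (cases "\<rho> \<le> 1")
  case False
  let ?f = "\<lambda>x :: real. x\<^sup>2 - 1 - 2 * ln x - 2 * (ln x)\<^sup>2"
  have "?f 1 \<le> ?f \<rho>"
  proof (rule DERIV_nonneg_imp_nondecreasing [where f = ?f])
    fix x :: real assume x: "1 \<le> x" "x \<le> \<rho>"
    have "ln (x\<^sup>2) \<le> x\<^sup>2 - 1" using x by (intro ln_le_minus_one) simp
    then have "0 \<le> 2 / x * (x\<^sup>2 - 1 - 2 * ln x)" using x by (simp add: ln_realpow)
    moreover have "(?f has_real_derivative 2 / x * (x\<^sup>2 - 1 - 2 * ln x)) (at x)"
      using x by (auto intro!: derivative_eq_intros simp: field_simps power2_eq_square)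
    ultimately show "\<exists>y. (?f has_real_derivative y) (at x) \<and> 0 \<le> y" by blast
  qed (use False in simp)
  then show ?thesis using False by (simp add: pair_volume_def)
qed (simp add: pair_volume_def)

text \<open>With (0, 1/x) as origin of the fibre, the second column is (t x, 1/x + t y), and the
  conditions cut out an interval starting at 0. If \<rho> < 1/x it is empty, which
  \<open>ennreal\<close> of a negative number reproduces.\<close>

lemma triangle_pairs_fibre:
  assumes "x > 0" "y \<ge> 0" "x + y < \<rho>"
  shows "(\<integral>\<^sup>+t. indicator (triangle_pairs \<rho>) (frame (vector [x, y], t)) \<partial>lborel) =
    ennreal ((\<rho> - 1 / x) / (x + y))"
proof -
  let ?v = "vector [x, y] :: real^2"
  have "(\<integral>\<^sup>+t. indicator (triangle_pairs \<rho>) (frame (?v, t)) \<partial>lborel) =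
    (\<integral>\<^sup>+t. indicator (triangle_pairs \<rho>) (cols ?v (vector [0, 1 / x] + t *\<^sub>R ?v)) \<partial>lborel)"
    by (rule nn_integral_frame_fibre) (use assms in \<open>simp_all add: det_cols\<close>)
  also have "\<dots> = (\<integral>\<^sup>+t. indicator {0..<(\<rho> - 1 / x) / (x + y)} t \<partial>lborel)"
  proof (rule nn_integral_cong)
    fix t :: real
    have "cols ?v (vector [0, 1 / x] + t *\<^sub>R ?v) \<in> triangle_pairs \<rho> \<longleftrightarrow>
      0 \<le> t * x \<and> 0 \<le> 1 / x + t * y \<and> t * x + (1 / x + t * y) < \<rho>"
      using assms by (simp add: triangle_pairs_def triangle_def)
    also have "\<dots> \<longleftrightarrow> 0 \<le> t \<and> t * (x + y) < \<rho> - 1 / x"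
    proof -
      have "0 \<le> t * x \<longleftrightarrow> 0 \<le> t" using assms by (simp add: zero_le_mult_iff)
      moreover have "0 \<le> t \<Longrightarrow> 0 \<le> 1 / x + t * y" using assms by simp
      moreover have "t * x + (1 / x + t * y) < \<rho> \<longleftrightarrow> t * (x + y) < \<rho> - 1 / x"
        by (auto simp: algebra_simps)
      ultimately show ?thesis by blast
    qed
    also have "\<dots> \<longleftrightarrow> t \<in> {0..<(\<rho> - 1 / x) / (x + y)}"
      using assms by (simp add: pos_less_divide_eq)
    finally show "indicator (triangle_pairs \<rho>) (cols ?v (vector [0, 1 / x] + t *\<^sub>R ?v)) =
        (indicator {0..<(\<rho> - 1 / x) / (x + y)} t :: ennreal)"
      by (simp add: indicator_def)
  qed
  also have "\<dots> = ennreal ((\<rho> - 1 / x) / (x + y))"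
    by (cases "0 \<le> (\<rho> - 1 / x) / (x + y)") (simp_all add: ennreal_neg)
  finally show ?thesis .
qed

lemma haar_triangle_pairs:
  assumes "\<rho> > 0"
  shows "emeasure haar (triangle_pairs \<rho>) = ennreal (pair_volume \<rho>)"
proof -
  let ?L = "ln \<rho>"
  \<comment> \<open>An antiderivative of what is left after integrating over \<open>t\<close> and
    \<open>y\<close>. With L = ln \<rho> its values are \<rho>^2 at \<rho> and 1 + 2 L + 2 L^2 at
    1/\<rho>.\<close>
  let ?G = "\<lambda>x. \<rho> * (x * ?L - x * ln x + x) + (?L - ln x)\<^sup>2 / 2"
  have "emeasure haar (triangle_pairs \<rho>) = (\<integral>\<^sup>+g. indicator (triangle_pairs \<rho>) g \<partial>haar)" by simp
  also have "\<dots> = (\<integral>\<^sup>+x. \<integral>\<^sup>+y. \<integral>\<^sup>+t. indicator (triangle_pairs \<rho>) (frame (vector [x, y], t)) \<partial>lborel \<partial>lborel \<partial>lborel)"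
    by (simp add: nn_integral_haar nn_integral_vec2 del: nn_integral_indicator)
  also have "\<dots> = (\<integral>\<^sup>+x. ennreal ((\<rho> - 1 / x) * (?L - ln x)) * indicator {1 / \<rho>..\<rho>} x \<partial>lborel)"
  proof (rule nn_integral_cong_AE)
    have "AE x in lborel. x \<noteq> 0 \<and> x \<noteq> \<rho>" by (intro AE_conjI AE_lborel_singleton)
    then show "AE x in lborel. (\<integral>\<^sup>+y. \<integral>\<^sup>+t. indicator (triangle_pairs \<rho>) (frame (vector [x, y], t)) \<partial>lborel \<partial>lborel)
      = ennreal ((\<rho> - 1 / x) * (?L - ln x)) * indicator {1 / \<rho>..\<rho>} x"
    proof eventually_elim
      case (elim x)
      show ?case
      proof (cases "0 < x \<and> x < \<rho>")
        case True
        then have x: "0 < x" "x < \<rho>" by auto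
        have "(\<integral>\<^sup>+y. \<integral>\<^sup>+t. indicator (triangle_pairs \<rho>) (frame (vector [x, y], t)) \<partial>lborel \<partial>lborel) =
          (\<integral>\<^sup>+y. ennreal ((\<rho> - 1 / x) / (x + y)) * indicator {0..\<rho> - x} y \<partial>lborel)"
        proof (rule nn_integral_cong_AE)
          have "AE y in lborel. y \<noteq> \<rho> - x" by (rule AE_lborel_singleton)
          then show "AE y in lborel. (\<integral>\<^sup>+t. indicator (triangle_pairs \<rho>) (frame (vector [x, y], t)) \<partial>lborel) =
              ennreal ((\<rho> - 1 / x) / (x + y)) * indicator {0..\<rho> - x} y"
          proof eventually_elim
            case (elim y)
            show ?case
            proof (cases "0 \<le> y \<and> x + y < \<rho>")
              case True
              then have "indicator {0..\<rho> - x} y = (1 :: ennreal)" by simp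
              with True show ?thesis using x by (simp add: triangle_pairs_fibre)
            next
              case False
              then have "frame (vector [x, y], t) \<notin> triangle_pairs \<rho>" for t
                by (auto simp: triangle_pairs_def triangle_def)
              then show ?thesis using False elim by (auto simp: indicator_def)
            qed
          qed
        qed
        also have "\<dots> = ennreal ((\<rho> - 1 / x) * (?L - ln x)) * indicator {1 / \<rho>..\<rho>} x"
        proof (cases "1 / x \<le> \<rho>")
          case True
          have "(\<integral>\<^sup>+y. ennreal ((\<rho> - 1 / x) / (x + y)) * indicator {0..\<rho> - x} y \<partial>lborel) =
            ennreal ((\<rho> - 1 / x) * ln (x + (\<rho> - x)) - (\<rho> - 1 / x) * ln (x + 0))"
          proof (rule nn_integral_FTC_Icc)
            fix y assume "y \<in> {0..\<rho> - x}"
            then have "0 < x + y" using x by simp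
            then show "((\<lambda>y. (\<rho> - 1 / x) * ln (x + y)) has_real_derivative (\<rho> - 1 / x) / (x + y)) (at y)"
              by (auto intro!: derivative_eq_intros)
            show "0 \<le> (\<rho> - 1 / x) / (x + y)" using \<open>0 < x + y\<close> True by simp
          qed (use x in simp_all)
          also have "\<dots> = ennreal ((\<rho> - 1 / x) * (?L - ln x))"
            by (simp add: right_diff_distrib)
          also have "x \<in> {1 / \<rho>..\<rho>}"
            using x True assms by (simp add: field_simps)
          then have "ennreal ((\<rho> - 1 / x) * (?L - ln x)) =
              ennreal ((\<rho> - 1 / x) * (?L - ln x)) * indicator {1 / \<rho>..\<rho>} x"
            by simp
          finally show ?thesis .
        next
          case False
          then have "x \<notin> {1 / \<rho>..\<rho>}" using x assms by (simp add: field_simps)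
          moreover have "ennreal ((\<rho> - 1 / x) / (x + y)) * indicator {0..\<rho> - x} y = 0" for y
            using False x by (auto simp: indicator_def intro!: ennreal_neg divide_nonpos_pos)
          then have "(\<integral>\<^sup>+y. ennreal ((\<rho> - 1 / x) / (x + y)) * indicator {0..\<rho> - x} y \<partial>lborel) = 0"
            by (simp only: nn_integral_const mult_zero_left)
          ultimately show ?thesis by simp
        qed
        finally show ?thesis .
      next
        case False
        then have "x < 0 \<or> \<rho> < x" using elim by auto
        then have "frame (vector [x, y], t) \<notin> triangle_pairs \<rho>" for y t
          by (auto simp: triangle_pairs_def triangle_def)
        moreover have "x \<notin> {1 / \<rho>..\<rho>}"
          using \<open>x < 0 \<or> \<rho> < x\<close> assms by (auto simp: not_le intro: less_trans)
        ultimately show ?thesis by (simp add: indicator_def)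
      qed
    qed
  qed
  also have "\<dots> = ennreal (pair_volume \<rho>)"
  proof (cases "\<rho> \<le> 1")
    case True
    \<comment> \<open>For \<rho> < 1 the interval is empty; for \<rho> = 1 it is the point 1, where
      the integrand vanishes.\<close>
    have "{1 / \<rho>..\<rho>} \<subseteq> {1}"
    proof
      fix x assume "x \<in> {1 / \<rho>..\<rho>}"
      moreover have "1 \<le> 1 / \<rho>" using True assms by simp
      ultimately show "x \<in> {1}" using True by auto
    qed
    then have "ennreal ((\<rho> - 1 / x) * (?L - ln x)) * indicator {1 / \<rho>..\<rho>} x = 0" for x
      by (cases "x = 1") (use True assms in \<open>auto simp: indicator_def\<close>)
    then have "(\<integral>\<^sup>+x. ennreal ((\<rho> - 1 / x) * (?L - ln x)) * indicator {1 / \<rho>..\<rho>} x \<partial>lborel) = 0"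
      by (simp only: nn_integral_const mult_zero_left)
    then show ?thesis using True by (simp add: pair_volume_def)
  next
    case False
    then have "1 * 1 \<le> \<rho> * \<rho>" by (intro mult_mono) simp_all
    then have le: "1 / \<rho> \<le> \<rho>" using assms by (simp add: pos_divide_le_eq)
    have "(\<integral>\<^sup>+x. ennreal ((\<rho> - 1 / x) * (?L - ln x)) * indicator {1 / \<rho>..\<rho>} x \<partial>lborel) =
      ennreal (?G \<rho> - ?G (1 / \<rho>))"
    proof (rule nn_integral_FTC_Icc)
      fix x assume x: "x \<in> {1 / \<rho>..\<rho>}"
      moreover have "0 < 1 / \<rho>" using assms by simp
      ultimately have x0: "x > 0" by (meson atLeastAtMost_iff less_le_trans)
      then show "(?G has_real_derivative (\<rho> - 1 / x) * (?L - ln x)) (at x)"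
        by (auto intro!: derivative_eq_intros simp: field_simps)
      have "1 / x \<le> \<rho>" "ln x \<le> ?L" using x x0 assms by (simp_all add: field_simps)
      then show "0 \<le> (\<rho> - 1 / x) * (?L - ln x)" by simp
    qed (use le in simp_all)
    also have "?G \<rho> - ?G (1 / \<rho>) = pair_volume \<rho>"
      using False assms by (simp add: pair_volume_def ln_div field_simps power2_eq_square)
    finally show ?thesis .
  qed
  finally show ?thesis .
qed

section \<open>Determinants and primitive vectors in the triangle\<close>

lemma det_triangle:
  assumes "v \<in> triangle 0 \<rho>" "w \<in> triangle 0 \<rho>"
  shows "\<bar>det (cols v w)\<bar> \<le> (v $ 1 + v $ 2) * (w $ 1 + w $ 2)"
proof -
  have nn: "0 \<le> v $ 1" "0 \<le> v $ 2" "0 \<le> w $ 1" "0 \<le> w $ 2"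
    using assms by (auto simp: triangle_def)
  have "0 \<le> v $ 1 * w $ 1" "0 \<le> v $ 1 * w $ 2" "0 \<le> v $ 2 * w $ 1" "0 \<le> v $ 2 * w $ 2"
    using nn by simp_all
  then show ?thesis by (simp add: det_cols algebra_simps abs_le_iff)
qed

lemma det_triangle_less:
  assumes "v \<in> triangle 0 \<rho>" "w \<in> triangle 0 \<rho>"
  shows "\<bar>det (cols v w)\<bar> < \<rho>\<^sup>2"
proof -
  have nn: "0 \<le> v $ 1 + v $ 2" "v $ 1 + v $ 2 < \<rho>" "0 \<le> w $ 1 + w $ 2" "w $ 1 + w $ 2 < \<rho>"
    using assms by (auto simp: triangle_def)
  have "(v $ 1 + v $ 2) * (w $ 1 + w $ 2) < \<rho> * \<rho>"
    using nn by (intro mult_strict_mono') auto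
  then show ?thesis using det_triangle [OF assms] by (simp add: power2_eq_square)
qed

text \<open>The determinant is at most the product of the two coordinate sums, hence by the
  arithmetic-geometric mean at most a quarter of \<open>\<rho>^2\<close>.\<close>

lemma det_triangle_sum:
  assumes "v \<in> triangle 0 \<rho>" "w \<in> triangle 0 \<rho>" "v + w \<in> triangle 0 \<rho>" "\<rho>\<^sup>2 < 2"
  shows "\<bar>det (cols v w)\<bar> < 1"
proof -
  let ?a = "v $ 1 + v $ 2" and ?b = "w $ 1 + w $ 2"
  have nn: "0 \<le> ?a" "0 \<le> ?b" "?a + ?b < \<rho>"
    using assms by (auto simp: triangle_def)
  have "4 * (?a * ?b) = (?a + ?b)\<^sup>2 - (?a - ?b)\<^sup>2" by (simp add: power2_eq_square algebra_simps)
  also have "\<dots> \<le> (?a + ?b)\<^sup>2" by simp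
  also have "\<dots> \<le> \<rho>\<^sup>2" using nn by (intro power_mono) auto
  finally show ?thesis using det_triangle [OF assms(1,2)] assms(4) by linarith
qed

lemma primitive_triangle_not_uminus:
  assumes "v \<in> primitive \<Lambda>" "v \<in> triangle 0 \<rho>" "w \<in> triangle 0 \<rho>"
  shows "w \<noteq> - v"
  using assms primitive_nonzero [OF assms(1)] by (auto simp: triangle_def vec_eq_iff forall_2)

text \<open>The determinant is an integer of absolute value below 2. It is not 0, since that would
  make the vectors equal or opposite, and the triangle contains no opposite primitive
  vectors.\<close>

lemma det_primitive_triangle:
  assumes "v \<in> primitive \<Lambda> \<inter> triangle 0 \<rho>" "w \<in> primitive \<Lambda> \<inter> triangle 0 \<rho>" "v \<noteq> w" "\<rho>\<^sup>2 < 2"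
  shows "det (cols v w) = 1 \<or> det (cols v w) = - 1"
proof -
  have v: "v \<in> primitive \<Lambda>" "v \<in> triangle 0 \<rho>" and w: "w \<in> primitive \<Lambda>" "w \<in> triangle 0 \<rho>"
    using assms by auto
  obtain k :: int where k: "det (cols v w) = of_int k"
    using det_primitive_Ints [OF v(1) w(1)] by (auto elim: Ints_cases)
  have "det (cols v w) \<noteq> 0"
    using parallel_primitive [OF v(1) w(1)] primitive_triangle_not_uminus [OF v w(2)] assms(3) by auto
  moreover have "\<bar>det (cols v w)\<bar> < 2"
    using det_triangle_less [OF v(2) w(2)] assms(4) by linarith
  ultimately have "k \<noteq> 0" "\<bar>k\<bar> < 2" using k by auto
  then have "k = 1 \<or> k = - 1" by linarith
  then show ?thesis using k by auto
qed

lemma cramer: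
  "det (cols v w) *\<^sub>R u = det (cols u w) *\<^sub>R v + det (cols v u) *\<^sub>R w"
  by (simp add: vec_eq_iff forall_2 det_cols algebra_simps)

text \<open>By Cramer's rule \<open>u\<close> is a combination of \<open>v\<close> and
  \<open>w\<close> with coefficients +1 or -1. So one vector is the sum of the other two, against
  \<open>det_triangle_sum\<close>, or all three add up to zero, which nonnegative coordinates
  exclude.\<close>

lemma no_three_primitive_triangle:
  assumes T: "v \<in> triangle 0 \<rho>" "w \<in> triangle 0 \<rho>" "u \<in> triangle 0 \<rho>" and \<rho>: "\<rho>\<^sup>2 < 2"
    and vw: "det (cols v w) = 1" and uw: "det (cols u w) = 1 \<or> det (cols u w) = - 1"
    and vu: "det (cols v u) = 1 \<or> det (cols v u) = - 1"
  shows False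
proof -
  have u: "u = det (cols u w) *\<^sub>R v + det (cols v u) *\<^sub>R w"
    using cramer [of v w u] vw by simp
  consider "u = v + w" | "v = u + w" | "w = v + u" | "u = - v - w"
    using u uw vu by (auto simp: algebra_simps)
  then show False
  proof cases
    case 1
    then show False using det_triangle_sum [OF T(1,2) _ \<rho>] T vw by auto
  next
    case 2
    then show False using det_triangle_sum [OF T(3,2) _ \<rho>] T uw by auto
  next
    case 3
    then show False using det_triangle_sum [OF T(1,3) _ \<rho>] T vu by auto
  next
    case 4
    then have "u $ 1 = - v $ 1 - w $ 1" "u $ 2 = - v $ 2 - w $ 2" by simp_all
    then have "v $ 1 = 0" "v $ 2 = 0" using T by (auto simp: triangle_def)
    then show False using vw by (simp add: det_cols)
  qed
qed

text \<open>The triangle holds 0, 1 or 2 primitive vectors; in the last case exactly one of the two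
  orders is positively oriented, so the pairs correct the count by 1.\<close>

lemma basis_sum_triangle:
  assumes "\<rho>\<^sup>2 < 2" "\<Lambda> \<in> unimodular_lattices"
  shows "basis_sum (indicator (unit_frames (triangle 0 \<rho>))) \<Lambda> =
    indicator (hits (triangle 0 \<rho>)) \<Lambda> + basis_sum (indicator (triangle_pairs \<rho>)) \<Lambda>"
proof -
  let ?P = "primitive \<Lambda> \<inter> triangle 0 \<rho>" and ?B = "bases \<Lambda> \<inter> triangle_pairs \<rho>"
  have B: "column 1 g \<in> ?P \<and> column 2 g \<in> ?P \<and> det (cols (column 1 g) (column 2 g)) = 1" if "g \<in> ?B" for g
    using that primitiveI [of g \<Lambda>] primitive_column2 [of g \<Lambda>] bases_SL2 [of g \<Lambda>]
    by (auto simp: triangle_pairs_def SL2_def cols_column)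
  have B1: "column 1 g \<noteq> column 2 g" if "g \<in> ?B" for g
    using B [OF that] by (auto simp: det_cols)
  have pair: "?P = {v, w} \<and> ?B = {cols v w}" if v: "v \<in> ?P" and w: "w \<in> ?P" and vw: "det (cols v w) = 1" for v w
  proof
    show P: "?P = {v, w}"
    proof (rule ccontr)
      assume "?P \<noteq> {v, w}"
      then obtain u where u: "u \<in> ?P" "u \<noteq> v" "u \<noteq> w" using v w by blast
      show False
        using det_primitive_triangle [of u \<Lambda> \<rho> w] det_primitive_triangle [of v \<Lambda> \<rho> u]
          u v w vw assms(1) no_three_primitive_triangle [of v \<rho> w u] by auto
    qed
    have "cols v w \<in> ?B"
      using primitive_basis [of v \<Lambda> w] v w vw by (simp add: triangle_pairs_def)
    moreover have "g = cols v w" if "g \<in> ?B" for g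
    proof -
      have *: "column 1 g \<in> {v, w}" "column 2 g \<in> {v, w}" "det (cols (column 1 g) (column 2 g)) = 1"
        using B [OF that] unfolding P by auto
      have "det (cols w v) = - 1" using vw by (simp add: det_cols algebra_simps)
      with * B1 [OF that] have "column 1 g = v" "column 2 g = w" by auto
      then show ?thesis using cols_column [of g] by simp
    qed
    ultimately show "?B = {cols v w}" by blast
  qed
  consider "?P = {}" | v where "?P = {v}" | v w where "v \<in> ?P" "w \<in> ?P" "v \<noteq> w"
    by blast
  then show ?thesis
  proof cases
    case 1
    then have "?B = {}" using B by blast
    with 1 show ?thesis by (simp add: basis_sum_unit_frames basis_sum_indicator [of "triangle_pairs \<rho>"] hits_def)
  next
    case 2
    then have "?B = {}" using B B1 by (metis all_not_in_conv singletonD)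
    with 2 show ?thesis
      using assms(2) by (simp add: basis_sum_unit_frames basis_sum_indicator [of "triangle_pairs \<rho>"] hits_def)
  next
    case 3
    have fin: "?thesis" if "v \<in> ?P" "w \<in> ?P" "v \<noteq> w" "det (cols v w) = 1" for v w
      using pair [OF that(1,2,4)] that(3) assms(2)
      by (simp add: basis_sum_unit_frames basis_sum_indicator [of "triangle_pairs \<rho>"] hits_def)
    have "det (cols w v) = - det (cols v w)" by (simp add: det_cols algebra_simps)
    then show ?thesis
      using det_primitive_triangle [OF 3 assms(1)] fin [OF 3] fin [OF 3(2,1)] 3(3) by auto
  qed
qed

context invariant_measure begin

text \<open>Take means in \<open>basis_sum_triangle\<close>: every term but the wanted probability
  is a known Haar integral.\<close>

lemma measure_hits_triangle:
  assumes "0 < \<rho>" "\<rho>\<^sup>2 < 2"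
  shows "measure \<mu> (hits (triangle 0 \<rho>)) = 6 / pi\<^sup>2 * (\<rho>\<^sup>2 / 2 - pair_volume \<rho>)"
proof -
  have pv: "0 \<le> pair_volume \<rho>"
    using assms by (intro pair_volume_nonneg)
  let ?U = "\<integral>\<^sup>+\<Lambda>. basis_sum (indicator (unit_frames (triangle 0 \<rho>))) \<Lambda> \<partial>\<mu>"
  have "?U = (\<integral>\<^sup>+\<Lambda>. indicator (hits (triangle 0 \<rho>)) \<Lambda> + basis_sum (indicator (triangle_pairs \<rho>)) \<Lambda> \<partial>\<mu>)"
    by (rule nn_integral_cong) (simp add: basis_sum_triangle assms)
  also have "\<dots> = emeasure \<mu> (hits (triangle 0 \<rho>)) + (\<integral>\<^sup>+\<Lambda>. basis_sum (indicator (triangle_pairs \<rho>)) \<Lambda> \<partial>\<mu>)"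
    by (subst nn_integral_add) simp_all
  also have "(\<integral>\<^sup>+\<Lambda>. basis_sum (indicator (triangle_pairs \<rho>)) \<Lambda> \<partial>\<mu>) = ennreal (6 / pi\<^sup>2) * ennreal (pair_volume \<rho>)"
    by (simp add: nn_integral_basis_sum haar_triangle_pairs assms)
  also have "\<dots> = ennreal (6 / pi\<^sup>2 * pair_volume \<rho>)"
    by (rule ennreal_mult' [symmetric]) simp
  also have "?U = ennreal (6 / pi\<^sup>2) * ennreal (\<rho>\<^sup>2 / 2)"
    using assms emeasure_triangle [of \<rho> 0] by (simp add: nn_integral_basis_sum haar_unit_frames)
  also have "\<dots> = ennreal (6 / pi\<^sup>2 * (\<rho>\<^sup>2 / 2))"
    by (rule ennreal_mult' [symmetric]) simp
  also have "emeasure \<mu> (hits (triangle 0 \<rho>)) + ennreal (6 / pi\<^sup>2 * pair_volume \<rho>) =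
      ennreal (measure \<mu> (hits (triangle 0 \<rho>)) + 6 / pi\<^sup>2 * pair_volume \<rho>)"
    using pv by (simp add: emeasure_eq_measure)
  finally have "6 / pi\<^sup>2 * (\<rho>\<^sup>2 / 2) = measure \<mu> (hits (triangle 0 \<rho>)) + 6 / pi\<^sup>2 * pair_volume \<rho>"
    using pv by (subst (asm) ennreal_inj) auto
  then show ?thesis by (simp add: right_diff_distrib)
qed

end

section \<open>Renormalization and the limit\<close>

lemma alpha1_attained:
  assumes "\<Lambda> \<in> unimodular_lattices"
  obtains u where "u \<in> \<Lambda>" "u \<noteq> 0" "alpha1 \<Lambda> = 1 / norm u"
    "\<And>v. v \<in> \<Lambda> \<Longrightarrow> v \<noteq> 0 \<Longrightarrow> 1 / norm v \<le> alpha1 \<Lambda>"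
proof -
  obtain u where u: "u \<in> \<Lambda>" "u \<noteq> 0" "\<And>v. v \<in> \<Lambda> \<Longrightarrow> v \<noteq> 0 \<Longrightarrow> norm u \<le> norm v"
    using assms by (rule shortest_vector) blast
  have le: "1 / norm v \<le> 1 / norm u" if "v \<in> \<Lambda>" "v \<noteq> 0" for v
    using u(2) u(3) [OF that] that by (simp add: frac_le)
  have "alpha1 \<Lambda> = 1 / norm u"
    unfolding alpha1_def by (rule cSup_eq_maximum) (use u le in auto)
  with u le that show thesis by metis
qed

lemma alpha1_le_iff:
  assumes "\<Lambda> \<in> unimodular_lattices"
  shows "alpha1 \<Lambda> \<le> c \<longleftrightarrow> (\<forall>v\<in>\<Lambda> - {0}. 1 / norm v \<le> c)"
  using alpha1_attained [OF assms] by (metis DiffE DiffI empty_iff insert_iff order_trans)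

lemma alpha1_pos: "\<Lambda> \<in> unimodular_lattices \<Longrightarrow> 0 < alpha1 \<Lambda>"
  using alpha1_attained by (metis zero_less_divide_1_iff zero_less_norm_iff)

lemma unipotent_nth [simp]:
  "(unipotent t *v v) $ 1 = v $ 1 + t * v $ 2" "(unipotent t *v v) $ 2 = v $ 2"
  by (simp_all add: unipotent_def matrix_vector_mult_def sum_2)

lemma unipotent_SL2 [simp]: "unipotent t \<in> SL2"
  by (simp add: unipotent_def SL2_def det_2)

text \<open>The inverse shear stretches by a bounded factor for bounded time; this bounds the set
  whose supremum enters \<open>E_set\<close>.\<close>

lemma norm_unipotent_ge:
  assumes "0 \<le> t" "t \<le> T"
  shows "norm v \<le> (2 + T) * norm (unipotent t *v v)"
proof -
  let ?w = "unipotent t *v v"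
  have "norm v \<le> \<bar>v $ 1\<bar> + \<bar>v $ 2\<bar>"
    using norm_le_l1_cart [of v] by (simp add: sum_2)
  also have "v $ 1 = ?w $ 1 - t * ?w $ 2" by simp
  also have "\<bar>?w $ 1 - t * ?w $ 2\<bar> \<le> \<bar>?w $ 1\<bar> + t * \<bar>?w $ 2\<bar>"
    using abs_triangle_ineq4 [of "?w $ 1" "t * ?w $ 2"] assms(1) by (simp add: abs_mult)
  also have "v $ 2 = ?w $ 2" by simp
  also have "\<bar>?w $ 1\<bar> + t * \<bar>?w $ 2\<bar> + \<bar>?w $ 2\<bar> \<le> norm ?w + T * norm ?w + norm ?w"
    using assms by (intro add_mono mult_mono component_le_norm_cart) auto
  finally show ?thesis by (simp add: algebra_simps)
qed

definition short_orbit :: "real \<Rightarrow> real \<Rightarrow> (real^2) set" where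
  "short_orbit T \<rho> = {v. \<exists>t\<in>{0..T}. norm (unipotent t *v v) < \<rho> / sqrt T}"

lemma sets_short_orbit [measurable]: "short_orbit T \<rho> \<in> sets borel"
proof -
  have "short_orbit T \<rho> = (\<Union>t\<in>{0..T}. {v. norm (unipotent t *v v) < \<rho> / sqrt T})"
    by (auto simp: short_orbit_def)
  also have "open \<dots>"
    by (intro open_UN ballI open_Collect_less continuous_intros linear_continuous_on
        matrix_vector_mul_bounded_linear)
  finally show ?thesis by (rule borel_open)
qed

lemma E_set_eq:
  assumes "T > 0"
  shows "E_set T r = unimodular_lattices - hits (short_orbit T (exp (- r)))"
proof -
  have "\<Lambda> \<in> E_set T r \<longleftrightarrow> \<Lambda> \<notin> hits (short_orbit T (exp (- r)))" if \<Lambda>: "\<Lambda> \<in> unimodular_lattices" for \<Lambda>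
  proof -
    let ?f = "\<lambda>t. ln (alpha1 (act (unipotent t) \<Lambda>))"
    have uni: "act (unipotent t) \<Lambda> \<in> unimodular_lattices" for t
      using \<Lambda> by (simp add: act_unimodular)
    \<comment> \<open>Over an unbounded set the real-valued \<open>SUP\<close> would carry no
      information.\<close>
    have "bdd_above (?f ` {0..T})"
    proof (rule bdd_aboveI2)
      fix t assume t: "t \<in> {0..T}"
      have "alpha1 (act (unipotent t) \<Lambda>) \<le> (2 + T) * alpha1 \<Lambda>"
        unfolding alpha1_le_iff [OF uni]
      proof
        fix w assume w: "w \<in> act (unipotent t) \<Lambda> - {0}"
        then obtain v where "w = unipotent t *v v" "v \<in> \<Lambda>"
          by (auto simp: act_def)
        with w have v: "w = unipotent t *v v" "v \<in> \<Lambda>" "v \<noteq> 0" and "w \<noteq> 0" by auto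
        have "1 / norm w \<le> (2 + T) * (1 / norm v)"
          using norm_unipotent_ge [of t T v] t v(3) \<open>w \<noteq> 0\<close> by (simp add: v(1) field_simps)
        also have "\<dots> \<le> (2 + T) * alpha1 \<Lambda>"
          using alpha1_attained [OF \<Lambda>] v assms by (intro mult_left_mono) (metis, simp)
        finally show "1 / norm w \<le> (2 + T) * alpha1 \<Lambda>" .
      qed
      then show "?f t \<le> ln ((2 + T) * alpha1 \<Lambda>)"
        using alpha1_pos [OF uni] by (intro ln_mono) auto
    qed
    then have "\<Lambda> \<in> E_set T r \<longleftrightarrow> (\<forall>t\<in>{0..T}. ?f t \<le> r + 1/2 * ln T)"
      using assms \<Lambda> by (simp add: E_set_def cSUP_le_iff)
    also have "\<dots> \<longleftrightarrow> (\<forall>t\<in>{0..T}. \<forall>v\<in>\<Lambda> - {0}. exp (- r) / sqrt T \<le> norm (unipotent t *v v))"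
    proof (rule ball_cong [OF refl])
      fix t
      have "?f t \<le> r + 1/2 * ln T \<longleftrightarrow> alpha1 (act (unipotent t) \<Lambda>) \<le> exp (r + 1/2 * ln T)"
        using alpha1_pos [OF uni] by (metis exp_le_cancel_iff exp_ln)
      also have "exp (r + 1/2 * ln T) = exp r * sqrt T"
        using assms by (simp add: exp_add ln_sqrt [symmetric])
      also have "alpha1 (act (unipotent t) \<Lambda>) \<le> exp r * sqrt T \<longleftrightarrow>
          (\<forall>v\<in>\<Lambda> - {0}. 1 / norm (unipotent t *v v) \<le> exp r * sqrt T)"
        unfolding alpha1_le_iff [OF uni] by (auto simp: act_def SL2_vec_eq_0)
      also have "\<dots> \<longleftrightarrow> (\<forall>v\<in>\<Lambda> - {0}. exp (- r) / sqrt T \<le> norm (unipotent t *v v))"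
      proof (rule ball_cong [OF refl])
        fix v assume "v \<in> \<Lambda> - {0}"
        then have "norm (unipotent t *v v) > 0" by (simp add: SL2_vec_eq_0)
        then show "1 / norm (unipotent t *v v) \<le> exp r * sqrt T \<longleftrightarrow>
            exp (- r) / sqrt T \<le> norm (unipotent t *v v)"
          using assms by (simp add: exp_minus field_simps)
      qed
      finally show "?f t \<le> r + 1/2 * ln T \<longleftrightarrow>
          (\<forall>v\<in>\<Lambda> - {0}. exp (- r) / sqrt T \<le> norm (unipotent t *v v))" .
    qed
    also have "\<dots> \<longleftrightarrow> \<Lambda> \<notin> hits (short_orbit T (exp (- r)))"
    proof
      assume *: "\<forall>t\<in>{0..T}. \<forall>v\<in>\<Lambda> - {0}. exp (- r) / sqrt T \<le> norm (unipotent t *v v)"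
      have "v \<notin> short_orbit T (exp (- r))" if "v \<in> primitive \<Lambda>" for v
        using * primitive_in_lattice [OF that] primitive_nonzero [OF that]
        by (auto simp: short_orbit_def not_less)
      then show "\<Lambda> \<notin> hits (short_orbit T (exp (- r)))"
        by (auto simp: hits_def)
    next
      assume *: "\<Lambda> \<notin> hits (short_orbit T (exp (- r)))"
      show "\<forall>t\<in>{0..T}. \<forall>v\<in>\<Lambda> - {0}. exp (- r) / sqrt T \<le> norm (unipotent t *v v)"
      proof (intro ballI)
        fix t v assume t: "t \<in> {0..T}" and "v \<in> \<Lambda> - {0}"
        \<comment> \<open>At every time a lattice vector is at least as long as the primitive vector
          it is a multiple of.\<close>
        then obtain g k where g: "g \<in> bases \<Lambda>" "k > 0" "v = of_nat k *\<^sub>R column 1 g"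
          using lattice_vector_primitive [OF \<Lambda>, of v] by auto
        have "column 1 g \<notin> short_orbit T (exp (- r))"
          using * primitiveI [OF g(1)] \<Lambda> by (auto simp: hits_def)
        then have "exp (- r) / sqrt T \<le> norm (unipotent t *v column 1 g)"
          using t by (auto simp: short_orbit_def not_less)
        also have "\<dots> \<le> of_nat k * norm (unipotent t *v column 1 g)"
          using g(2) by (simp add: mult_le_cancel_right1)
        also have "\<dots> = norm (unipotent t *v v)"
          by (simp add: g(3) matrix_vector_mult_scaleR)
        finally show "exp (- r) / sqrt T \<le> norm (unipotent t *v v)" .
      qed
    qed
    finally show ?thesis .
  qed
  moreover have "E_set T r \<subseteq> unimodular_lattices" by (auto simp: E_set_def)
  ultimately show ?thesis by blast
qed

text \<open>The diagonal matrix with entries sqrt T and 1/sqrt T times the integral matrix (x, y) ->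
  (-y, x + y). The latter makes the closed first quadrant correspond, up to sign, to the vectors
  whose first coordinate vanishes at some time in [0, T].\<close>

definition renormalize :: "real \<Rightarrow> real^2^2" where
  "renormalize T = vector [vector [0, - sqrt T], vector [1 / sqrt T, 1 / sqrt T]]"

lemma renormalize_SL2: "T > 0 \<Longrightarrow> renormalize T \<in> SL2"
  by (simp add: renormalize_def SL2_def det_2)

text \<open>Multiplying both coordinates by sqrt T clears all denominators.\<close>

lemma renormalize_short_orbit:
  assumes "T > 0" "\<rho> > 0"
  shows "renormalize T *v v \<in> short_orbit T \<rho> \<longleftrightarrow>
    (\<exists>t\<in>{0..T}. (t * (v $ 1 + v $ 2) - T * v $ 2)\<^sup>2 + (v $ 1 + v $ 2)\<^sup>2 < \<rho>\<^sup>2)"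
proof -
  let ?s = "sqrt T"
  have s: "?s > 0" "?s\<^sup>2 = T" using assms by simp_all
  have R: "(renormalize T *v v) $ 1 = - (?s * v $ 2)" "(renormalize T *v v) $ 2 = (v $ 1 + v $ 2) / ?s"
    by (simp_all add: renormalize_def matrix_vector_mult_def sum_2 add_divide_distrib)
  have "norm (unipotent t *v (renormalize T *v v)) < \<rho> / ?s \<longleftrightarrow>
    (t * (v $ 1 + v $ 2) - T * v $ 2)\<^sup>2 + (v $ 1 + v $ 2)\<^sup>2 < \<rho>\<^sup>2" for t
  proof -
    let ?w = "unipotent t *v (renormalize T *v v)"
    have w: "?w $ 1 * ?s = t * (v $ 1 + v $ 2) - T * v $ 2" "?w $ 2 * ?s = v $ 1 + v $ 2"
      using s by (simp_all add: R field_simps power2_eq_square)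
    have "norm ?w < \<rho> / ?s \<longleftrightarrow> norm ?w * ?s < \<rho>"
      using s by (simp add: pos_less_divide_eq)
    also have "\<dots> \<longleftrightarrow> (norm ?w * ?s)\<^sup>2 < \<rho>\<^sup>2"
      using s assms by (intro iffI power_strict_mono) (auto intro: power2_less_imp_less)
    also have "(norm ?w * ?s)\<^sup>2 = (?w $ 1 * ?s)\<^sup>2 + (?w $ 2 * ?s)\<^sup>2"
      unfolding power_mult_distrib power2_norm_eq_inner inner_vec2 by (simp add: power2_eq_square distrib_right)
    finally show ?thesis unfolding w .
  qed
  then show ?thesis by (simp add: short_orbit_def)
qed

text \<open>The witness is the time at which the first coordinate vanishes; the rescaled norm is
  then the coordinate sum.\<close>

lemma triangle_subset_orbit:
  assumes "T > 0" "\<rho> > 0" "v \<in> triangle 0 \<rho>" "v \<noteq> 0"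
  shows "renormalize T *v v \<in> short_orbit T \<rho>"
proof -
  let ?l = "v $ 1 + v $ 2"
  have v: "0 \<le> v $ 1" "0 \<le> v $ 2" "?l < \<rho>" using assms by (auto simp: triangle_def)
  have "?l \<noteq> 0"
    using assms(4) v by (auto simp: vec_eq_iff forall_2)
  then have l: "?l > 0" using v by simp
  have "T * v $ 2 / ?l \<in> {0..T}"
    using l v assms(1) by (simp add: pos_divide_le_eq mult_left_mono)
  moreover have "T * v $ 2 / ?l * ?l - T * v $ 2 = 0" using l by simp
  moreover have "?l\<^sup>2 < \<rho>\<^sup>2" using l v by (intro power_strict_mono) auto
  ultimately show ?thesis
    unfolding renormalize_short_orbit [OF assms(1,2)]
    by (intro bexI [of _ "T * v $ 2 / ?l"]) (simp_all only: power_zero_numeral add_0_left)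
qed

text \<open>Let the coordinate sum l be nonnegative, changing sign if necessary. Then t l lies in
  [0, T l] and within \<rho> of \<open>T * v $ 2\<close>, which bounds both coordinates below by
  -\<rho>/T.\<close>

lemma orbit_subset_triangle:
  assumes "T > 0" "\<rho> > 0" "renormalize T *v v \<in> short_orbit T \<rho>"
  shows "v \<in> triangle (\<rho> / T) \<rho> \<or> - v \<in> triangle (\<rho> / T) \<rho>"
proof -
  have pos: "v \<in> triangle (\<rho> / T) \<rho>"
    if t: "t \<in> {0..T}" and l: "0 \<le> v $ 1 + v $ 2"
      and c: "(t * (v $ 1 + v $ 2) - T * v $ 2)\<^sup>2 + (v $ 1 + v $ 2)\<^sup>2 < \<rho>\<^sup>2" for v :: "real^2" and t
  proof -
    let ?l = "v $ 1 + v $ 2" and ?d = "t * (v $ 1 + v $ 2) - T * v $ 2"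
    have "?l\<^sup>2 < \<rho>\<^sup>2" "?d\<^sup>2 < \<rho>\<^sup>2"
      using c zero_le_power2 [of ?d] zero_le_power2 [of ?l] by linarith+
    then have "\<bar>?l\<bar> < \<rho>" "\<bar>?d\<bar> < \<rho>"
      using assms(2) power2_less_imp_less [of "\<bar>?l\<bar>" \<rho>] power2_less_imp_less [of "\<bar>?d\<bar>" \<rho>] by simp_all
    moreover have "0 \<le> t * ?l" "t * ?l \<le> T * ?l" using t l by (simp_all add: mult_right_mono)
    moreover have "T * ?l = T * v $ 1 + T * v $ 2" by (simp add: algebra_simps)
    ultimately have "- \<rho> \<le> T * v $ 2" "- \<rho> \<le> T * v $ 1" "?l < \<rho>" by linarith+
    then show ?thesis using assms(1) by (simp add: triangle_def field_simps)
  qed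
  obtain t where t: "t \<in> {0..T}" "(t * (v $ 1 + v $ 2) - T * v $ 2)\<^sup>2 + (v $ 1 + v $ 2)\<^sup>2 < \<rho>\<^sup>2"
    using assms(3) unfolding renormalize_short_orbit [OF assms(1,2)] by blast
  show ?thesis
  proof (cases "0 \<le> v $ 1 + v $ 2")
    case True
    then show ?thesis using pos t by blast
  next
    case False
    have eq: "(t * ((- v) $ 1 + (- v) $ 2) - T * (- v) $ 2)\<^sup>2 + ((- v) $ 1 + (- v) $ 2)\<^sup>2 =
        (t * (v $ 1 + v $ 2) - T * v $ 2)\<^sup>2 + (v $ 1 + v $ 2)\<^sup>2"
      by (simp add: power2_eq_square algebra_simps)
    have "- v \<in> triangle (\<rho> / T) \<rho>"
      by (rule pos [OF t(1)]) (use False t(2) in \<open>simp_all only: eq, simp_all\<close>)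
    then show ?thesis by blast
  qed
qed

section \<open>Sandwich bounds, the limit and its continuity\<close>

lemma hits_mono: "D \<subseteq> D' \<Longrightarrow> hits D \<subseteq> hits D'"
  by (auto simp: hits_def)

lemma measure_triangle:
  assumes "0 \<le> \<rho> + 2 * \<epsilon>"
  shows "measure lborel (triangle \<epsilon> \<rho>) = (\<rho> + 2 * \<epsilon>)\<^sup>2 / 2" "triangle \<epsilon> \<rho> \<in> fmeasurable lborel"
  using emeasure_triangle [OF assms] by (simp_all add: measure_def fmeasurable_def)

lemma triangle_mono: "\<epsilon> \<le> \<epsilon>' \<Longrightarrow> \<rho> \<le> \<rho>' \<Longrightarrow> triangle \<epsilon> \<rho> \<subseteq> triangle \<epsilon>' \<rho>'"
  by (auto simp: triangle_def)

context invariant_measure begin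

lemma measure_hits_le:
  assumes "D \<in> fmeasurable lborel"
  shows "measure \<mu> (hits D) \<le> 6 / pi\<^sup>2 * measure lborel D"
proof -
  have "D \<in> sets borel" using assms by (simp add: fmeasurable_def)
  from emeasure_hits_le [OF this] show ?thesis
    using assms by (simp add: emeasure_eq_measure emeasure_eq_measure2 ennreal_mult' [symmetric])
qed

text \<open>A lattice that hits \<open>D'\<close> but not \<open>D\<close> has a primitive vector in
  \<open>D' - D\<close>, to which the first moment bound applies.\<close>

lemma measure_hits_diff:
  assumes D: "D \<in> fmeasurable lborel" "D' \<in> fmeasurable lborel" "D \<subseteq> D'"
  shows "measure \<mu> (hits D') - measure \<mu> (hits D) \<le> 6 / pi\<^sup>2 * (measure lborel D' - measure lborel D)"
proof -
  have [measurable]: "D \<in> sets borel" "D' \<in> sets borel" using assms by (simp_all add: fmeasurable_def)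
  have "hits D' \<subseteq> hits D \<union> hits (D' - D)" by (auto simp: hits_def)
  then have "measure \<mu> (hits D') \<le> measure \<mu> (hits D \<union> hits (D' - D))"
    by (intro finite_measure_mono) simp_all
  also have "\<dots> \<le> measure \<mu> (hits D) + measure \<mu> (hits (D' - D))"
    by (rule measure_Un_le) simp_all
  also have "measure \<mu> (hits (D' - D)) \<le> 6 / pi\<^sup>2 * measure lborel (D' - D)"
    using D by (intro measure_hits_le fmeasurable.Diff) auto
  also have "measure lborel (D' - D) = measure lborel D' - measure lborel D"
    using D by (intro measurable_measure_Diff) (auto simp: fmeasurable_def)
  finally show ?thesis by simp
qed

definition gap_limit :: "real \<Rightarrow> real" where
  "gap_limit r = 1 - measure \<mu> (hits (triangle 0 (exp (- r))))"

lemma measure_compl_hits: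
  assumes [measurable]: "D \<in> sets borel"
  shows "measure \<mu> (unimodular_lattices - hits D) = 1 - measure \<mu> (hits D)"
proof -
  have "measure \<mu> (space \<mu>) = 1" by (simp add: measure_def emeasure_space_\<mu>)
  then show ?thesis using finite_measure_compl [of "hits D"] by simp
qed

text \<open>Invariance under \<open>renormalize T\<close> replaces the short-orbit set by its
  pullback. On primitive vectors this lies, up to sign, between two triangles whose areas differ by
  O(1/T).\<close>

lemma measure_E_set_bounds:
  fixes T r :: real
  assumes "T > 0"
  defines "\<rho> \<equiv> exp (- r)"
  shows "measure \<mu> (E_set T r) \<le> gap_limit r"
    "gap_limit r - 6 / pi\<^sup>2 * ((\<rho> + 2 * (\<rho> / T))\<^sup>2 / 2 - \<rho>\<^sup>2 / 2) \<le> measure \<mu> (E_set T r)"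
proof -
  let ?D = "{v. renormalize T *v v \<in> short_orbit T \<rho>}"
  have \<rho>: "\<rho> > 0" by (simp add: \<rho>_def)
  have "?D = (*v) (renormalize T) -` short_orbit T \<rho> \<inter> space borel" by auto
  also have "\<dots> \<in> sets borel" by (rule measurable_sets [OF borel_measurable_matrix_vector_mult]) simp
  finally have [measurable]: "?D \<in> sets borel" .
  have E: "measure \<mu> (E_set T r) = 1 - measure \<mu> (hits ?D)"
    using assms by (simp add: E_set_eq measure_compl_hits measure_hits_act renormalize_SL2)
  have "hits (triangle 0 \<rho>) \<subseteq> hits ?D"
    using triangle_subset_orbit [OF assms(1) \<rho>] primitive_nonzero by (fastforce simp: hits_def)
  then have "measure \<mu> (hits (triangle 0 \<rho>)) \<le> measure \<mu> (hits ?D)"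
    by (intro finite_measure_mono) simp_all
  then show "measure \<mu> (E_set T r) \<le> gap_limit r"
    by (simp add: E gap_limit_def \<rho>_def)
  have "hits ?D \<subseteq> hits (triangle (\<rho> / T) \<rho>)"
    using orbit_subset_triangle [OF assms(1) \<rho>] primitive_uminus by (fastforce simp: hits_def)
  then have "measure \<mu> (hits ?D) \<le> measure \<mu> (hits (triangle (\<rho> / T) \<rho>))"
    by (intro finite_measure_mono) simp_all
  moreover have "measure \<mu> (hits (triangle (\<rho> / T) \<rho>)) - measure \<mu> (hits (triangle 0 \<rho>)) \<le>
      6 / pi\<^sup>2 * (measure lborel (triangle (\<rho> / T) \<rho>) - measure lborel (triangle 0 \<rho>))"
    using assms \<rho> by (intro measure_hits_diff measure_triangle triangle_mono) simp_all
  moreover have "measure lborel (triangle (\<rho> / T) \<rho>) = (\<rho> + 2 * (\<rho> / T))\<^sup>2 / 2"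
    "measure lborel (triangle 0 \<rho>) = \<rho>\<^sup>2 / 2"
    using assms \<rho> measure_triangle(1) [of \<rho> 0] measure_triangle(1) [of \<rho> "\<rho> / T"] by simp_all
  ultimately show "gap_limit r - 6 / pi\<^sup>2 * ((\<rho> + 2 * (\<rho> / T))\<^sup>2 / 2 - \<rho>\<^sup>2 / 2) \<le> measure \<mu> (E_set T r)"
    by (simp add: E gap_limit_def flip: \<rho>_def)
qed

lemma tendsto_gap_limit: "((\<lambda>T. measure \<mu> (E_set T r)) \<longlongrightarrow> gap_limit r) at_top"
proof (rule tendsto_sandwich)
  let ?\<rho> = "exp (- r)"
  let ?l = "\<lambda>T. gap_limit r - 6 / pi\<^sup>2 * ((?\<rho> + 2 * (?\<rho> / T))\<^sup>2 / 2 - ?\<rho>\<^sup>2 / 2)"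
  show "\<forall>\<^sub>F T in at_top. ?l T \<le> measure \<mu> (E_set T r)"
    using eventually_gt_at_top [of 0] by eventually_elim (rule measure_E_set_bounds)
  show "\<forall>\<^sub>F T in at_top. measure \<mu> (E_set T r) \<le> gap_limit r"
    using eventually_gt_at_top [of 0] by eventually_elim (rule measure_E_set_bounds)
  have "((\<lambda>T. ?\<rho> / T) \<longlongrightarrow> 0) at_top"
    by (intro tendsto_divide_0 [OF tendsto_const] filterlim_at_top_imp_at_infinity filterlim_ident)
  then have "(?l \<longlongrightarrow> gap_limit r - 6 / pi\<^sup>2 * ((?\<rho> + 2 * 0)\<^sup>2 / 2 - ?\<rho>\<^sup>2 / 2)) at_top"
    by (intro tendsto_intros) auto
  then show "(?l \<longlongrightarrow> gap_limit r) at_top" by simp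
qed simp

text \<open>The triangles are nested and have area exp(-2 r)/2, whence half of the constant
  6/pi^2.\<close>

lemma gap_limit_lipschitz:
  "\<bar>gap_limit r - gap_limit s\<bar> \<le> 3 / pi\<^sup>2 * \<bar>exp (- 2 * r) - exp (- 2 * s)\<bar>"
proof -
  have *: "\<bar>gap_limit r - gap_limit s\<bar> \<le> 3 / pi\<^sup>2 * \<bar>exp (- 2 * r) - exp (- 2 * s)\<bar>" if "r \<le> s" for r s
  proof -
    let ?T = "\<lambda>r. triangle 0 (exp (- r))"
    have sub: "?T s \<subseteq> ?T r" using that by (intro triangle_mono) auto
    have "measure \<mu> (hits (?T s)) \<le> measure \<mu> (hits (?T r))"
      using sub by (intro finite_measure_mono hits_mono) simp_all
    moreover have "measure \<mu> (hits (?T r)) - measure \<mu> (hits (?T s)) \<le>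
        6 / pi\<^sup>2 * (measure lborel (?T r) - measure lborel (?T s))"
      using sub by (intro measure_hits_diff measure_triangle) simp_all
    moreover have "measure lborel (?T r) = exp (- 2 * r) / 2" for r
      using measure_triangle(1) [of "exp (- r)" 0] by (simp flip: exp_double)
    moreover have "exp (- 2 * s) \<le> exp (- 2 * r)" using that by simp
    ultimately show ?thesis by (simp add: gap_limit_def abs_if field_simps)
  qed
  show ?thesis
    using * [of r s] * [of s r] by (cases "r \<le> s") (simp_all add: abs_minus_commute)
qed

lemma continuous_gap_limit: "continuous_on UNIV gap_limit"
proof -
  have "(gap_limit \<longlongrightarrow> gap_limit s) (at s)" for s
  proof (rule LIM_zero_cancel)
    have "((\<lambda>r. 3 / pi\<^sup>2 * \<bar>exp (- 2 * r) - exp (- 2 * s)\<bar>) \<longlongrightarrow>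
        3 / pi\<^sup>2 * \<bar>exp (- 2 * s) - exp (- 2 * s)\<bar>) (at s)"
      by (intro tendsto_intros)
    then have "((\<lambda>r. 3 / pi\<^sup>2 * \<bar>exp (- 2 * r) - exp (- 2 * s)\<bar>) \<longlongrightarrow> 0) (at s)" by simp
    then show "((\<lambda>r. gap_limit r - gap_limit s) \<longlongrightarrow> 0) (at s)"
      by (rule Lim_null_comparison [rotated]) (use gap_limit_lipschitz [of _ s] in simp)
  qed
  then show ?thesis by (simp add: continuous_on_def)
qed

lemma gap_limit_eq:
  assumes "- (1/2) * ln 2 < r"
  shows "gap_limit r = 1 - 6 / pi\<^sup>2 * (exp (- 2 * r) / 2 - pair_volume (exp (- r)))"
proof -
  have sq: "(exp (- r))\<^sup>2 = exp (- 2 * r)" by (simp flip: exp_double)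
  \<comment> \<open>The hypothesis on \<open>r\<close> says exactly that the square of exp(-r) is
    below 2.\<close>
  have "exp (- 2 * r) < exp (ln 2)" using assms by (subst exp_less_cancel_iff) simp
  then show ?thesis
    using measure_hits_triangle [of "exp (- r)"] unfolding sq by (simp add: gap_limit_def)
qed

end

section \<open>Bounds in a large triangle\<close>

text \<open>Placed in the second quadrant, where determinants with vectors of the triangle have
  constant sign.\<close>

definition corner_box :: "real \<Rightarrow> (real^2) set" where
  "corner_box d = {v. - d < v $ 1 \<and> v $ 1 < 0 \<and> 0 < v $ 2 \<and> v $ 2 < d}"

lemma sets_corner_box [measurable]: "corner_box d \<in> sets borel"
proof -
  have "corner_box d = {v \<in> space borel. - d < v $ 1 \<and> v $ 1 < 0 \<and> 0 < v $ 2 \<and> v $ 2 < d}"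
    by (simp add: corner_box_def)
  also have "\<dots> \<in> sets borel" by measurable
  finally show ?thesis .
qed

lemma emeasure_corner_box:
  assumes "d > 0"
  shows "emeasure lborel (corner_box d) = ennreal (d\<^sup>2)"
proof -
  have "emeasure lborel (corner_box d) =
    (\<integral>\<^sup>+x. \<integral>\<^sup>+y. indicator {- d<..<0} x * indicator {0<..<d} y \<partial>lborel \<partial>lborel)"
    unfolding emeasure_vec2 [OF sets_corner_box]
    by (intro nn_integral_cong) (auto simp: corner_box_def indicator_def)
  also have "\<dots> = (\<integral>\<^sup>+x. ennreal d * indicator {- d<..<0} x \<partial>lborel)"
  proof (rule nn_integral_cong)
    fix x :: real
    have "(\<integral>\<^sup>+y. indicator {- d<..<0} x * indicator {0<..<d} y \<partial>lborel) =
        indicator {- d<..<0} x * emeasure lborel {0<..<d}"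
      by (rule nn_integral_cmult_indicator) simp
    then show "(\<integral>\<^sup>+y. indicator {- d<..<0} x * indicator {0<..<d} y \<partial>lborel) =
        ennreal d * indicator {- d<..<0} x"
      using assms by (simp add: mult.commute)
  qed
  also have "\<dots> = ennreal d * ennreal d"
    using assms by (simp add: nn_integral_cmult)
  finally show ?thesis
    using assms by (simp add: power2_eq_square ennreal_mult)
qed

text \<open>The determinant is a difference of two numbers in (0, 1), so as an integer it is 0; and
  \<open>- v\<close> lies in the opposite quadrant.\<close>

lemma corner_box_primitive_unique:
  assumes "0 < d" "d \<le> 1" "v \<in> primitive \<Lambda> \<inter> corner_box d" "w \<in> primitive \<Lambda> \<inter> corner_box d"
  shows "v = w"
proof -
  define a b a' b' where "a = - v $ 1" "b = v $ 2" "a' = - w $ 1" "b' = w $ 2"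
  have v: "0 < a" "a < d" "0 < b" "b < d" and w: "0 < a'" "a' < d" "0 < b'" "b' < d"
    using assms by (auto simp: a_b_a'_b'_def corner_box_def)
  have "0 < a * b'" "0 < a' * b" using v w by simp_all
  moreover have "a * b' < 1 * 1" "a' * b < 1 * 1"
    using v w assms(2) by (intro mult_strict_mono'; simp)+
  moreover have "det (cols v w) = a' * b - a * b'"
    by (simp add: det_cols a_b_a'_b'_def)
  ultimately have "\<bar>det (cols v w)\<bar> < 1" by linarith
  moreover have "det (cols v w) \<in> \<int>" using assms by (intro det_primitive_Ints) auto
  ultimately have "det (cols v w) = 0" using Ints_nonzero_abs_less1 by blast
  then have "w = v \<or> w = - v" using assms parallel_primitive by blast
  then show ?thesis
    using v w by (auto simp: a_b_a'_b'_def)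
qed

text \<open>Minus the determinant is a sum of two nonnegative terms and below 1. By integrality both
  terms vanish, which forces \<open>w = 0\<close>.\<close>

lemma corner_box_misses_triangle:
  assumes "\<rho> > 0" "v \<in> primitive \<Lambda>" "v \<in> corner_box (1 / \<rho>)" "w \<in> primitive \<Lambda>"
  shows "w \<notin> triangle 0 \<rho>"
proof
  assume "w \<in> triangle 0 \<rho>"
  then have w: "0 \<le> w $ 1" "0 \<le> w $ 2" "w $ 1 + w $ 2 < \<rho>" by (auto simp: triangle_def)
  define a b where "a = - v $ 1" "b = v $ 2"
  have v: "0 < a" "a < 1 / \<rho>" "0 < b" "b < 1 / \<rho>"
    using assms(3) by (auto simp: a_b_def corner_box_def)
  have det: "- det (cols v w) = a * w $ 2 + b * w $ 1"
    by (simp add: det_cols a_b_def)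
  have "a * w $ 2 + b * w $ 1 \<le> 1 / \<rho> * w $ 2 + 1 / \<rho> * w $ 1"
    using v w by (intro add_mono mult_right_mono) auto
  also have "\<dots> = (w $ 1 + w $ 2) / \<rho>" by (simp add: add_divide_distrib)
  also have "\<dots> < 1" using w assms(1) by simp
  finally have "a * w $ 2 + b * w $ 1 < 1" .
  moreover have "0 \<le> a * w $ 2" "0 \<le> b * w $ 1" using v w by simp_all
  ultimately have "\<bar>det (cols v w)\<bar> < 1" using det by linarith
  moreover have "det (cols v w) \<in> \<int>" using assms by (intro det_primitive_Ints) auto
  ultimately have "det (cols v w) = 0" using Ints_nonzero_abs_less1 by blast
  then have "a * w $ 2 = 0" "b * w $ 1 = 0"
    using det \<open>0 \<le> a * w $ 2\<close> \<open>0 \<le> b * w $ 1\<close> by linarith+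
  then have "w = 0" using v by (simp add: vec_eq_iff forall_2)
  then show False using primitive_nonzero [OF assms(4)] by simp
qed

text \<open>Lagrange's identity and reduction give (|v||w|)^2 <= 1 + (|v||w|)^2 / 4, so (|v||w|)^2
  is at most 4/3 < (3/2)^2; moreover |v| <= |w|, and 3 is twice 3/2.\<close>

lemma reduced_norm_mult:
  assumes "g \<in> reduced"
  shows "norm (column 1 g) * (norm (column 1 g) + norm (column 2 g)) < 3"
proof -
  let ?v = "column 1 g" and ?w = "column 2 g"
  have red: "2 * \<bar>?v \<bullet> ?w\<bar> \<le> ?v \<bullet> ?v" "?v \<bullet> ?v \<le> ?w \<bullet> ?w" and "g \<in> SL2"
    using assms by (auto simp: reduced_def)
  then have d: "?v $ 1 * ?w $ 2 - ?v $ 2 * ?w $ 1 = 1"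
    using det_cols [of ?v ?w] by (simp add: SL2_def cols_column)
  have "(?v \<bullet> ?v) * (?w \<bullet> ?w) = (?v $ 1 * ?w $ 2 - ?v $ 2 * ?w $ 1)\<^sup>2 + (?v \<bullet> ?w)\<^sup>2"
    unfolding inner_vec2 by (simp add: power2_eq_square algebra_simps)
  also have "(?v \<bullet> ?w)\<^sup>2 = \<bar>?v \<bullet> ?w\<bar> * \<bar>?v \<bullet> ?w\<bar>" by (simp add: power2_eq_square)
  also have "\<dots> \<le> ((?v \<bullet> ?v) / 2) * ((?w \<bullet> ?w) / 2)"
    using red by (intro mult_mono) auto
  finally have "(?v \<bullet> ?v) * (?w \<bullet> ?w) \<le> 4 / 3"
    unfolding d by simp
  moreover have "(norm ?v * norm ?w)\<^sup>2 = (?v \<bullet> ?v) * (?w \<bullet> ?w)"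
    by (simp add: power_mult_distrib power2_norm_eq_inner)
  moreover have "4 / 3 < (3 / 2 :: real)\<^sup>2" by (simp add: power2_eq_square)
  ultimately have "(norm ?v * norm ?w)\<^sup>2 < (3 / 2)\<^sup>2" by linarith
  then have "norm ?v * norm ?w < 3 / 2"
    by (rule power2_less_imp_less) simp
  moreover have "norm ?v * norm ?v \<le> norm ?v * norm ?w"
    using red by (intro mult_left_mono) (auto simp: norm_le)
  ultimately show ?thesis by (simp add: distrib_left)
qed

text \<open>Rounding down both coordinates of \<open>c\<close> leaves a remainder with coefficients
  in [0, 1).\<close>

lemma lattice_approx:
  assumes g: "g \<in> bases \<Lambda>"
  obtains n where "n \<in> \<Lambda>" "norm (c - n) \<le> norm (column 1 g) + norm (column 2 g)"
proof -
  let ?v = "column 1 g" and ?w = "column 2 g"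
  have 1: "det (cols ?v ?w) = 1" using bases_SL2 [OF g] by (simp add: SL2_def cols_column)
  define x y where "x = det (cols c ?w)" "y = det (cols ?v c)"
  define n where "n = of_int \<lfloor>x\<rfloor> *\<^sub>R ?v + of_int \<lfloor>y\<rfloor> *\<^sub>R ?w"
  have c: "c = x *\<^sub>R ?v + y *\<^sub>R ?w" using cramer [of ?v ?w c] by (simp add: 1 x_y_def)
  have "norm (c - n) = norm (frac x *\<^sub>R ?v + frac y *\<^sub>R ?w)"
    unfolding n_def frac_def by (subst c) (simp add: algebra_simps)
  also have "\<dots> \<le> frac x * norm ?v + frac y * norm ?w"
    by (rule order_trans [OF norm_triangle_ineq]) (simp add: frac_ge_0)
  also have "\<dots> \<le> 1 * norm ?v + 1 * norm ?w"
    using frac_lt_1 [of x] frac_lt_1 [of y] by (intro add_mono mult_right_mono) auto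
  finally have "norm (c - n) \<le> norm ?v + norm ?w" by simp
  moreover have "n \<in> \<Lambda>"
    using lattice_ofI [of "\<lfloor>x\<rfloor>" g "\<lfloor>y\<rfloor>"] bases_lattice_of [OF g] by (simp add: n_def)
  ultimately show thesis using that by blast
qed

lemma triangle_scale:
  assumes "of_nat k *\<^sub>R v \<in> triangle 0 \<rho>" "k > 0"
  shows "v \<in> triangle 0 \<rho>"
proof -
  have k: "0 \<le> v $ 1" "0 \<le> v $ 2" "of_nat k * (v $ 1 + v $ 2) < \<rho>"
    using assms by (auto simp: triangle_def zero_le_mult_iff distrib_left)
  then have "1 * (v $ 1 + v $ 2) \<le> of_nat k * (v $ 1 + v $ 2)"
    using assms(2) by (intro mult_right_mono) auto
  then show ?thesis using k by (simp add: triangle_def)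
qed

text \<open>The open disc of radius \<rho>/4 about (\<rho>/4, \<rho>/4) lies in the triangle, so
  missing it forces |v| + |w| >= \<rho>/4 for a reduced basis. By \<open>reduced_norm_mult\<close>
  then |v| < 3 / (\<rho>/4), the source of the 12.\<close>

lemma short_vector_of_empty_triangle:
  assumes "\<rho> > 0" "\<Lambda> \<in> unimodular_lattices" "\<Lambda> \<notin> hits (triangle 0 \<rho>)"
  shows "\<Lambda> \<in> hits (ball 0 (12 / \<rho>))"
proof -
  obtain g where g: "g \<in> bases \<Lambda>" "g \<in> reduced" using assms(2) by (rule reduced_basis_exists)
  let ?v = "column 1 g" and ?w = "column 2 g"
  define c :: "real^2" where "c = vector [\<rho> / 4, \<rho> / 4]"
  obtain n where n: "n \<in> \<Lambda>" "norm (c - n) \<le> norm ?v + norm ?w"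
    using lattice_approx [OF g(1)] by metis
  have "\<rho> / 4 \<le> norm ?v + norm ?w"
  proof (rule ccontr)
    assume "\<not> \<rho> / 4 \<le> norm ?v + norm ?w"
    then have "norm (c - n) < \<rho> / 4" using n by linarith
    then have "\<bar>(c - n) $ i\<bar> < \<rho> / 4" for i
      using component_le_norm_cart [of "c - n" i] by linarith
    from this [of 1] this [of 2] have "\<bar>\<rho> / 4 - n $ 1\<bar> < \<rho> / 4" "\<bar>\<rho> / 4 - n $ 2\<bar> < \<rho> / 4"
      by (simp_all add: c_def)
    then have ni: "0 < n $ 1" "0 < n $ 2" "n $ 1 + n $ 2 < \<rho>"
      by linarith+
    then have "n \<noteq> 0" by auto
    then obtain h k where h: "h \<in> bases \<Lambda>" "k > 0" "n = of_nat k *\<^sub>R column 1 h"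
      using lattice_vector_primitive [OF assms(2) n(1)] by metis
    have "n \<in> triangle 0 \<rho>" using ni by (simp add: triangle_def)
    then have "column 1 h \<in> triangle 0 \<rho>" using triangle_scale h by blast
    then show False using assms(2,3) primitiveI [OF h(1)] by (auto simp: hits_def)
  qed
  then have "norm ?v * (\<rho> / 4) \<le> norm ?v * (norm ?v + norm ?w)"
    by (intro mult_left_mono) auto
  also have "\<dots> < 3" by (rule reduced_norm_mult [OF g(2)])
  finally have "?v \<in> ball 0 (12 / \<rho>)" using assms(1) by (simp add: field_simps)
  then show ?thesis using assms(2) primitiveI [OF g(1)] by (auto simp: hits_def)
qed

context invariant_measure begin

text \<open>For \<open>r \<le> 0\<close> the box has side exp r <= 1 and holds at most one primitive
  vector, so its area determines its hitting probability exactly.\<close>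

lemma gap_limit_ge:
  assumes "r \<le> 0"
  shows "6 / pi\<^sup>2 * exp (2 * r) \<le> gap_limit r"
proof -
  let ?Q = "corner_box (1 / exp (- r))"
  have d: "1 / exp (- r) = exp r" by (simp add: exp_minus field_simps)
  have "emeasure \<mu> (hits ?Q) = ennreal (6 / pi\<^sup>2) * ennreal ((exp r)\<^sup>2)"
    unfolding d emeasure_corner_box [OF exp_gt_zero, symmetric]
    by (rule emeasure_hits_eq) (use assms in \<open>auto intro: corner_box_primitive_unique [of "exp r"]\<close>)
  also have "\<dots> = ennreal (6 / pi\<^sup>2 * (exp r)\<^sup>2)"
    by (rule ennreal_mult' [symmetric]) simp
  finally have "measure \<mu> (hits ?Q) = 6 / pi\<^sup>2 * (exp r)\<^sup>2"
    by (rule measure_eq_emeasure_eq_ennreal [rotated]) simp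
  then have Q: "measure \<mu> (hits ?Q) = 6 / pi\<^sup>2 * exp (2 * r)"
    using exp_double [of r] by (simp only:)
  have "hits ?Q \<subseteq> unimodular_lattices - hits (triangle 0 (exp (- r)))"
    using corner_box_misses_triangle [OF exp_gt_zero [of "- r"]] by (fastforce simp: hits_def)
  then have "measure \<mu> (hits ?Q) \<le> measure \<mu> (unimodular_lattices - hits (triangle 0 (exp (- r))))"
    by (intro finite_measure_mono) (use sets.compl_sets [of "hits (triangle 0 (exp (- r)))" \<mu>] in simp_all)
  then show ?thesis by (simp add: Q gap_limit_def measure_compl_hits)
qed

text \<open>144 pi exp(2 r) is the area of the disc of radius 12 exp r that contains a short
  primitive vector.\<close>

lemma gap_limit_le: "gap_limit r \<le> 6 / pi\<^sup>2 * (144 * pi) * exp (2 * r)"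
proof -
  let ?B = "ball 0 (12 / exp (- r)) :: (real^2) set"
  have "unimodular_lattices - hits (triangle 0 (exp (- r))) \<subseteq> hits ?B"
    using short_vector_of_empty_triangle [OF exp_gt_zero] by blast
  then have "gap_limit r \<le> measure \<mu> (hits ?B)"
    unfolding gap_limit_def measure_compl_hits [OF sets_triangle, symmetric]
    by (intro finite_measure_mono) simp_all
  also have "\<dots> \<le> 6 / pi\<^sup>2 * measure lborel ?B"
    by (intro measure_hits_le) (simp add: fmeasurable_def emeasure_ball)
  also have "measure lborel ?B = 144 * pi * (exp r)\<^sup>2"
    by (simp add: circle_area exp_minus power_divide field_simps)
  also have "(exp r)\<^sup>2 = exp (2 * r)"
    by (rule exp_double [symmetric])
  finally show ?thesis by (simp only: mult.assoc)
qed

end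

theorem theorem1p1:
  fixes \<mu> :: "(real^2) set measure"
  assumes "invariant_probability \<mu>"
  shows "\<exists>F :: real \<Rightarrow> real.
    (\<forall>r. ((\<lambda>T. measure \<mu> (E_set T r)) \<longlongrightarrow> F r) at_top) \<and>
    continuous_on UNIV F \<and>
    (\<forall>r>0. F r = 1 - 3 / pi^2 * exp (-2 * r)) \<and>
    (\<forall>r. - (1/2) * ln 2 < r \<and> r \<le> 0 \<longrightarrow>
       F r = 1 - 3 / pi^2 * (- exp (-2 * r) + 4 * r^2 - 4 * r + 2)) \<and>
    (\<exists>C0 C1 :: real. C0 > 0 \<and> C1 > 0 \<and>
       (\<forall>r \<le> - (1/2) * ln 2. C0 * exp (2 * r) \<le> F r \<and> F r \<le> C1 * exp (2 * r)))"
proof -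
  interpret invariant_measure \<mu> by unfold_locales (rule assms)
  have 1: "gap_limit r = 1 - 3 / pi^2 * exp (-2 * r)" if "r > 0" for r
  proof -
    \<comment> \<open>For positive \<open>r\<close> the side exp(-r) is below 1, where
      \<open>pair_volume\<close> vanishes.\<close>
    have "- (1/2) * ln 2 < r" using that ln_gt_zero [of "2 :: real"] by linarith
    then show ?thesis using that by (simp add: gap_limit_eq pair_volume_def)
  qed
  have 2: "gap_limit r = 1 - 3 / pi^2 * (- exp (-2 * r) + 4 * r^2 - 4 * r + 2)"
    if r: "- (1/2) * ln 2 < r" "r \<le> 0" for r
  proof -
    have "(exp (- r))\<^sup>2 = exp (- 2 * r)" by (simp flip: exp_double)
    \<comment> \<open>Here the logarithm of the side is -r. At \<open>r = 0\<close> the definition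
      takes its other branch, and the formula gives 0 there too.\<close>
    then have "pair_volume (exp (- r)) = exp (- 2 * r) - 1 + 2 * r - 2 * r\<^sup>2"
      using r by (cases "r = 0") (simp_all add: pair_volume_def)
    then show ?thesis
      unfolding gap_limit_eq [OF r(1)] by (simp only:) (simp add: field_simps)
  qed
  have "(0 :: real) < ln 2" by simp
  then have "r \<le> 0" if "r \<le> - (1/2) * ln 2" for r :: real using that by linarith
  then have 3: "\<forall>r \<le> - (1/2) * ln 2. 6 / pi\<^sup>2 * exp (2 * r) \<le> gap_limit r \<and>
      gap_limit r \<le> 6 / pi\<^sup>2 * (144 * pi) * exp (2 * r)"
    using gap_limit_ge gap_limit_le by blast
  have "6 / pi\<^sup>2 > 0" "6 / pi\<^sup>2 * (144 * pi) > 0" by simp_all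
  with 1 2 3 tendsto_gap_limit continuous_gap_limit show ?thesis
    by (intro exI [of _ gap_limit] conjI) blast+
qed

end
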